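(* Fix $\varepsilon>0$. Let $G=G_n$ be a sequence of $(n,d,\lambda)$-graphs, where $d=d(n)$ and $\lambda=\lambda(n)$, such that $\frac{d/\lambda}{\log d}\to\infty$ and $\frac{d\log^2 n}{n}\to 0$ as $n\to\infty$. Then, for all sufficiently large $n$, for every vertex $r\in V(G)$ the graph $G$ contains $(1-\varepsilon)d$ independent spanning trees rooted at $r$.
   Context: An $n$-vertex graph $G$ whose adjacency matrix has eigenvalues $\lambda_1\geq\lambda_2\geq\dots\geq\lambda_n$ is an $(n,d,\lambda)$-graph if $G$ is $d$-regular and $\max\{\lambda_2,|\lambda_n|\}\leq\lambda$. Spanning trees $T_1,\dots,T_k$ of a graph $G$, all rooted at the same vertex $r$, are called (vertex-)independent spanning trees rooted at $r$ if for every vertex $v\in V(G)$ the unique $r$–$v$ paths in $T_1,\dots,T_k$ are pairwise internally vertex-disjoint (any two share no vertices other than $r$ and $v$). The asymptotic hypotheses $d/\lambda=\omega(\log d)$ and $d=o(n/\log^2 n)$ are as written, with $\log$ the natural logarithm. *)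

theory Defs
  imports Complex_Main "Graph_Theory.Graph_Theory" "Jordan_Normal_Form.Char_Poly"
begin

text \<open>
  A finite simple graph is a \<^locale>\<open>pair_graph\<close>: a finite loop-free symmetric digraph
  whose arcs are pairs of vertices, so that an edge is a pair of opposite arcs.
\<close>

definition adjacency_mat :: "'a pair_pre_digraph \<Rightarrow> 'a list \<Rightarrow> real mat" where
  "adjacency_mat G vs =
     mat (length vs) (length vs) (\<lambda>(i, j). if (vs ! i, vs ! j) \<in> parcs G then 1 else 0)"

text \<open>
  The list of all adjacency eigenvalues with multiplicity, in non-increasing order. The choice of
  the enumeration of the vertices is immaterial, since another one conjugates the matrix
  by a permutation.
\<close>

definition adjacency_eigenvalues :: "'a pair_pre_digraph \<Rightarrow> real list \<Rightarrow> bool" where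
  "adjacency_eigenvalues G ls \<longleftrightarrow>
     sorted_wrt (\<ge>) ls \<and>
     (\<exists>vs. distinct vs \<and> set vs = pverts G \<and>
           char_poly (adjacency_mat G vs) = (\<Prod>l\<leftarrow>ls. [:- l, 1:]))"

text \<open>
  Lists are indexed from 0, so the second largest and the smallest eigenvalue are \<open>ls ! 1\<close>
  and \<open>ls ! (n - 1)\<close>. The former exists only for \<open>n \<ge> 2\<close>.
\<close>

definition ndl_graph :: "'a pair_pre_digraph \<Rightarrow> nat \<Rightarrow> nat \<Rightarrow> real \<Rightarrow> bool" where
  "ndl_graph G n d lam \<longleftrightarrow>
     pair_graph G \<and> card (pverts G) = n \<and> 2 \<le> n \<and>
     (\<forall>v\<in>pverts G. out_degree (with_proj G) v = d) \<and>
     (\<exists>ls. adjacency_eigenvalues G ls \<and> max (ls ! 1) \<bar>ls ! (n - 1)\<bar> \<le> lam)"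

text \<open>
  The notion \<^const>\<open>spanning_tree\<close> is not used: it excludes directed cycles only, so it
  accepts a transitively oriented triangle, while it rejects every symmetric digraph with an arc
  because of the closed walk \<open>u, v, u\<close>. In a simple graph the undirected cycles are the
  directed cycles of length at least 3.
\<close>

definition undirected_tree :: "'a pair_pre_digraph \<Rightarrow> bool" where
  "undirected_tree T \<longleftrightarrow>
     pair_graph T \<and> Digraph_Component.connected (with_proj T) \<and>
     \<not> (\<exists>p. pre_digraph.cycle (with_proj T) p \<and> 3 \<le> length p)"

definition undirected_spanning_tree :: "'a pair_pre_digraph \<Rightarrow> 'a pair_pre_digraph \<Rightarrow> bool" where
  "undirected_spanning_tree T G \<longleftrightarrow> undirected_tree T \<and> spanning (with_proj T) (with_proj G)"

text \<open>
  The trees are \<open>T 0, \<dots>, T (k - 1)\<close>. The paths \<open>p\<close> and \<open>q\<close> below exist and are unique,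
  as \<open>T i\<close> and \<open>T j\<close> are spanning trees.
\<close>

definition independent_spanning_trees ::
    "'a pair_pre_digraph \<Rightarrow> 'a \<Rightarrow> nat \<Rightarrow> (nat \<Rightarrow> 'a pair_pre_digraph) \<Rightarrow> bool" where
  "independent_spanning_trees G r k T \<longleftrightarrow>
     r \<in> pverts G \<and>
     (\<forall>i<k. undirected_spanning_tree (T i) G) \<and>
     (\<forall>v\<in>pverts G. \<forall>i<k. \<forall>j<k. i \<noteq> j \<longrightarrow>
        (\<forall>p q. pre_digraph.apath (with_proj (T i)) r p v \<and>
               pre_digraph.apath (with_proj (T j)) r q v \<longrightarrow>
               set (pre_digraph.awalk_verts (with_proj (T i)) r p) \<inter>
               set (pre_digraph.awalk_verts (with_proj (T j)) r q) \<subseteq> {r, v}))"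

end

theory Submission
  imports Defs "Jordan_Normal_Form.Schur_Decomposition" "HOL-Analysis.L2_Norm"
    "HOL-Library.FuncSet" "HOL-Library.Disjoint_Sets" "HOL-Real_Asymp.Real_Asymp"
begin

text \<open>
  Let \<open>a\<^sub>1, \<dots>, a\<^sub>k\<close> be \<open>k = \<lceil>(1 - \<epsilon>) d\<rceil>\<close> neighbours of the root. Disjoint connected sets (cores)
  \<open>S\<^sub>i\<close> containing \<open>a\<^sub>i\<close> are constructed such that every vertex \<open>v\<close> reaches all of them along
  paths of the form \<open>v, S\<^sub>i\<close> or \<open>v, u\<^sub>i, S\<^sub>i\<close>, where the \<open>u\<^sub>i\<close> are distinct neighbours of \<open>v\<close> outside
  the cores. The \<open>i\<close>-th tree follows these paths into \<open>S\<^sub>i\<close> and then a spanning tree of \<open>S\<^sub>i\<close> to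
  \<open>a\<^sub>i\<close> and the root.

  Two reservoirs, in which every vertex has a small positive proportion of its neighbours, are
  split off by the local lemma. Colouring the first one randomly, a vertex getting colour \<open>i\<close> with
  probability of order \<open>1 / (d ln d)\<close>, yields sparse seeds for the cores; by expansion the second
  neighbourhood of a set of \<open>\<epsilon> d / 2\<close> neighbours of \<open>v\<close> in that reservoir has size at least of order
  \<open>min n (d\<^sup>3 / \<lambda>\<^sup>2)\<close>, so that, again by the local lemma, the seeds satisfy Hall's condition for the
  \<open>u\<^sub>i\<close> at all vertices simultaneously. Finally the seeds of each colour are connected inside the
  second reservoir by the Friedman--Pippenger method: binary trees are grown from all
  components of a colour until an edge joins two of them, and everything but the connecting
  path is released again. With \<open>j\<close> components left this costs \<open>O(log (n / j))\<close> vertices,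
  which amortizes to \<open>O(log d)\<close> per seed and so fits into the second reservoir.
\<close>

section \<open>The local lemma in uniform product spaces\<close>

text \<open>The matching step dictates both hypotheses. Each seed is later charged O(ln d)
  connecting vertices, so seeds may fill only a proportion of order 1 / ln d of the graph; this
  fixes a palette of \<open>M\<close> equally likely colours, \<open>M\<close> of order d ln d, of
  which at most d are used. A set of s vertices misses a given colour with probability about exp (-
  s / M), and the union bound over all Hall violators at a vertex needs this to be a fixed negative
  power of d. Hence second neighbourhoods of size of order d (ln d)^2 are required; comparison with
  min n (d^3 / \<lambda>^2) asks for d / \<lambda> of order ln d and n of order d (ln d)^2, with
  large constants.

  The obstacle is that d may grow arbitrarily slowly with n, whereas all failure probabilities are
  bounded in terms of d only. Therefore every bad event is made to depend on a ball of radius at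
  most two, where the local lemma applies, and connecting a seed must not cost log n. Randomness is
  always a uniform function between finite sets, so probabilities are ratios of
  cardinalities.\<close>

definition depends_on :: "('a \<Rightarrow> 'c) set \<Rightarrow> 'a set \<Rightarrow> 'a set \<Rightarrow> 'c set \<Rightarrow> bool" where
  "depends_on A Y V C \<longleftrightarrow> A \<subseteq> (V \<rightarrow>\<^sub>E C) \<and>
     (\<forall>f\<in>A. \<forall>g\<in>V \<rightarrow>\<^sub>E C. (\<forall>x\<in>Y. f x = g x) \<longrightarrow> g \<in> A)"

lemma depends_on_D:
  "depends_on A Y V C \<Longrightarrow> f \<in> A \<Longrightarrow> g \<in> V \<rightarrow>\<^sub>E C \<Longrightarrow> (\<And>x. x \<in> Y \<Longrightarrow> f x = g x) \<Longrightarrow> g \<in> A"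
  unfolding depends_on_def by blast

text \<open>Exchanging the values of a pair of functions outside \<open>Y\<close> maps \<open>(A \<inter> B) \<times> \<Omega>\<close> onto \<open>A \<times> B\<close>.\<close>

lemma card_Int_depends_on:
  fixes A B :: "('a \<Rightarrow> 'c) set"
  assumes fin: "finite V" "finite C"
    and A: "depends_on A Y V C" and B: "depends_on B Z V C" and disj: "Y \<inter> Z = {}"
  shows "card (A \<inter> B) * card (V \<rightarrow>\<^sub>E C) = card A * card B"
proof -
  let ?O = "V \<rightarrow>\<^sub>E C"
  define sw where "sw = (\<lambda>(f :: 'a \<Rightarrow> 'c, g :: 'a \<Rightarrow> 'c).
     ((\<lambda>x. if x \<in> Y then f x else g x), (\<lambda>x. if x \<in> Y then g x else f x)))"
  have sub: "A \<subseteq> ?O" "B \<subseteq> ?O" using A B unfolding depends_on_def by auto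
  have invol: "sw (sw p) = p" for p unfolding sw_def by (cases p) (auto simp: fun_eq_iff)
  have mix: "(\<lambda>x. if x \<in> Y then f x else g x) \<in> ?O" if "f \<in> ?O" "g \<in> ?O" for f g
    using that by (auto simp: PiE_iff extensional_def)
  have inj: "inj_on sw S" for S by (metis inj_onI invol)
  have "bij_betw sw ((A \<inter> B) \<times> ?O) (A \<times> B)"
  proof (rule bij_betw_byWitness[where f' = sw])
      show "sw ` ((A \<inter> B) \<times> ?O) \<subseteq> A \<times> B"
    proof
      fix p assume "p \<in> sw ` ((A \<inter> B) \<times> ?O)"
      then obtain f g where fg: "f \<in> A" "f \<in> B" "g \<in> ?O" "p = sw (f, g)" by auto
      have f: "f \<in> ?O" using fg sub by blast
      have 1: "(\<lambda>x. if x \<in> Y then f x else g x) \<in> A"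
        by (rule depends_on_D[OF A fg(1) mix[OF f fg(3)]]) simp
      have 2: "(\<lambda>x. if x \<in> Y then g x else f x) \<in> B"
        by (rule depends_on_D[OF B fg(2) mix[OF fg(3) f]]) (use disj in auto)
      show "p \<in> A \<times> B" using 1 2 fg(4) by (auto simp: sw_def)
    qed
    show "sw ` (A \<times> B) \<subseteq> (A \<inter> B) \<times> ?O"
    proof
      fix p assume "p \<in> sw ` (A \<times> B)"
      then obtain f g where fg: "f \<in> A" "g \<in> B" "p = sw (f, g)" by auto
      have f: "f \<in> ?O" and g: "g \<in> ?O" using fg sub by blast+
      have 1: "(\<lambda>x. if x \<in> Y then f x else g x) \<in> A"
        by (rule depends_on_D[OF A fg(1) mix[OF f g]]) simp
      have 2: "(\<lambda>x. if x \<in> Y then f x else g x) \<in> B"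
        by (rule depends_on_D[OF B fg(2) mix[OF f g]]) (use disj in auto)
      have 3: "(\<lambda>x. if x \<in> Y then g x else f x) \<in> ?O" by (rule mix[OF g f])
      show "p \<in> (A \<inter> B) \<times> ?O" using 1 2 3 fg(3) by (auto simp: sw_def)
    qed
  qed (use invol in auto)
  then have "card ((A \<inter> B) \<times> ?O) = card (A \<times> B)" by (rule bij_betw_same_card)
  then show ?thesis by (simp add: card_cartesian_product)
qed

text \<open>By induction on \<open>S\<close>, every \<open>E i\<close> fills at most a share 1 / (2
  D) of \<open>good S\<close>. The events of \<open>S\<close> that share a coordinate with
  \<open>E i\<close> number at most \<open>D\<close>; without them \<open>S2\<close> remains, and
  \<open>E i\<close> is independent of \<open>good S2\<close>, where its share is at most 1 / (4 D).
  By induction, passing from \<open>good S2\<close> to \<open>good S\<close> loses at most half,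
  which costs the factor 2.\<close>

theorem lovasz_local_lemma:
  fixes E :: "'i \<Rightarrow> ('a \<Rightarrow> 'c) set" and W :: "'i \<Rightarrow> 'a set"
  assumes fin: "finite V" "finite C" "C \<noteq> {}" "finite I" and D: "1 \<le> D"
    and dep: "\<And>i. i \<in> I \<Longrightarrow> depends_on (E i) (W i) V C"
    and deg: "\<And>i. i \<in> I \<Longrightarrow> card {j \<in> I. W j \<inter> W i \<noteq> {}} \<le> D"
    and pr: "\<And>i. i \<in> I \<Longrightarrow> 4 * real D * real (card (E i)) \<le> real (card (V \<rightarrow>\<^sub>E C))"
  shows "\<exists>f \<in> V \<rightarrow>\<^sub>E C. \<forall>i\<in>I. f \<notin> E i"
proof -
  let ?O = "V \<rightarrow>\<^sub>E C"
  define good where "good S = ?O - (\<Union>i\<in>S. E i)" for S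
  have finO: "finite ?O" using fin by (simp add: finite_PiE)
  have Opos: "0 < card ?O" using fin finO by (auto simp: card_gt_0_iff PiE_eq_empty_iff)
  have Esub: "E i \<subseteq> ?O" if "i \<in> I" for i using dep[OF that] unfolding depends_on_def by auto
  have fing: "finite (good S)" for S unfolding good_def using finO by auto
  have dep_good: "depends_on (good S) (- Y) V C" if SI: "S \<subseteq> I" and disj: "\<And>j. j \<in> S \<Longrightarrow> W j \<inter> Y = {}" for S Y
    unfolding depends_on_def
  proof (intro conjI ballI impI)
    show "good S \<subseteq> ?O" by (auto simp: good_def)
    fix f g assume f: "f \<in> good S" and g: "g \<in> ?O" and eq: "\<forall>x\<in>-Y. f x = g x"
    have "g \<notin> E j" if j: "j \<in> S" for j
    proof
      assume gE: "g \<in> E j"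
      have fO: "f \<in> ?O" using f by (auto simp: good_def)
      have jI: "j \<in> I" using j SI by auto
      have "f \<in> E j"
        by (rule depends_on_D[OF dep[OF jI] gE fO]) (metis eq disj[OF j] ComplI disjoint_iff)
      then show False using f j by (auto simp: good_def)
    qed
    then show "g \<in> good S" using g by (auto simp: good_def)
  qed
  have main: "(\<forall>i\<in>I. 2 * real D * card (E i \<inter> good S) \<le> card (good S)) \<and> 0 < card (good S)"
    if "S \<subseteq> I" for S
    using finite_subset[OF that \<open>finite I\<close>] that
  proof (induction S rule: finite_psubset_induct)
    case (psubset S)
    have pos: "0 < card (good S)"
    proof (cases "S = {}")
      case True then show ?thesis using Opos by (simp add: good_def)
    next
      case False
      then obtain i S' where S: "S = insert i S'" "i \<notin> S'" by (meson Set.set_insert all_not_in_conv)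
      have ih: "2 * real D * card (E i \<inter> good S') \<le> card (good S')" "0 < card (good S')"
        using psubset.IH[of S'] psubset.prems S by auto
      have iI: "i \<in> I" using S psubset.prems by auto
      have eq: "good S = good S' - E i \<inter> good S'" using S by (auto simp: good_def)
      have c: "card (good S) = card (good S') - card (E i \<inter> good S')"
        unfolding eq using fing by (intro card_Diff_subset) auto
      have "2 * real (card (E i \<inter> good S')) \<le> 2 * real D * card (E i \<inter> good S')"
        using D by (simp add: mult_right_mono)
      then have "2 * real (card (E i \<inter> good S')) \<le> card (good S')" using ih by linarith
      then show ?thesis using c ih by linarith
    qed
    have "2 * real D * card (E i \<inter> good S) \<le> card (good S)" if i: "i \<in> I" for i
    proof -
      define S1 where "S1 = {j \<in> S. W j \<inter> W i \<noteq> {}}"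
      define S2 where "S2 = S - S1"
      have S: "S1 \<subseteq> S" "S2 \<subseteq> S" "S2 \<subseteq> I" "finite S1" "S1 \<subseteq> I"
        using psubset by (auto simp: S1_def S2_def)
      have "depends_on (good S2) (- W i) V C"
        using dep_good[OF S(3), of "W i"] by (auto simp: S1_def S2_def)
      then have "card (E i \<inter> good S2) * card ?O = card (E i) * card (good S2)"
        using card_Int_depends_on[OF fin(1,2) dep[OF i], of "good S2" "- W i"] by auto
      then have "real (card (E i \<inter> good S2)) * card ?O = real (card (E i)) * card (good S2)"
        by (metis of_nat_mult)
      then have "4 * real D * card (E i \<inter> good S2) * card ?O = 4 * real D * card (E i) * card (good S2)"
        by (simp add: mult.assoc)
      also have "\<dots> \<le> card ?O * card (good S2)"
        using mult_right_mono[OF pr[OF i], of "real (card (good S2))"] by simp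
      finally have e2: "4 * real D * card (E i \<inter> good S2) \<le> card (good S2)"
        using Opos by (simp add: mult.commute)
      have "card (E i \<inter> good S) \<le> card (E i \<inter> good S2)"
        using fing S by (intro card_mono) (auto simp: good_def)
      then have e1: "4 * real D * card (E i \<inter> good S) \<le> 4 * real D * card (E i \<inter> good S2)"
        by (intro mult_left_mono) auto
      have half: "real (card (good S2)) \<le> 2 * card (good S)"
      proof (cases "S1 = {}")
        case True then show ?thesis by (simp add: S2_def)
      next
        case False
        then have psub: "S2 \<subset> S" using S by (auto simp: S2_def)
        have "good S2 \<subseteq> good S \<union> (\<Union>j\<in>S1. E j \<inter> good S2)" by (auto simp: good_def S2_def)
        then have "card (good S2) \<le> card (good S \<union> (\<Union>j\<in>S1. E j \<inter> good S2))"
          using fing S by (intro card_mono) auto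
        also have "\<dots> \<le> card (good S) + card (\<Union>j\<in>S1. E j \<inter> good S2)" by (rule card_Un_le)
        also have "\<dots> \<le> card (good S) + (\<Sum>j\<in>S1. card (E j \<inter> good S2))"
          by (intro add_left_mono card_UN_le S(4))
        finally have c1: "real (card (good S2)) \<le> card (good S) + (\<Sum>j\<in>S1. real (card (E j \<inter> good S2)))"
          by (metis of_nat_add of_nat_le_iff of_nat_sum)
        have "2 * D * (\<Sum>j\<in>S1. real (card (E j \<inter> good S2))) = (\<Sum>j\<in>S1. 2 * real D * card (E j \<inter> good S2))"
          by (simp add: sum_distrib_left)
        also have "\<dots> \<le> (\<Sum>j\<in>S1. real (card (good S2)))"
          using psubset.IH[OF psub S(3)] S by (intro sum_mono) auto
        also have "\<dots> = card S1 * real (card (good S2))" by simp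
        also have "card S1 \<le> card {j \<in> I. W j \<inter> W i \<noteq> {}}"
          using S \<open>finite I\<close> by (intro card_mono) (auto simp: S1_def)
        then have "card S1 * real (card (good S2)) \<le> D * real (card (good S2))"
          using deg[OF i] by (intro mult_right_mono) auto
        finally have "2 * (\<Sum>j\<in>S1. real (card (E j \<inter> good S2))) \<le> real (card (good S2))"
          using D by (simp add: mult.assoc mult.left_commute)
        then show ?thesis using c1 by linarith
      qed
      show ?thesis using e1 e2 half by linarith
    qed
    then show ?case using pos by blast
  qed
  show ?thesis using main[of I] by (auto simp: good_def card_gt_0_iff)
qed

section \<open>Hall's theorem\<close>

text \<open>The Halmos-Vaughan induction. If a nonempty proper subset \<open>J\<close> is tight, it
  is matched into its neighbourhood \<open>U\<close>, and \<open>I - J\<close> inherits the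
  condition outside \<open>U\<close> because \<open>U\<close> has exactly as many elements as
  \<open>J\<close>. Otherwise every nonempty proper subset has an element to spare, so one index may
  take an arbitrary \<open>x\<close>.\<close>

theorem hall_marriage:
  fixes S :: "'i \<Rightarrow> 'b set"
  assumes "finite I" "\<And>i. i \<in> I \<Longrightarrow> finite (S i)"
    and "\<And>J. J \<subseteq> I \<Longrightarrow> card J \<le> card (\<Union>i\<in>J. S i)"
  shows "\<exists>m. inj_on m I \<and> (\<forall>i\<in>I. m i \<in> S i)"
  using assms
proof (induction I arbitrary: S rule: finite_psubset_induct)
  case (psubset I)
  note fin = psubset.prems(1) and hall = psubset.prems(2)
  have finU: "finite (\<Union>i\<in>J. S i)" if "J \<subseteq> I" for J
    using that fin psubset.hyps finite_subset by blast
  show ?case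
  proof (cases "\<exists>J. J \<noteq> {} \<and> J \<subset> I \<and> card J = card (\<Union>i\<in>J. S i)")
    case True
    then obtain J where J: "J \<noteq> {}" "J \<subset> I" "card J = card (\<Union>i\<in>J. S i)" by blast
    define U where "U = (\<Union>i\<in>J. S i)"
    have finJ: "finite J" using J psubset.hyps finite_subset by blast
    have "\<exists>m. inj_on m J \<and> (\<forall>i\<in>J. m i \<in> S i)"
      using J(2) fin hall by (intro psubset.IH) auto
    then obtain m1 where m1: "inj_on m1 J" "\<And>i. i \<in> J \<Longrightarrow> m1 i \<in> S i" by blast
    have "\<exists>m. inj_on m (I - J) \<and> (\<forall>i\<in>I - J. m i \<in> S i - U)"
    proof (rule psubset.IH)
      show "I - J \<subset> I" using J by auto
      show "finite (S i - U)" if "i \<in> I - J" for i using that fin by auto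
      fix K assume K: "K \<subseteq> I - J"
      have finK: "finite K" using K psubset.hyps finite_subset by blast
      have "card (K \<union> J) \<le> card (\<Union>i\<in>K \<union> J. S i)" using K J by (intro hall) auto
      also have "card (K \<union> J) = card K + card J" using finK finJ K by (intro card_Un_disjoint) auto
      also have "(\<Union>i\<in>K \<union> J. S i) = (\<Union>i\<in>K. S i - U) \<union> U" by (auto simp: U_def)
      also have "card \<dots> = card (\<Union>i\<in>K. S i - U) + card U"
      proof (intro card_Un_disjoint)
        show "finite (\<Union>i\<in>K. S i - U)" using finK K fin by auto
        show "finite U" unfolding U_def using finU J by auto
      qed auto
      finally show "card K \<le> card (\<Union>i\<in>K. S i - U)" using J(3) U_def by simp
    qed
    then obtain m2 where m2: "inj_on m2 (I - J)" "\<And>i. i \<in> I - J \<Longrightarrow> m2 i \<in> S i - U" by blast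
    define m where "m i = (if i \<in> J then m1 i else m2 i)" for i
    have "m i \<in> U" if "i \<in> J" for i using m1 that by (auto simp: m_def U_def)
    moreover have "m i \<notin> U" if "i \<in> I - J" for i using m2 that by (auto simp: m_def)
    ultimately have cross: "m i \<noteq> m j" if "i \<in> J" "j \<in> I - J" for i j using that by metis
    have "inj_on m I"
    proof (rule inj_onI)
      fix i j assume ij: "i \<in> I" "j \<in> I" "m i = m j"
      have "i \<in> J \<longleftrightarrow> j \<in> J" using cross[of i j] cross[of j i] ij by auto
      then show "i = j"
        using ij inj_onD[OF m1(1), of i j] inj_onD[OF m2(1), of i j] by (auto simp: m_def split: if_splits)
    qed
    moreover have "\<forall>i\<in>I. m i \<in> S i" using m1 m2 by (auto simp: m_def)
    ultimately show ?thesis by blast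
  next
    case False
    show ?thesis
    proof (cases "I = {}")
      case False
      then obtain i where i: "i \<in> I" by auto
      have "card {i} \<le> card (\<Union>i\<in>{i}. S i)" using i by (intro hall) auto
      then have "S i \<noteq> {}" by auto
      then obtain x where x: "x \<in> S i" by auto
      have "\<exists>m. inj_on m (I - {i}) \<and> (\<forall>j\<in>I - {i}. m j \<in> S j - {x})"
      proof (rule psubset.IH)
        show "I - {i} \<subset> I" using i by auto
        show "finite (S j - {x})" if "j \<in> I - {i}" for j using that fin by auto
        fix K assume K: "K \<subseteq> I - {i}"
        show "card K \<le> card (\<Union>j\<in>K. S j - {x})"
        proof (cases "K = {}")
          case nonempty: False
          have KI: "K \<subset> I" "K \<subseteq> I" using K i by auto
          then have "card K \<noteq> card (\<Union>j\<in>K. S j)" using \<open>\<nexists>J. _ J\<close> nonempty by blast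
          moreover have "card K \<le> card (\<Union>j\<in>K. S j)" using KI by (intro hall) auto
          ultimately have "card K \<le> card (\<Union>j\<in>K. S j) - 1" by linarith
          also have "\<dots> \<le> card ((\<Union>j\<in>K. S j) - {x})"
            using finU[OF KI(2)] by (simp add: card_Diff_singleton_if)
          also have "(\<Union>j\<in>K. S j) - {x} = (\<Union>j\<in>K. S j - {x})" by auto
          finally show ?thesis .
        qed auto
      qed
      then obtain m where m: "inj_on m (I - {i})" "\<And>j. j \<in> I - {i} \<Longrightarrow> m j \<in> S j - {x}" by blast
      have "inj_on (m(i := x)) I"
      proof (rule inj_onI)
        fix j j' assume "j \<in> I" "j' \<in> I" "(m(i := x)) j = (m(i := x)) j'"
        then show "j = j'"
          using m(2)[of j] m(2)[of j'] inj_onD[OF m(1), of j j'] by (auto split: if_splits)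
      qed
      moreover have "\<forall>j\<in>I. (m(i := x)) j \<in> S j" using m x by auto
      ultimately show ?thesis by blast
    qed auto
  qed
qed

section \<open>Tail bounds for uniform random functions\<close>

text \<open>The unnormalized generating function of a binomial variable; it factorizes over the
  coordinates. The three tail bounds below take s = 2, 1/2 and 0.\<close>

lemma sum_PiE_weight:
  fixes s :: real
  assumes fin: "finite V" "finite C" and Y: "Y \<subseteq> V" and T: "T \<subseteq> C" and C: "C \<noteq> {}"
  shows "(\<Sum>f \<in> V \<rightarrow>\<^sub>E C. s ^ card {y \<in> Y. f y \<in> T}) =
    real (card (V \<rightarrow>\<^sub>E C)) * (1 + (s - 1) * card T / card C) ^ card Y"
proof -
  have finY: "finite Y" and finT: "finite T" using fin Y T finite_subset by auto
  have cC: "0 < card C" using C fin by (simp add: card_gt_0_iff)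
  have "s ^ card {y \<in> Y. f y \<in> T} = (\<Prod>y\<in>V. if y \<in> Y \<and> f y \<in> T then s else 1)" for f
  proof -
    have "(\<Prod>y\<in>V. if y \<in> Y \<and> f y \<in> T then s else 1) = (\<Prod>y\<in>{y\<in>V. y \<in> Y \<and> f y \<in> T}. s)"
      using prod.inter_filter[OF fin(1), of "\<lambda>_. s" "\<lambda>y. y \<in> Y \<and> f y \<in> T"] by simp
    also have "{y\<in>V. y \<in> Y \<and> f y \<in> T} = {y \<in> Y. f y \<in> T}" using Y by auto
    finally show ?thesis by simp
  qed
  then have "(\<Sum>f \<in> V \<rightarrow>\<^sub>E C. s ^ card {y \<in> Y. f y \<in> T}) =
      (\<Sum>f \<in> V \<rightarrow>\<^sub>E C. \<Prod>y\<in>V. if y \<in> Y \<and> f y \<in> T then s else 1)" by simp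
  also have "\<dots> = (\<Prod>y\<in>V. \<Sum>c\<in>C. if y \<in> Y \<and> c \<in> T then s else 1)"
    using fin by (subst prod_sum_PiE) auto
  also have "\<dots> = (\<Prod>y\<in>V. card C * (if y \<in> Y then 1 + (s - 1) * card T / card C else 1))"
  proof (intro prod.cong refl)
    fix y assume "y \<in> V"
    have cTC: "card T \<le> card C" using card_mono[OF fin(2) T] .
    have "(\<Sum>c\<in>C. if c \<in> T then s else 1) = (\<Sum>c\<in>T. s) + (\<Sum>c\<in>C - T. 1)"
      using fin(2) T by (simp add: sum.If_cases Int_absorb1 Diff_eq)
    also have "\<dots> = card T * s + (real (card C) - real (card T))"
      using T fin finT cTC by (simp add: card_Diff_subset of_nat_diff)
    finally have e: "(\<Sum>c\<in>C. if c \<in> T then s else 1) = card T * s + (real (card C) - real (card T))" .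
    have "card C * (1 + (s - 1) * card T / card C) = card C + (s - 1) * card T"
      using cC by (simp add: field_simps)
    then show "(\<Sum>c\<in>C. if y \<in> Y \<and> c \<in> T then s else 1) =
        card C * (if y \<in> Y then 1 + (s - 1) * card T / card C else 1)"
      using e by (cases "y \<in> Y") (simp_all add: algebra_simps)
  qed
  also have "\<dots> = real (card C) ^ card V * (1 + (s - 1) * card T / card C) ^ card Y"
  proof -
    have "V \<inter> {y. y \<in> Y} = Y" using Y by auto
    then show ?thesis using fin by (simp add: prod.distrib prod.If_cases)
  qed
  also have "real (card C) ^ card V = card (V \<rightarrow>\<^sub>E C)" using fin by (simp add: card_PiE)
  finally show ?thesis by simp
qed

text \<open>Markov's inequality for the weight 2 to the count, with exp (1/2) \<le> 2 to bring in
  the threshold. A threshold of four times the mean leaves exp of minus the mean.\<close>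

lemma card_upper_tail:
  fixes a :: real
  assumes fin: "finite V" "finite C" and Y: "Y \<subseteq> V" and T: "T \<subseteq> C" and C: "C \<noteq> {}"
  shows "card {f \<in> V \<rightarrow>\<^sub>E C. a \<le> card {y \<in> Y. f y \<in> T}}
     \<le> card (V \<rightarrow>\<^sub>E C) * exp (real (card Y) * card T / card C - a / 2)"
proof -
  let ?O = "V \<rightarrow>\<^sub>E C" let ?X = "\<lambda>f. card {y \<in> Y. f y \<in> T}"
  have finO: "finite ?O" using fin by (simp add: finite_PiE)
  have e2: "exp (1/2 :: real) \<le> 2" using exp_bound_half[of "1/2::real"] by simp
  have "card {f \<in> ?O. a \<le> ?X f} * exp (a / 2) = (\<Sum>f\<in>{f \<in> ?O. a \<le> ?X f}. exp (a / 2))" by simp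
  also have "\<dots> \<le> (\<Sum>f\<in>{f \<in> ?O. a \<le> ?X f}. 2 ^ ?X f)"
  proof (intro sum_mono)
    fix f assume "f \<in> {f \<in> ?O. a \<le> ?X f}"
    then have "exp (a / 2) \<le> exp (real (?X f) * (1/2))" by simp
    also have "\<dots> = exp (1/2) ^ ?X f" by (rule exp_of_nat_mult)
    also have "\<dots> \<le> 2 ^ ?X f" using e2 by (intro power_mono) auto
    finally show "exp (a / 2) \<le> 2 ^ ?X f" .
  qed
  also have "\<dots> \<le> (\<Sum>f\<in>?O. 2 ^ ?X f)" using finO by (intro sum_mono2) auto
  also have "\<dots> = card ?O * (1 + card T / card C) ^ card Y"
    using sum_PiE_weight[OF fin Y T C, of 2] by simp
  also have "\<dots> \<le> card ?O * exp (card T / card C) ^ card Y"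
    by (intro mult_left_mono power_mono) (auto simp: exp_ge_add_one_self)
  also have "exp (card T / card C) ^ card Y = exp (real (card Y) * card T / card C)"
    by (simp add: exp_of_nat_mult[symmetric])
  finally have "card {f \<in> ?O. a \<le> ?X f} \<le> card ?O * exp (real (card Y) * card T / card C) / exp (a / 2)"
    by (simp add: pos_le_divide_eq)
  then show ?thesis by (simp add: exp_diff)
qed

text \<open>Markov's inequality for the weight 1/2 to the count, with exp (- 1) \<le> 1/2. A
  threshold of a quarter of the mean leaves exp of minus a quarter of the mean.\<close>

lemma card_lower_tail:
  fixes a :: real
  assumes fin: "finite V" "finite C" and Y: "Y \<subseteq> V" and T: "T \<subseteq> C" and C: "C \<noteq> {}"
  shows "card {f \<in> V \<rightarrow>\<^sub>E C. card {y \<in> Y. f y \<in> T} \<le> a}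
     \<le> card (V \<rightarrow>\<^sub>E C) * exp (a - real (card Y) * card T / (2 * card C))"
proof -
  let ?O = "V \<rightarrow>\<^sub>E C" let ?X = "\<lambda>f. card {y \<in> Y. f y \<in> T}"
  have finO: "finite ?O" using fin by (simp add: finite_PiE)
  have cTC: "real (card T) / card C \<le> 1"
    using card_mono[OF fin(2) T] by (auto simp: divide_le_eq_1)
  have "(2::real) \<le> exp 1" using exp_ge_add_one_self[of "1::real"] by simp
  then have "inverse (exp (1::real)) \<le> inverse 2" by (intro le_imp_inverse_le) auto
  then have h2: "exp (- 1 :: real) \<le> 1 / 2" by (simp add: exp_minus)
  have "card {f \<in> ?O. ?X f \<le> a} * exp (- a) = (\<Sum>f\<in>{f \<in> ?O. ?X f \<le> a}. exp (- a))" by simp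
  also have "\<dots> \<le> (\<Sum>f\<in>{f \<in> ?O. ?X f \<le> a}. (1/2) ^ ?X f)"
  proof (intro sum_mono)
    fix f assume "f \<in> {f \<in> ?O. ?X f \<le> a}"
    then have "exp (- a) \<le> exp (real (?X f) * (- 1))" by simp
    also have "\<dots> = exp (- 1) ^ ?X f" by (rule exp_of_nat_mult)
    also have "\<dots> \<le> (1/2) ^ ?X f"
      using h2 by (intro power_mono) auto
    finally show "exp (- a) \<le> (1/2) ^ ?X f" .
  qed
  also have "\<dots> \<le> (\<Sum>f\<in>?O. (1/2) ^ ?X f)" using finO by (intro sum_mono2) auto
  also have "\<dots> = card ?O * (1 - card T / (2 * card C)) ^ card Y"
  proof -
    have "1 + (1/2 - 1) * real (card T) / card C = 1 - card T / (2 * card C)" by simp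
    then show ?thesis using sum_PiE_weight[OF fin Y T C, of "1/2"] by presburger
  qed
  also have "\<dots> \<le> card ?O * exp (- (card T / (2 * card C))) ^ card Y"
  proof (intro mult_left_mono power_mono)
    show "1 - card T / (2 * card C) \<le> exp (- (card T / (2 * card C)))"
      using exp_ge_add_one_self[of "- (card T / (2 * card C))"] by simp
    have "card T / (2 * card C) = (card T / card C) / 2" by simp
    then show "0 \<le> 1 - card T / (2 * card C)" using cTC by linarith
  qed auto
  also have "exp (- (card T / (2 * card C))) ^ card Y = exp (- (real (card Y) * card T / (2 * card C)))"
    by (simp add: exp_of_nat_mult[symmetric])
  finally have "card {f \<in> ?O. ?X f \<le> a} * exp (- a) * exp a
      \<le> card ?O * exp (- (real (card Y) * card T / (2 * card C))) * exp a"
    by (intro mult_right_mono) auto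
  moreover have "exp (- a) * exp a = 1" by (simp add: exp_add[symmetric])
  moreover have "exp (- q) * exp a = exp (a - q)" for q by (simp add: exp_add[symmetric])
  ultimately show ?thesis by (simp only: mult.assoc mult_1_right)
qed

lemma card_avoiding:
  assumes fin: "finite V" "finite C" and Y: "Y \<subseteq> V" and T: "T \<subseteq> C" and C: "C \<noteq> {}"
  shows "card {f \<in> V \<rightarrow>\<^sub>E C. \<forall>y\<in>Y. f y \<notin> T}
     \<le> card (V \<rightarrow>\<^sub>E C) * exp (- (real (card T) * card Y / card C))"
proof -
  let ?O = "V \<rightarrow>\<^sub>E C" let ?X = "\<lambda>f. card {y \<in> Y. f y \<in> T}"
  have finO: "finite ?O" using fin by (simp add: finite_PiE)
  have finY: "finite Y" using fin Y finite_subset by auto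
  have cTC: "real (card T) / card C \<le> 1"
    using card_mono[OF fin(2) T] by (auto simp: divide_le_eq_1)
  \<comment> \<open>Since 0 ^ 0 = 1, the weight for s = 0 is the indicator of the event.\<close>
  have "real (card {f \<in> ?O. \<forall>y\<in>Y. f y \<notin> T}) = (\<Sum>f\<in>{f \<in> ?O. \<forall>y\<in>Y. f y \<notin> T}. 0 ^ ?X f)"
  proof -
    have "(\<Sum>f\<in>{f \<in> ?O. \<forall>y\<in>Y. f y \<notin> T}. 0 ^ ?X f) = (\<Sum>f\<in>{f \<in> ?O. \<forall>y\<in>Y. f y \<notin> T}. 1 :: real)"
    proof (intro sum.cong refl)
      fix f assume "f \<in> {f \<in> ?O. \<forall>y\<in>Y. f y \<notin> T}"
      then have "{y \<in> Y. f y \<in> T} = {}" by auto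
      then have c0: "?X f = 0" by (simp only: card.empty)
      show "0 ^ ?X f = (1 :: real)" by (simp only: c0 power_0)
    qed
    then show ?thesis by simp
  qed
  also have "\<dots> \<le> (\<Sum>f\<in>?O. 0 ^ ?X f)" using finO by (intro sum_mono2) auto
  also have "\<dots> = card ?O * (1 - card T / card C) ^ card Y"
    using sum_PiE_weight[OF fin Y T C, of 0] by simp
  also have "\<dots> \<le> card ?O * exp (- (card T / card C)) ^ card Y"
  proof (intro mult_left_mono power_mono)
    show "1 - card T / card C \<le> exp (- (card T / card C))"
      using exp_ge_add_one_self[of "- (card T / card C)"] by simp
  qed (use cTC in auto)
  also have "exp (- (card T / card C)) ^ card Y = exp (- (real (card T) * card Y / card C))"
    by (simp add: exp_of_nat_mult[symmetric] mult.commute)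
  finally show ?thesis .
qed

section \<open>Disjoint connected sets in expanding graphs\<close>

definition nbhd :: "('a \<Rightarrow> 'a set) \<Rightarrow> 'a set \<Rightarrow> 'a set" where
  "nbhd N X = (\<Union>x\<in>X. N x)"

definition induced :: "('a \<Rightarrow> 'a set) \<Rightarrow> 'a set \<Rightarrow> ('a \<times> 'a) set" where
  "induced N S = {(u, v). u \<in> S \<and> v \<in> S \<and> v \<in> N u}"

definition conn :: "('a \<Rightarrow> 'a set) \<Rightarrow> 'a set \<Rightarrow> bool" where
  "conn N S \<longleftrightarrow> (\<forall>x\<in>S. \<forall>y\<in>S. (x, y) \<in> (induced N S)\<^sup>*)"

lemma induced_mono: "S \<subseteq> T \<Longrightarrow> induced N S \<subseteq> induced N T"
  by (auto simp: induced_def)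

lemma conn_singleton: "conn N {x}"
  by (auto simp: conn_def)

lemma conn_Un:
  assumes "conn N S" "conn N T" "u \<in> S" "v \<in> T" "u = v \<or> v \<in> N u \<and> u \<in> N v"
  shows "conn N (S \<union> T)"
proof -
  let ?R = "(induced N (S \<union> T))\<^sup>*"
  have S: "(x, y) \<in> ?R" if "x \<in> S" "y \<in> S" for x y
    using assms(1) that rtrancl_mono[OF induced_mono[of S "S \<union> T" N]] by (auto simp: conn_def)
  have T: "(x, y) \<in> ?R" if "x \<in> T" "y \<in> T" for x y
    using assms(2) that rtrancl_mono[OF induced_mono[of T "S \<union> T" N]] by (auto simp: conn_def)
  have uv: "(u, v) \<in> ?R" "(v, u) \<in> ?R"
    using assms(3-5) by (cases "u = v"; force simp: induced_def)+
  show ?thesis unfolding conn_def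
  proof (intro ballI)
    fix x y assume "x \<in> S \<union> T" "y \<in> S \<union> T"
    then have "(x, u) \<in> ?R" "(u, y) \<in> ?R"
      using S[of x u] S[of u y] T[of x v] T[of v y] uv assms(3,4) by (blast intro: rtrancl_trans)+
    then show "(x, y) \<in> ?R" by (rule rtrancl_trans)
  qed
qed

lemma conn_Un_Int: "conn N S \<Longrightarrow> conn N T \<Longrightarrow> u \<in> S \<Longrightarrow> u \<in> T \<Longrightarrow> conn N (S \<union> T)"
  by (rule conn_Un) auto

text \<open>Of pseudorandomness only this is kept: any two vertex sets of size \<open>m\<close>,
  possibly overlapping, are joined by an edge. It serves twice: large sets have almost all vertices
  as neighbours, which keeps tight sets small, and two large families of leaves are joined by an
  edge, which merges components.\<close>

locale expanding =
  fixes V :: "'a set" and N :: "'a \<Rightarrow> 'a set" and m :: nat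
  assumes finV: "finite V" and N_sub: "N x \<subseteq> V" and N_sym: "y \<in> N x \<Longrightarrow> x \<in> N y"
    and m_pos: "1 \<le> m"
    and edge: "X \<subseteq> V \<Longrightarrow> Y \<subseteq> V \<Longrightarrow> m \<le> card X \<Longrightarrow> m \<le> card Y \<Longrightarrow> \<exists>x\<in>X. \<exists>y\<in>Y. y \<in> N x"
begin

text \<open>
  The set \<open>F\<close> consists of the free vertices, and \<open>g x\<close> bounds the number of further children that
  \<open>x\<close> may be given.
\<close>

definition ext :: "'a set \<Rightarrow> ('a \<Rightarrow> int) \<Rightarrow> bool" where
  "ext F g \<longleftrightarrow> (\<forall>X\<subseteq>V. card X \<le> 2 * m \<longrightarrow> sum g X \<le> int (card (nbhd N X \<inter> F)))"

text \<open>
  The Friedman--Pippenger argument: if no neighbour of \<open>s\<close> can be used, then the sets witnessing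
  this are tight, tight sets are closed under union by submodularity, and their union together
  with \<open>s\<close> violates \<open>ext\<close>.
\<close>

lemma ext_add_leaf:
  assumes ext: "ext F g" and F: "F \<subseteq> V" "7 * m < card F" and g3: "\<And>x. g x \<le> 3"
    and s: "s \<in> V" "1 \<le> g s"
  shows "\<exists>y \<in> N s \<inter> F. ext (F - {y}) (g(s := g s - 1))"
proof (rule ccontr)
  assume no: "\<not> ?thesis"
  let ?c = "\<lambda>X. int (card (nbhd N X \<inter> F))"
  have finX: "finite X" if "X \<subseteq> V" for X using that finV finite_subset by auto
  have finF: "finite F" using F finX by auto
  define tight where "tight X \<longleftrightarrow> X \<subseteq> V \<and> card X \<le> m \<and> s \<notin> X \<and> sum g X = ?c X" for X
  have extD: "sum g X \<le> ?c X" if "X \<subseteq> V" "card X \<le> 2 * m" for X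
    using ext that by (auto simp: ext_def)
  have sum3: "sum g X \<le> 3 * int (card X)" for X
    using sum_bounded_above[of X g 3] g3 by simp
  \<comment> \<open>A set of at least \<open>m\<close> vertices has fewer than \<open>m\<close>
    non-neighbours, so more than 6 m of the free vertices are its neighbours, while 2 m vertices
    demand at most 6 m. Tight sets thus have size at most \<open>m\<close>, and the union of two of
    them stays within the range 2 m of \<open>ext\<close>.\<close>
  have small: "card X \<le> m" if X: "X \<subseteq> V" "card X \<le> 2 * m" "sum g X = ?c X" for X
  proof (rule ccontr)
    assume "\<not> card X \<le> m"
    then have "card (V - nbhd N X) < m"
      using edge[of X "V - nbhd N X"] X(1) by (force simp: nbhd_def)
    moreover have "card (F - nbhd N X) \<le> card (V - nbhd N X)"
      using F finV by (intro card_mono) auto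
    moreover have "card F = card (nbhd N X \<inter> F) + card (F - nbhd N X)"
      using finF by (subst card_Un_disjoint[symmetric]) (auto intro: arg_cong[of _ _ card])
    ultimately have "6 * int m < ?c X" using F by linarith
    then show False using sum3[of X] X by linarith
  qed
  have wit: "\<exists>X. tight X \<and> y \<in> nbhd N X" if y: "y \<in> N s \<inter> F" for y
  proof -
    from no y have "\<not> ext (F - {y}) (g(s := g s - 1))" by blast
    then obtain X where X: "X \<subseteq> V" "card X \<le> 2 * m"
      "int (card (nbhd N X \<inter> (F - {y}))) < sum (g(s := g s - 1)) X"
      by (auto simp: ext_def not_le)
    have 1: "sum (g(s := g s - 1)) X = sum g X - (if s \<in> X then 1 else 0)"
    proof (cases "s \<in> X")
      case True
      then have "sum (g(s := g s - 1)) X = (g s - 1) + sum g (X - {s})"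
        using finX[OF X(1)] by (subst sum.remove[of _ s]) (auto intro!: sum.cong)
      then show ?thesis using True finX[OF X(1)] by (simp add: sum.remove)
    next
      case False then show ?thesis by (auto intro!: sum.cong)
    qed
    have 2: "int (card (nbhd N X \<inter> (F - {y}))) = ?c X - (if y \<in> nbhd N X then 1 else 0)"
    proof (cases "y \<in> nbhd N X")
      case True
      then have "nbhd N X \<inter> (F - {y}) = (nbhd N X \<inter> F) - {y}" "y \<in> nbhd N X \<inter> F" using y by auto
      moreover have "0 < card (nbhd N X \<inter> F)"
        using calculation(2) finF by (auto simp: card_gt_0_iff)
      ultimately show ?thesis using True finF by (simp add: card_Diff_singleton)
    next
      case False
      then have "nbhd N X \<inter> (F - {y}) = nbhd N X \<inter> F" by auto
      then show ?thesis using False by simp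
    qed
    \<comment> \<open>Deleting \<open>y\<close> and lowering the budget of \<open>s\<close> changes
      either side by at most one, so a violation forces equality before the change, a loss on the
      right and none on the left.\<close>
    have eq: "sum g X = ?c X" "s \<notin> X" "y \<in> nbhd N X"
      using X(3) 1 2 extD[OF X(1,2)] by (auto split: if_splits)
    then show ?thesis using small[OF X(1,2)] X by (auto simp: tight_def)
  qed
  have un: "tight (X \<union> Y)" if X: "tight X" and Y: "tight Y" for X Y
  proof -
    have sub: "X \<union> Y \<subseteq> V" "X \<inter> Y \<subseteq> V" "X \<subseteq> V" "Y \<subseteq> V" using X Y by (auto simp: tight_def)
    have c: "card (X \<union> Y) \<le> 2 * m" using X Y card_Un_le[of X Y] by (auto simp: tight_def)
    have c': "card (X \<inter> Y) \<le> 2 * m"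
      using card_mono[of X "X \<inter> Y"] X finX[OF sub(3)] by (auto simp: tight_def)
    have "sum g (X \<union> Y) + sum g (X \<inter> Y) = sum g X + sum g Y"
      using finX sub by (simp add: sum.union_inter)
    also have "\<dots> = ?c X + ?c Y" using X Y by (simp add: tight_def)
    also have "\<dots> = int (card ((nbhd N X \<inter> F) \<union> (nbhd N Y \<inter> F))) + int (card ((nbhd N X \<inter> F) \<inter> (nbhd N Y \<inter> F)))"
      using finF by (metis card_Un_Int finite_Int of_nat_add)
    also have "(nbhd N X \<inter> F) \<union> (nbhd N Y \<inter> F) = nbhd N (X \<union> Y) \<inter> F" by (auto simp: nbhd_def)
    finally have "sum g (X \<union> Y) + sum g (X \<inter> Y)
        = ?c (X \<union> Y) + int (card ((nbhd N X \<inter> F) \<inter> (nbhd N Y \<inter> F)))" .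
    moreover have "?c (X \<inter> Y) \<le> int (card ((nbhd N X \<inter> F) \<inter> (nbhd N Y \<inter> F)))"
      using finF by (simp, intro card_mono) (auto simp: nbhd_def)
    ultimately have "sum g (X \<union> Y) = ?c (X \<union> Y)"
      using extD[OF sub(1) c] extD[OF sub(2) c'] by linarith
    then show ?thesis using small[OF sub(1) c] sub X Y by (auto simp: tight_def)
  qed
  have "\<exists>X. tight X \<and> T \<subseteq> nbhd N X" if "finite T" "T \<subseteq> N s \<inter> F" for T
    using that
  proof (induction T rule: finite_induct)
    case empty
    have "tight {}" by (simp add: tight_def nbhd_def)
    then show ?case by blast
  next
    case (insert y T)
    then obtain X Y where "tight X" "T \<subseteq> nbhd N X" "tight Y" "y \<in> nbhd N Y" using wit by blast
    then have "tight (X \<union> Y)" "insert y T \<subseteq> nbhd N (X \<union> Y)" using un by (auto simp: nbhd_def)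
    then show ?case by blast
  qed
  from this[of "N s \<inter> F"] obtain X where X: "tight X" "N s \<inter> F \<subseteq> nbhd N X"
    using finF by auto
  \<comment> \<open>Adding \<open>s\<close> raises the demand by at least one without adding a free
    neighbour. The enlarged set has at most m + 1 \<le> 2 m elements, so \<open>ext\<close> applies
    to it.\<close>
  then have "nbhd N (insert s X) \<inter> F = nbhd N X \<inter> F" by (auto simp: nbhd_def)
  moreover have "sum g (insert s X) = g s + sum g X"
    using X finX by (auto simp: tight_def)
  moreover have "sum g (insert s X) \<le> ?c (insert s X)"
    using X s m_pos finX by (intro extD) (auto simp: tight_def)
  ultimately show False using s X by (simp add: tight_def)
qed


text \<open>Edges are pairs (parent, child), and injectivity of \<open>snd\<close> gives each vertex
  at most one parent. Free vertices and remaining budgets are functions of the edge set alone, so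
  the growth can be undone in any order, not only in the reverse one.\<close>

definition forest :: "'a set \<Rightarrow> ('a \<Rightarrow> int) \<Rightarrow> ('a \<times> 'a) set \<Rightarrow> bool" where
  "forest F g E \<longleftrightarrow> finite E \<and> inj_on snd E \<and>
     (\<forall>(x, y) \<in> E. x \<in> V \<and> y \<in> N x \<and> y \<in> F) \<and>
     ext (F - snd ` E) (\<lambda>x. g x - int (card (E `` {x})))"

lemma relpow_subset: "R \<subseteq> S \<Longrightarrow> R ^^ h \<subseteq> S ^^ h" for R S :: "('b \<times> 'b) set"
  by (induction h) (auto simp: relcomp_unfold)

lemma forest_empty: "ext F g \<Longrightarrow> forest F g {}"
  by (simp add: forest_def)

text \<open>
  Deleting edges \<open>(x, y)\<close> frees the vertices \<open>y\<close>, which are neighbours of the vertices \<open>x\<close>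
  whose budget is restored.
\<close>

lemma forest_subset:
  assumes E: "forest F g E" and sub: "E' \<subseteq> E" and F: "F \<subseteq> V"
  shows "forest F g E'"
proof -
  have fin: "finite E" "finite E'" and inj: "inj_on snd E"
    and edges: "\<And>x y. (x, y) \<in> E \<Longrightarrow> x \<in> V \<and> y \<in> N x \<and> y \<in> F"
    using E sub finite_subset by (auto simp: forest_def)
  have "ext (F - snd ` E') (\<lambda>x. g x - int (card (E' `` {x})))"
    unfolding ext_def
  proof (intro allI impI)
    fix X assume X: "X \<subseteq> V" "card X \<le> 2 * m"
    have finX: "finite X" using X finV finite_subset by auto
    \<comment> \<open>The deleted edges that start in \<open>X\<close>. They raise the demand of
      \<open>X\<close> by their number, and their heads are equally many newly freed neighbours of
      \<open>X\<close>.\<close>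
    define D where "D = (E - E') \<inter> X \<times> UNIV"
    have finD: "finite D" using fin by (simp add: D_def)
    have img: "finite (E `` {x})" "finite (E' `` {x})" for x
      using fin by (simp_all add: finite_Image)
    have "card (E `` {x}) = card (E' `` {x}) + card ((E - E') `` {x})" for x
    proof -
      have "E `` {x} = E' `` {x} \<union> (E - E') `` {x}" using sub by auto
      then show ?thesis using fin by (simp add: card_Un_disjoint finite_Image disjoint_iff)
    qed
    then have "(\<Sum>x\<in>X. g x - int (card (E' `` {x})))
        = (\<Sum>x\<in>X. g x - int (card (E `` {x}))) + int (\<Sum>x\<in>X. card ((E - E') `` {x}))"
      by (simp add: sum_subtractf sum.distrib)
    also have "(\<Sum>x\<in>X. card ((E - E') `` {x})) = card D"
    proof -
      have "D = Sigma X (\<lambda>x. (E - E') `` {x})" by (auto simp: D_def)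
      then show ?thesis using finX fin by (simp add: finite_Image)
    qed
    also have "card D = card (snd ` D)"
      using inj by (intro card_image[symmetric] inj_on_subset[OF inj]) (auto simp: D_def)
    also have "(\<Sum>x\<in>X. g x - int (card (E `` {x}))) \<le> int (card (nbhd N X \<inter> (F - snd ` E)))"
      using E X by (auto simp: forest_def ext_def)
    also have "int (card (nbhd N X \<inter> (F - snd ` E))) + int (card (snd ` D))
        = int (card (nbhd N X \<inter> (F - snd ` E) \<union> snd ` D))"
    proof -
      have "finite (nbhd N X \<inter> (F - snd ` E))" using F finV by (intro finite_subset[OF _ finV]) auto
      moreover have "(nbhd N X \<inter> (F - snd ` E)) \<inter> snd ` D = {}" by (auto simp: D_def)
      ultimately show ?thesis using finD by (simp add: card_Un_disjoint)
    qed
    also have "\<dots> \<le> int (card (nbhd N X \<inter> (F - snd ` E')))"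
    proof -
      have "snd ` D \<subseteq> nbhd N X \<inter> (F - snd ` E')"
      proof
        fix y assume "y \<in> snd ` D"
        then obtain x where x: "x \<in> X" "(x, y) \<in> E" "(x, y) \<notin> E'" by (auto simp: D_def)
        have "y \<notin> snd ` E'"
        proof
          assume "y \<in> snd ` E'"
          then obtain w where "(w, y) \<in> E'" by auto
          then have "(w, y) = (x, y)" using inj_onD[OF inj, of "(w, y)" "(x, y)"] x sub by auto
          then show False using \<open>(w, y) \<in> E'\<close> x by simp
        qed
        then show "y \<in> nbhd N X \<inter> (F - snd ` E')" using edges[OF x(2)] x(1) by (auto simp: nbhd_def)
      qed
      then have "nbhd N X \<inter> (F - snd ` E) \<union> snd ` D \<subseteq> nbhd N X \<inter> (F - snd ` E')"
        using sub by auto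
      moreover have "finite (nbhd N X \<inter> (F - snd ` E'))" using F by (intro finite_subset[OF _ finV]) auto
      ultimately show ?thesis by (simp add: card_mono)
    qed
    finally show "(\<Sum>x\<in>X. g x - int (card (E' `` {x}))) \<le> int (card (nbhd N X \<inter> (F - snd ` E')))"
      by simp
  qed
  then show ?thesis using fin sub edges inj_on_subset[OF inj sub] by (auto simp: forest_def)
qed

lemma forest_add_leaf:
  assumes E: "forest F g E" and F: "F \<subseteq> V" "7 * m + card E < card F" and g3: "\<And>x. g x \<le> 3"
    and s: "s \<in> V" "1 \<le> g s - int (card (E `` {s}))"
  shows "\<exists>y \<in> N s \<inter> (F - snd ` E). forest F g (insert (s, y) E)"
proof -
  have fin: "finite E" and inj: "inj_on snd E" using E by (auto simp: forest_def)
  have finF: "finite F" using F finV finite_subset by auto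
  have "card (F - snd ` E) \<ge> card F - card (snd ` E)" by (rule diff_card_le_card_Diff) (use fin in auto)
  then have "7 * m < card (F - snd ` E)" using F card_image_le[OF fin, of snd] by linarith
  moreover have "g x - int (card (E `` {x})) \<le> 3" for x using g3[of x] by linarith
  ultimately obtain y where y: "y \<in> N s \<inter> (F - snd ` E)"
    "ext (F - snd ` E - {y}) ((\<lambda>x. g x - int (card (E `` {x}))) (s := g s - int (card (E `` {s})) - 1))"
    using ext_add_leaf[of "F - snd ` E" "\<lambda>x. g x - int (card (E `` {x}))" s] E F s
    by (auto simp: forest_def)
  have "(\<lambda>x. g x - int (card (insert (s, y) E `` {x})))
      = (\<lambda>x. g x - int (card (E `` {x}))) (s := g s - int (card (E `` {s})) - 1)"
  proof
    fix x
    show "g x - int (card (insert (s, y) E `` {x})) =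
      ((\<lambda>x. g x - int (card (E `` {x}))) (s := g s - int (card (E `` {s})) - 1)) x"
    proof (cases "x = s")
      case True
      have "y \<notin> E `` {s}" using y by force
      moreover have "insert (s, y) E `` {s} = insert y (E `` {s})" by auto
      ultimately show ?thesis using True fin by (simp add: finite_Image)
    next
      case False
      then have "insert (s, y) E `` {x} = E `` {x}" by auto
      then show ?thesis using False by simp
    qed
  qed
  moreover have "F - snd ` insert (s, y) E = F - snd ` E - {y}" by auto
  ultimately have "ext (F - snd ` insert (s, y) E) (\<lambda>x. g x - int (card (insert (s, y) E `` {x})))"
    using y(2) by metis
  moreover have "inj_on snd (insert (s, y) E)" using inj y by auto
  ultimately have "forest F g (insert (s, y) E)" using E y s by (auto simp: forest_def)
  then show ?thesis using y by auto
qed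

lemma forest_add_children:
  assumes "finite L" "forest F g E" "F \<subseteq> V" "7 * m + card E + 2 * card L < card F" "\<And>x. g x \<le> 3"
    and "\<And>x. x \<in> L \<Longrightarrow> x \<in> V \<and> E `` {x} = {} \<and> 2 \<le> g x"
  shows "\<exists>E'. E \<subseteq> E' \<and> forest F g E' \<and> card E' = card E + 2 * card L \<and>
    (\<forall>x\<in>L. card (E' `` {x}) = 2) \<and> (\<forall>x. x \<notin> L \<longrightarrow> E' `` {x} = E `` {x})"
  using assms(1,4,6)
proof (induction L rule: finite_induct)
  case empty
  then show ?case using assms(2) by auto
next
  case (insert s L)
  then obtain E1 where E1: "E \<subseteq> E1" "forest F g E1" "card E1 = card E + 2 * card L"
    "\<And>x. x \<in> L \<Longrightarrow> card (E1 `` {x}) = 2" "\<And>x. x \<notin> L \<Longrightarrow> E1 `` {x} = E `` {x}" by auto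
  have s: "s \<in> V" "E1 `` {s} = {}" "2 \<le> g s" using insert E1(5)[of s] by auto
  have fin1: "finite E1" using E1(2) by (simp add: forest_def)
  obtain y where y: "y \<in> N s \<inter> (F - snd ` E1)" "forest F g (insert (s, y) E1)"
    using forest_add_leaf[OF E1(2) assms(3) _ assms(5) s(1)] insert s E1(3) by auto
  define E2 where "E2 = insert (s, y) E1"
  have "(s, y) \<notin> E1" using s(2) by auto
  then have E2: "card E2 = card E1 + 1" "E2 `` {s} = {y}" "finite E2"
    using y s fin1 by (auto simp: E2_def)
  obtain z where z: "z \<in> N s \<inter> (F - snd ` E2)" "forest F g (insert (s, z) E2)"
    using forest_add_leaf[OF y(2)[folded E2_def] assms(3) _ assms(5) s(1)] insert s E1(3) E2 by auto
  define E3 where "E3 = insert (s, z) E2"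
  have "z \<notin> snd ` E2" "y \<in> snd ` E2" using z by (auto simp: E2_def)
  then have "z \<noteq> y" "(s, z) \<notin> E2" by force+
  have "E3 `` {s} = {y, z}" using E2 by (auto simp: E3_def)
  then have two: "card (E3 `` {s}) = 2" using \<open>z \<noteq> y\<close> by simp
  have eq: "E3 `` {x} = E1 `` {x}" if "x \<noteq> s" for x using that by (auto simp: E3_def E2_def)
  have "card (E3 `` {x}) = 2" if "x \<in> insert s L" for x
  proof (cases "x = s")
    case False
    then show ?thesis using eq[OF False] E1(4)[of x] that by simp
  qed (use two in simp)
  moreover have "card E3 = card E1 + 2" using E2 \<open>(s, z) \<notin> E2\<close> by (simp add: E3_def)
  moreover have "E \<subseteq> E3" using E1(1) by (auto simp: E3_def E2_def)
  ultimately have "E \<subseteq> E3 \<and> card E3 = card E + 2 * card (insert s L) \<and> (\<forall>x\<in>insert s L. card (E3 `` {x}) = 2)"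
    using E1(3) insert.hyps by simp
  moreover have "\<forall>x. x \<notin> insert s L \<longrightarrow> E3 `` {x} = E `` {x}" using eq E1(5) by simp
  ultimately show ?case using z(2) unfolding E3_def[symmetric] by blast
qed

text \<open>Two children are given to every leaf of every tree, level by level. Leaves have spent
  nothing of their budget, and \<open>7 * m\<close> free vertices remain in reserve for the
  extension step. The number \<open>2 ^ Suc h - 2\<close> counts the non-root vertices of a complete
  binary tree; uniqueness of parents keeps the leaf levels \<open>lev z\<close> of different roots
  disjoint.\<close>

lemma forest_grow:
  assumes ext: "ext F g" and F: "F \<subseteq> V" and g3: "\<And>x. g x \<le> 3" "\<forall>x\<in>F. g x = 3"
    and Z: "Z \<subseteq> V" "Z \<inter> F = {}" "\<forall>z\<in>Z. 2 \<le> g z"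
    and size: "7 * m + card Z * (2 ^ Suc h - 2) < card F"
  shows "\<exists>E lev. forest F g E \<and> card E = card Z * (2 ^ Suc h - 2) \<and> fst ` E \<subseteq> Z \<union> snd ` E \<and>
     (\<forall>z\<in>Z. lev z \<subseteq> Z \<union> snd ` E \<and> card (lev z) = 2 ^ h \<and>
        (\<forall>y\<in>lev z. (z, y) \<in> E ^^ h \<and> E `` {y} = {})) \<and> disjoint_family_on lev Z"
  using size
proof (induction h)
  case 0
  then show ?case using forest_empty[OF ext]
    by (intro exI[of _ "{}"] exI[of _ "\<lambda>z. {z}"]) (auto simp: disjoint_family_on_def)
next
  case (Suc h)
  have finZ: "finite Z" using finite_subset[OF Z(1) finV] .
  have "card Z * (2 ^ Suc h - 2) \<le> card Z * (2 ^ Suc (Suc h) - 2)"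
    by (intro mult_le_mono2 diff_le_mono) simp
  then have "7 * m + card Z * (2 ^ Suc h - 2) < card F" using Suc.prems by linarith
  from Suc.IH[OF this] obtain E lev where E: "forest F g E" "card E = card Z * (2 ^ Suc h - 2)"
      "fst ` E \<subseteq> Z \<union> snd ` E"
    and lev_all: "\<forall>z\<in>Z. lev z \<subseteq> Z \<union> snd ` E \<and> card (lev z) = 2 ^ h \<and>
        (\<forall>y\<in>lev z. (z, y) \<in> E ^^ h \<and> E `` {y} = {})"
    and disj: "disjoint_family_on lev Z"
    by (elim exE conjE) (rule that)
  have lev: "\<And>z. z \<in> Z \<Longrightarrow> lev z \<subseteq> Z \<union> snd ` E" "\<And>z. z \<in> Z \<Longrightarrow> card (lev z) = 2 ^ h"
      "\<And>z y. z \<in> Z \<Longrightarrow> y \<in> lev z \<Longrightarrow> (z, y) \<in> E ^^ h \<and> E `` {y} = {}" "disjoint_family_on lev Z"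
    using lev_all disj by simp_all
  define L where "L = (\<Union>z\<in>Z. lev z)"
  have EF: "snd ` E \<subseteq> F" and finE: "finite E" using E(1) by (auto simp: forest_def)
  have finlev: "finite (lev z)" if "z \<in> Z" for z
    using lev(2)[OF that] by (metis card.infinite power_not_zero zero_neq_numeral)
  have finL: "finite L" unfolding L_def using finZ finlev by auto
  have cL: "card L = card Z * 2 ^ h"
    unfolding L_def using finZ finlev lev(2,4)
    by (subst card_UN_disjoint) (auto simp: disjoint_family_on_def)
  have Lprop: "x \<in> V \<and> E `` {x} = {} \<and> 2 \<le> g x" if x: "x \<in> L" for x
  proof -
    have "x \<in> Z \<union> snd ` E" using x lev(1) by (auto simp: L_def)
    then show ?thesis using x lev(3) Z g3 EF F by (auto simp: L_def)
  qed
  have cE: "card E + 2 * card L = card Z * (2 ^ Suc (Suc h) - 2)"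
  proof -
    have "(2::nat) ^ Suc h - 2 + 2 * 2 ^ h = 2 ^ Suc (Suc h) - 2"
      using one_le_power[of "2::nat" h] by simp
    then show ?thesis unfolding E(2) cL by (metis distrib_left mult.left_commute)
  qed
  have sz: "7 * m + card E + 2 * card L < card F" using Suc.prems cE by linarith
  obtain E' where E': "E \<subseteq> E'" "forest F g E'" "card E' = card E + 2 * card L"
    "\<And>x. x \<in> L \<Longrightarrow> card (E' `` {x}) = 2" "\<And>x. x \<notin> L \<Longrightarrow> E' `` {x} = E `` {x}"
    using forest_add_children[OF finL E(1) F sz g3(1) Lprop] by meson
  have inj: "inj_on snd E'" using E'(2) by (simp add: forest_def)
  have par: "x = w" if "(x, y) \<in> E'" "(w, y) \<in> E'" for x w y
    using inj_onD[OF inj, of "(x, y)" "(w, y)"] that by auto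
  define lev' where "lev' z = E' `` lev z" for z
  have fresh: "y \<in> F \<and> y \<notin> snd ` E" if "x \<in> L" "(x, y) \<in> E'" for x y
  proof -
    have "y \<in> F" using E'(2) that by (auto simp: forest_def)
    moreover have "y \<notin> snd ` E"
    proof
      assume "y \<in> snd ` E"
      then obtain w where "(w, y) \<in> E" by auto
      then have "(x, y) \<in> E" using par[OF that(2), of w] E'(1) by auto
      then show False using Lprop[OF that(1)] by auto
    qed
    ultimately show ?thesis by simp
  qed
  have leaf: "E' `` {y} = {}" if "x \<in> L" "(x, y) \<in> E'" for x y
  proof -
    have y: "y \<notin> Z \<union> snd ` E" using fresh[OF that] Z by auto
    then have "y \<notin> L" using lev(1) by (auto simp: L_def)
    moreover have "y \<notin> fst ` E" using y E(3) by auto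
    ultimately show ?thesis using E'(5)[of y] by force
  qed
  have "fst ` E' \<subseteq> Z \<union> snd ` E'"
  proof
    fix x assume "x \<in> fst ` E'"
    then obtain y where xy: "(x, y) \<in> E'" by auto
    show "x \<in> Z \<union> snd ` E'"
    proof (cases "x \<in> L")
      case True then show ?thesis using lev(1) E'(1) by (force simp: L_def)
    next
      case False
      then have "(x, y) \<in> E" using xy E'(5)[of x] by auto
      then show ?thesis using E(3) E'(1) by force
    qed
  qed
  moreover have "lev' z \<subseteq> Z \<union> snd ` E' \<and> card (lev' z) = 2 ^ Suc h \<and>
      (\<forall>y\<in>lev' z. (z, y) \<in> E' ^^ Suc h \<and> E' `` {y} = {})" if z: "z \<in> Z" for z
  proof (intro conjI ballI)
    show "lev' z \<subseteq> Z \<union> snd ` E'" by (force simp: lev'_def)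
    have "lev' z = (\<Union>x\<in>lev z. E' `` {x})" by (auto simp: lev'_def)
    also have "card \<dots> = (\<Sum>x\<in>lev z. card (E' `` {x}))"
      using finlev[OF z] E'(2) par by (intro card_UN_disjoint) (auto simp: forest_def finite_Image)
    also have "\<dots> = (\<Sum>x\<in>lev z. 2)" using E'(4) z by (intro sum.cong) (auto simp: L_def)
    also have "\<dots> = 2 * card (lev z)" by simp
    finally show "card (lev' z) = 2 ^ Suc h" using lev(2)[OF z] by simp
    fix y assume "y \<in> lev' z"
    then obtain x where x: "x \<in> lev z" "(x, y) \<in> E'" by (auto simp: lev'_def)
    have "(z, x) \<in> E' ^^ h" using lev(3)[OF z x(1)] relpow_subset[OF E'(1), of h] by auto
    then show "(z, y) \<in> E' ^^ Suc h" using x(2) by auto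
    show "E' `` {y} = {}" using leaf[of x y] x z by (auto simp: L_def)
  qed
  moreover have "disjoint_family_on lev' Z"
    unfolding disjoint_family_on_def
  proof (intro ballI impI equals0I)
    fix z z' y assume z: "z \<in> Z" "z' \<in> Z" "z \<noteq> z'" and "y \<in> lev' z \<inter> lev' z'"
    then obtain x x' where x: "x \<in> lev z" "(x, y) \<in> E'" "x' \<in> lev z'" "(x', y) \<in> E'"
      by (auto simp: lev'_def)
    then have "x \<in> lev z \<inter> lev z'" using par[OF x(2,4)] by simp
    then show False using disj z by (auto simp: disjoint_family_on_def)
  qed
  moreover have "card E' = card Z * (2 ^ Suc (Suc h) - 2)" using E'(3) cE by simp
  ultimately show ?case using E'(2) by (intro exI[of _ E'] exI[of _ lev'] conjI ballI) simp_all
qed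

end

text \<open>Extracts the edges that must survive when a tree is released: a set with at most
  \<open>h\<close> edges that leads from \<open>z\<close> to \<open>y\<close> and in which every
  vertex is reached from \<open>z\<close>.\<close>

lemma relpow_chain:
  assumes "(z, y) \<in> E ^^ h"
  shows "\<exists>E1\<subseteq>E. finite E1 \<and> card E1 \<le> h \<and> fst ` E1 \<subseteq> insert z (snd ` E1) \<and>
    y \<in> insert z (snd ` E1) \<and> (\<forall>w\<in>insert z (snd ` E1). (z, w) \<in> E1\<^sup>*)"
  using assms
proof (induction h arbitrary: y)
  case 0
  then show ?case by (intro exI[of _ "{}"]) auto
next
  case (Suc h)
  then obtain x where x: "(z, x) \<in> E ^^ h" "(x, y) \<in> E" by auto
  then obtain E1 where E1: "E1 \<subseteq> E" "finite E1" "card E1 \<le> h" "fst ` E1 \<subseteq> insert z (snd ` E1)"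
    "x \<in> insert z (snd ` E1)" "\<And>w. w \<in> insert z (snd ` E1) \<Longrightarrow> (z, w) \<in> E1\<^sup>*"
    using Suc.IH by meson
  let ?E = "insert (x, y) E1"
  have mono: "(z, w) \<in> ?E\<^sup>*" if "w \<in> insert z (snd ` E1)" for w
    using E1(6)[OF that] rtrancl_mono[of E1 ?E] by auto
  have "(z, y) \<in> ?E\<^sup>*" using mono[OF E1(5)] by (auto intro: rtrancl_into_rtrancl)
  then have "\<forall>w\<in>insert z (snd ` ?E). (z, w) \<in> ?E\<^sup>*" using mono by auto
  moreover have "card ?E \<le> Suc h" using E1(2,3) card_insert_le_m1[of "Suc h" E1] by (simp add: card_insert_if)
  moreover have "?E \<subseteq> E" "finite ?E" "fst ` ?E \<subseteq> insert z (snd ` ?E)" "y \<in> insert z (snd ` ?E)"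
    using E1 x by auto
  ultimately show ?case by (intro exI[of _ ?E]) simp
qed

section \<open>Merging components along edges between leaves\<close>

context expanding
begin

lemma conn_root:
  assumes "\<And>w. w \<in> S \<Longrightarrow> (z, w) \<in> (induced N S)\<^sup>*"
  shows "conn N S"
proof -
  have "sym (induced N S)" by (auto simp: sym_def induced_def intro: N_sym)
  then have "sym ((induced N S)\<^sup>*)" by (rule sym_rtrancl)
  then show ?thesis unfolding conn_def using assms by (meson rtrancl_trans symE)
qed

lemma conn_chain:
  assumes "fst ` E \<subseteq> insert z (snd ` E)" "\<And>w. w \<in> insert z (snd ` E) \<Longrightarrow> (z, w) \<in> E\<^sup>*"
    and "\<And>x y. (x, y) \<in> E \<Longrightarrow> y \<in> N x"
  shows "conn N (insert z (snd ` E))"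
proof (rule conn_root)
  fix w assume w: "w \<in> insert z (snd ` E)"
  have "E \<subseteq> induced N (insert z (snd ` E))" using assms(1,3) by (force simp: induced_def)
  then show "(z, w) \<in> (induced N (insert z (snd ` E)))\<^sup>*"
    using assms(2)[OF w] rtrancl_mono by blast
qed

text \<open>The roots are split into two halves, and by \<open>h\<close> the leaves over either half
  number at least \<open>m\<close>, so some edge joins leaves \<open>y\<close> and \<open>y'\<close>
  over different roots. Only the two branches leading to them are kept. The merged component is
  represented by the leaf \<open>w = y\<close>, because it has not given birth and so can become the
  root of the next binary tree.\<close>

lemma merge_two:
  assumes ext: "ext F g" and F: "F \<subseteq> V" and g3: "\<And>x. g x \<le> 3" "\<forall>x\<in>F. g x = 3"
    and Z: "Z \<subseteq> V" "Z \<inter> F = {}" "\<forall>z\<in>Z. 2 \<le> g z"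
    and size: "7 * m + card Z * (2 ^ Suc h - 2) < card F" and h: "m \<le> (card Z div 2) * 2 ^ h"
  shows "\<exists>z z' w P g'. z \<in> Z \<and> z' \<in> Z \<and> z \<noteq> z' \<and> P \<subseteq> F \<and> card P \<le> 2 * h \<and>
    conn N ({z, z'} \<union> P) \<and> w \<in> insert z P \<and> 2 \<le> g' w \<and> ext (F - P) g' \<and>
    (\<forall>x. g' x \<le> g x) \<and> (\<forall>x. x \<notin> {z, z'} \<union> P \<longrightarrow> g' x = g x)"
proof -
  have finZ: "finite Z" using finite_subset[OF Z(1) finV] .
  obtain E lev where E: "forest F g E" "fst ` E \<subseteq> Z \<union> snd ` E"
    and lev_all: "\<forall>z\<in>Z. lev z \<subseteq> Z \<union> snd ` E \<and> card (lev z) = 2 ^ h \<and>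
        (\<forall>y\<in>lev z. (z, y) \<in> E ^^ h \<and> E `` {y} = {})"
    and disj: "disjoint_family_on lev Z"
    using forest_grow[OF ext F g3 Z size] by (elim exE conjE) (rule that)
  have lev: "\<And>z. z \<in> Z \<Longrightarrow> lev z \<subseteq> Z \<union> snd ` E" "\<And>z. z \<in> Z \<Longrightarrow> card (lev z) = 2 ^ h"
      "\<And>z y. z \<in> Z \<Longrightarrow> y \<in> lev z \<Longrightarrow> (z, y) \<in> E ^^ h \<and> E `` {y} = {}" "disjoint_family_on lev Z"
    using lev_all disj by simp_all
  have EF: "snd ` E \<subseteq> F" and edges: "\<And>x y. (x, y) \<in> E \<Longrightarrow> y \<in> N x"
    using E(1) by (auto simp: forest_def)
  have finlev: "finite (lev z)" if "z \<in> Z" for z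
    using lev(2)[OF that] by (metis card.infinite power_not_zero zero_neq_numeral)
  have levV: "lev z \<subseteq> V" if "z \<in> Z" for z using lev(1)[OF that] EF F Z(1) by blast
  have cU: "card (\<Union>z\<in>T. lev z) = card T * 2 ^ h" if "T \<subseteq> Z" for T
    using that finite_subset[OF that finZ] finlev lev(2,4)
    by (subst card_UN_disjoint) (auto simp: disjoint_family_on_def subset_iff)
  obtain Z1 where Z1: "Z1 \<subseteq> Z" "card Z1 = card Z div 2"
    using obtain_subset_with_card_n[of "card Z div 2" Z] by auto
  define Z2 where "Z2 = Z - Z1"
  have "card Z2 = card Z - card Z div 2"
    using Z1 finite_subset[OF Z1(1) finZ] by (simp add: Z2_def card_Diff_subset)
  then have Z2: "Z2 \<subseteq> Z" "card Z div 2 \<le> card Z2" by (auto simp: Z2_def)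
  have "m \<le> card (\<Union>z\<in>Z1. lev z)" using cU[OF Z1(1)] Z1 h by simp
  moreover have "m \<le> card (\<Union>z\<in>Z2. lev z)"
    using cU[OF Z2(1)] h mult_le_mono1[OF Z2(2), of "2 ^ h"] by linarith
  moreover have "(\<Union>z\<in>Z1. lev z) \<subseteq> V" "(\<Union>z\<in>Z2. lev z) \<subseteq> V" using levV Z1 Z2 by auto
  ultimately obtain y y' where "y \<in> (\<Union>z\<in>Z1. lev z)" "y' \<in> (\<Union>z\<in>Z2. lev z)" and yy': "y' \<in> N y"
    using edge[of "\<Union>z\<in>Z1. lev z" "\<Union>z\<in>Z2. lev z"] by meson
  then obtain z z' where z: "z \<in> Z" "y \<in> lev z" "z' \<in> Z" "y' \<in> lev z'" "z \<noteq> z'"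
    using Z1(1) by (auto simp: Z2_def)
  obtain A where A: "A \<subseteq> E" "finite A" "card A \<le> h" "fst ` A \<subseteq> insert z (snd ` A)"
    "y \<in> insert z (snd ` A)" "\<And>w. w \<in> insert z (snd ` A) \<Longrightarrow> (z, w) \<in> A\<^sup>*"
    using relpow_chain[OF lev(3)[OF z(1,2), THEN conjunct1]] by meson
  obtain B where B: "B \<subseteq> E" "finite B" "card B \<le> h" "fst ` B \<subseteq> insert z' (snd ` B)"
    "y' \<in> insert z' (snd ` B)" "\<And>w. w \<in> insert z' (snd ` B) \<Longrightarrow> (z', w) \<in> B\<^sup>*"
    using relpow_chain[OF lev(3)[OF z(3,4), THEN conjunct1]] by meson
  define D where "D = A \<union> B"
  define P where "P = snd ` D"
  define g' where "g' x = g x - int (card (D `` {x}))" for x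
  have D: "D \<subseteq> E" using A B by (auto simp: D_def)
  have "card P \<le> card D" unfolding P_def using A B by (intro card_image_le) (auto simp: D_def)
  also have "\<dots> \<le> card A + card B" unfolding D_def by (rule card_Un_le)
  finally have cP: "card P \<le> 2 * h" using A B by linarith
  have "conn N (insert z (snd ` A) \<union> insert z' (snd ` B))"
  proof (rule conn_Un)
    show "conn N (insert z (snd ` A))" using A edges by (intro conn_chain) auto
    show "conn N (insert z' (snd ` B))" using B edges by (intro conn_chain) auto
  qed (use A B yy' N_sym in auto)
  also have "insert z (snd ` A) \<union> insert z' (snd ` B) = {z, z'} \<union> P" by (auto simp: P_def D_def)
  finally have conn: "conn N ({z, z'} \<union> P)" .
  \<comment> \<open>The release of all tree vertices off the two branches; the extension property
    survives because it holds for every subset of the edges.\<close>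
  have "ext (F - P) g'"
    using forest_subset[OF E(1) D F] by (simp add: forest_def P_def g'_def[abs_def])
  moreover have "g' x = g x" if "x \<notin> {z, z'} \<union> P" for x
  proof -
    have "x \<notin> fst ` D" using that A(4) B(4) by (auto simp: P_def D_def)
    then have "D `` {x} = {}" by force
    then show ?thesis by (simp add: g'_def)
  qed
  \<comment> \<open>The leaf has no child in \<open>D\<close>, so its budget is the original one: 3
    if it is a free vertex, at least 2 if the tree has height 0 and it is the root itself.\<close>
  moreover have "2 \<le> g' y"
  proof -
    have "D `` {y} = {}" using lev(3)[OF z(1,2)] D by auto
    moreover have "2 \<le> g y"
    proof (cases "y \<in> Z")
      case False
      then have "y \<in> F" using lev(1)[OF z(1)] z(2) EF by blast
      then show ?thesis using g3(2) by simp
    qed (use Z(3) in simp)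
    ultimately show ?thesis by (simp add: g'_def)
  qed
  moreover have "y \<in> insert z P" using A(5) by (auto simp: P_def D_def)
  moreover have "P \<subseteq> F" using D EF by (auto simp: P_def)
  moreover have "g' x \<le> g x" for x by (simp add: g'_def)
  ultimately show ?thesis using z cP conn
    by (intro exI[of _ z] exI[of _ z'] exI[of _ y] exI[of _ P] exI[of _ g']) simp
qed

text \<open>Here \<open>Z\<close> holds one representative of each component still to be joined,
  with room for two children; the other vertices of a component may have spent theirs. The function
  \<open>B\<close> is a potential: reducing \<open>j\<close> components to \<open>j - 1\<close> uses
  at most \<open>B j - B (j - 1)\<close> vertices, and the costs telescope. Of the
  \<open>19 * m\<close> vertices, 7 m are the reserve of the extension step and 12 m hold the
  temporary trees.\<close>

lemma connect_one:
  fixes B :: "nat \<Rightarrow> real"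
  assumes ext: "ext F g" and F: "F \<subseteq> V" and g3: "\<And>x. g x \<le> 3" "\<And>x. x \<in> F \<Longrightarrow> g x = 3"
    and Z: "Z \<subseteq> V" "Z \<inter> F = {}" "\<And>z. z \<in> Z \<Longrightarrow> 2 \<le> g z" "Z \<noteq> {}"
    and cost: "\<And>j. 2 \<le> j \<Longrightarrow> j \<le> card Z \<Longrightarrow>
      \<exists>h. m \<le> (j div 2) * 2 ^ h \<and> j * (2 ^ Suc h - 2) \<le> 12 * m \<and> 2 * real h \<le> B j - B (j - 1)"
    and size: "19 * real m + B (card Z) - B 1 < card F"
    and monoB: "\<And>i j. i \<le> j \<Longrightarrow> B i \<le> B j"
  shows "\<exists>P g'. P \<subseteq> F \<and> real (card P) \<le> B (card Z) - B 1 \<and> conn N (Z \<union> P) \<and> ext (F - P) g' \<and>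
    (\<forall>x. g' x \<le> g x) \<and> (\<forall>x. x \<notin> Z \<union> P \<longrightarrow> g' x = g x)"
  using assms
proof (induction "card Z" arbitrary: Z F g rule: less_induct)
  case less
  have finZ: "finite Z" using finite_subset[OF less.prems(5) finV] .
  have finF: "finite F" using finite_subset[OF less.prems(2) finV] .
  show ?case
  proof (cases "card Z = 1")
    case True
    then obtain z where "Z = {z}" by (metis card_1_singletonE)
    then show ?thesis using less.prems(1)
      by (intro exI[of _ "{}"] exI[of _ g]) (auto simp: conn_singleton)
  next
    case False
    then have c2: "2 \<le> card Z" using less.prems(8) finZ
      by (metis One_nat_def card_0_eq less_2_cases not_less)
    obtain h where h: "m \<le> (card Z div 2) * 2 ^ h" "card Z * (2 ^ Suc h - 2) \<le> 12 * m"
      "2 * real h \<le> B (card Z) - B (card Z - 1)"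
      using less.prems(9)[OF c2] by auto
    have "B 1 \<le> B (card Z)" using c2 less.prems(11) by auto
    then have "real (7 * m + card Z * (2 ^ Suc h - 2)) < card F" using h(2) less.prems(10) by linarith
    then have sz: "7 * m + card Z * (2 ^ Suc h - 2) < card F" by linarith
    have all: "\<forall>x\<in>F. g x = 3" "\<forall>z\<in>Z. 2 \<le> g z" using less.prems(4,7) by auto
    obtain z z' w P g1 where zz: "z \<in> Z" "z' \<in> Z" "z \<noteq> z'" "P \<subseteq> F" "card P \<le> 2 * h"
      "conn N ({z, z'} \<union> P)" "w \<in> insert z P" "2 \<le> g1 w" "ext (F - P) g1"
      and g1_all: "\<forall>x. g1 x \<le> g x" "\<forall>x. x \<notin> {z, z'} \<union> P \<longrightarrow> g1 x = g x"
      using merge_two[OF less.prems(1,2,3) all(1) less.prems(5,6) all(2) sz h(1)] by (elim exE conjE) (rule that)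
    have g1: "\<And>x. g1 x \<le> g x" "\<And>x. x \<notin> {z, z'} \<union> P \<Longrightarrow> g1 x = g x"
      using g1_all by blast+
    \<comment> \<open>The new representative replaces both old ones. Since it lies in the connecting
      piece, connecting \<open>Z'\<close> also connects \<open>z\<close> and
      \<open>z'\<close>.\<close>
    define Z' where "Z' = insert w (Z - {z, z'})"
    have w: "w \<notin> Z - {z, z'}" using zz(1,4,7) less.prems(6) by auto
    have cZ': "card Z' = card Z - 1"
    proof -
      have "card (Z - {z, z'}) = card Z - 2"
        using zz(1-3) finZ by (subst card_Diff_subset) auto
      then show ?thesis using w finZ c2 by (simp add: Z'_def)
    qed
    have finP: "finite P" using zz(4) finF finite_subset by auto
    have "\<exists>P' g'. P' \<subseteq> F - P \<and> real (card P') \<le> B (card Z') - B 1 \<and> conn N (Z' \<union> P') \<and>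
      ext (F - P - P') g' \<and> (\<forall>x. g' x \<le> g1 x) \<and> (\<forall>x. x \<notin> Z' \<union> P' \<longrightarrow> g' x = g1 x)"
    proof (rule less.hyps)
      show "card Z' < card Z" using cZ' c2 by linarith
      show "ext (F - P) g1" by (rule zz(9))
      show "F - P \<subseteq> V" using less.prems(2) by auto
      show "g1 x \<le> 3" for x using g1(1)[of x] less.prems(3)[of x] by linarith
      show "g1 x = 3" if "x \<in> F - P" for x
        using g1(2)[of x] zz(1,2) less.prems(4,6) that by auto
      show "Z' \<subseteq> V" "Z' \<inter> (F - P) = {}" "Z' \<noteq> {}"
        using zz(1,4,7) less.prems(2,5,6) by (auto simp: Z'_def)
      show "2 \<le> g1 x" if "x \<in> Z'" for x
      proof (cases "x = w")
        case False
        then have "x \<in> Z" "x \<notin> {z, z'} \<union> P" using that zz(4) less.prems(6) by (auto simp: Z'_def)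
        then show ?thesis using g1(2) less.prems(7) by auto
      qed (use zz in auto)
      show "\<exists>h. m \<le> (j div 2) * 2 ^ h \<and> j * (2 ^ Suc h - 2) \<le> 12 * m \<and> 2 * real h \<le> B j - B (j - 1)"
        if "2 \<le> j" "j \<le> card Z'" for j using less.prems(9) that cZ' by auto
      have "real (card (F - P)) = real (card F) - card P"
        using finP zz(4) card_mono[OF finF zz(4)] by (simp add: card_Diff_subset of_nat_diff)
      then show "19 * real m + B (card Z') - B 1 < card (F - P)"
        using less.prems(10) zz(5) h(3) cZ' by simp
      show "B i \<le> B j" if "i \<le> j" for i j using less.prems(11) that by auto
    qed
    then obtain P' g' where P': "P' \<subseteq> F - P" "real (card P') \<le> B (card Z') - B 1" "conn N (Z' \<union> P')"
      "ext (F - P - P') g'" "\<And>x. g' x \<le> g1 x" "\<And>x. x \<notin> Z' \<union> P' \<Longrightarrow> g' x = g1 x" by blast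
    have "conn N (({z, z'} \<union> P) \<union> (Z' \<union> P'))"
      by (rule conn_Un_Int[OF zz(6) P'(3), of w]) (use zz in \<open>auto simp: Z'_def\<close>)
    moreover have "({z, z'} \<union> P) \<union> (Z' \<union> P') = Z \<union> (P \<union> P')" using zz by (auto simp: Z'_def)
    moreover have "real (card (P \<union> P')) \<le> B (card Z) - B 1"
      using card_Un_le[of P P'] zz(5) h(3) P'(2) cZ' by simp
    moreover have "F - P - P' = F - (P \<union> P')" by auto
    moreover have "g' x \<le> g x" for x using P'(5)[of x] g1(1)[of x] by linarith
    moreover have "g' x = g x" if "x \<notin> Z \<union> (P \<union> P')" for x
    proof -
      have "x \<notin> {z, z'} \<union> P" using that zz(1,2) by auto
      moreover have "x \<notin> Z' \<union> P'" using calculation that zz(7) by (auto simp: Z'_def)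
      ultimately show ?thesis using P'(6) g1(2) by simp
    qed
    ultimately show ?thesis using zz(4) P'(1,4) by (intro exI[of _ "P \<union> P'"] exI[of _ g']) auto
  qed
qed

text \<open>The colours are treated in succession with a common free set. Budgets may have been
  spent only at vertices of finished colours, so the seeds of the next colour still have budget 3.
  Only connecting paths are lost for good, whence the sum of the potentials; reserve and temporary
  trees, \<open>19 * m\<close>, are paid once.\<close>

lemma connect_all:
  fixes B :: "nat \<Rightarrow> real" and k :: nat
  assumes ext: "ext F (\<lambda>_. 3)" and F: "F \<subseteq> V"
    and Z: "\<And>i. i < k \<Longrightarrow> Z i \<subseteq> V - F" "\<And>i. i < k \<Longrightarrow> Z i \<noteq> {}" "disjoint_family_on Z {..<k}"
    and cost: "\<And>j. 2 \<le> j \<Longrightarrow> j \<le> card V \<Longrightarrow>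
      \<exists>h. m \<le> (j div 2) * 2 ^ h \<and> j * (2 ^ Suc h - 2) \<le> 12 * m \<and> 2 * real h \<le> B j - B (j - 1)"
    and size: "19 * real m + (\<Sum>i<k. B (card (Z i))) < card F"
    and monoB: "\<And>i j. i \<le> j \<Longrightarrow> B i \<le> B j" "0 \<le> B 0"
  shows "\<exists>P. (\<forall>i<k. P i \<subseteq> F \<and> conn N (Z i \<union> P i)) \<and> disjoint_family_on P {..<k}"
proof -
  have finF: "finite F" using finite_subset[OF F finV] .
  have B0: "0 \<le> B j" for j using monoB(1)[of 0 j] monoB(2) by linarith
  have "\<exists>P g. (\<forall>i<l. P i \<subseteq> F \<and> conn N (Z i \<union> P i)) \<and> disjoint_family_on P {..<l} \<and>
     real (card (\<Union>i<l. P i)) \<le> (\<Sum>i<l. B (card (Z i))) \<and> ext (F - (\<Union>i<l. P i)) g \<and>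
     (\<forall>x. g x \<le> 3) \<and> (\<forall>x. x \<notin> (\<Union>i<l. Z i \<union> P i) \<longrightarrow> g x = 3)" if "l \<le> k" for l
    using that
  proof (induction l)
    case 0
    then show ?case using ext by (auto simp: disjoint_family_on_def intro!: exI[of _ "\<lambda>_. 3"])
  next
    case (Suc l)
    then obtain P g where P: "\<And>i. i < l \<Longrightarrow> P i \<subseteq> F" "\<And>i. i < l \<Longrightarrow> conn N (Z i \<union> P i)"
      "disjoint_family_on P {..<l}" "real (card (\<Union>i<l. P i)) \<le> (\<Sum>i<l. B (card (Z i)))"
      "ext (F - (\<Union>i<l. P i)) g" "\<And>x. g x \<le> 3" "\<And>x. x \<notin> (\<Union>i<l. Z i \<union> P i) \<Longrightarrow> g x = 3"
      by auto
    let ?U = "\<Union>i<l. P i"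
    have UF: "?U \<subseteq> F" using P(1) by auto
    have lk: "l < k" using Suc by simp
    have ZF: "Z i \<inter> F = {}" "Z i \<subseteq> V" if "i < k" for i using Z(1)[OF that] by auto
    have Zl: "x \<notin> Z i" if "x \<in> Z l" "i < l" for x i
      using Z(3) that lk unfolding disjoint_family_on_def by (metis disjoint_iff lessThan_iff less_trans nat_neq_iff)
    have "\<exists>Q g'. Q \<subseteq> F - ?U \<and> real (card Q) \<le> B (card (Z l)) - B 1 \<and> conn N (Z l \<union> Q) \<and>
      ext (F - ?U - Q) g' \<and> (\<forall>x. g' x \<le> g x) \<and> (\<forall>x. x \<notin> Z l \<union> Q \<longrightarrow> g' x = g x)"
    proof (rule connect_one[OF P(5)])
      show "F - ?U \<subseteq> V" using F by auto
      show "g x \<le> 3" for x by (rule P(6))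
      show "g x = 3" if "x \<in> F - ?U" for x
        using that ZF(1) lk by (intro P(7)) (auto dest: less_trans)
      show "Z l \<subseteq> V" "Z l \<inter> (F - ?U) = {}" "Z l \<noteq> {}" using ZF[OF lk] Z(2)[OF lk] by auto
      show "2 \<le> g z" if "z \<in> Z l" for z
      proof -
        have "z \<notin> F" using ZF(1)[OF lk] that by auto
        then have "g z = 3" using Zl[OF that] P(1) by (intro P(7)) auto
        then show ?thesis by simp
      qed
      show "\<exists>h. m \<le> (j div 2) * 2 ^ h \<and> j * (2 ^ Suc h - 2) \<le> 12 * m \<and> 2 * real h \<le> B j - B (j - 1)"
        if "2 \<le> j" "j \<le> card (Z l)" for j
        using that card_mono[OF finV ZF(2)[OF lk]] by (intro cost) auto
      have "real (card (F - ?U)) = real (card F) - card ?U"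
        using finite_subset[OF UF finF] UF card_mono[OF finF UF] by (simp add: card_Diff_subset of_nat_diff)
      moreover have "(\<Sum>i<Suc l. B (card (Z i))) \<le> (\<Sum>i<k. B (card (Z i)))"
        using Suc.prems B0 by (intro sum_mono2) auto
      ultimately show "19 * real m + B (card (Z l)) - B 1 < card (F - ?U)"
        using size P(4) B0[of 1] by simp
    qed (use monoB in auto)
    then obtain Q g' where Q: "Q \<subseteq> F - ?U" "real (card Q) \<le> B (card (Z l)) - B 1" "conn N (Z l \<union> Q)"
      "ext (F - ?U - Q) g'" "\<And>x. g' x \<le> g x" "\<And>x. x \<notin> Z l \<union> Q \<Longrightarrow> g' x = g x" by blast
    let ?P = "P(l := Q)"
    have U': "(\<Union>i<Suc l. ?P i) = ?U \<union> Q" by (auto simp: lessThan_Suc)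
    have "\<forall>i<Suc l. ?P i \<subseteq> F \<and> conn N (Z i \<union> ?P i)" using P(1,2) Q(1,3) by (auto simp: less_Suc_eq)
    moreover have "disjoint_family_on ?P {..<Suc l}"
      unfolding disjoint_family_on_def
    proof (intro ballI impI)
      fix i j assume ij: "i \<in> {..<Suc l}" "j \<in> {..<Suc l}" "i \<noteq> j"
      have QP: "Q \<inter> P i = {}" if "i < l" for i using Q(1) that by blast
      consider "i < l" "j < l" | "i < l" "j = l" | "i = l" "j < l" using ij by fastforce
      then show "?P i \<inter> ?P j = {}"
      proof cases
        case 1
        then show ?thesis using P(3) ij(3) by (auto simp: disjoint_family_on_def)
      next
        case 2
        then show ?thesis using QP[of i] by (simp add: Int_commute)
      next
        case 3
        then show ?thesis using QP[of j] by simp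
      qed
    qed
    moreover have "real (card (?U \<union> Q)) \<le> (\<Sum>i<Suc l. B (card (Z i)))"
      using card_Un_le[of ?U Q] P(4) Q(2) B0[of 1] by simp
    moreover have "ext (F - (?U \<union> Q)) g'" using Q(4) by (simp add: Diff_Un[symmetric] Diff_eq Int_assoc)
    moreover have "g' x \<le> 3" for x using P(6)[of x] Q(5)[of x] by linarith
    moreover have "g' x = 3" if "x \<notin> (\<Union>i<Suc l. Z i \<union> ?P i)" for x
    proof -
      have no: "x \<notin> Z i \<union> ?P i" if "i < Suc l" for i
        using that \<open>x \<notin> (\<Union>i<Suc l. Z i \<union> ?P i)\<close> by blast
      have "x \<notin> Z i \<union> P i" if "i < l" for i using no[of i] that by simp
      then have "x \<notin> (\<Union>i<l. Z i \<union> P i)" by blast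
      moreover have "x \<notin> Z l \<union> Q" using no[of l] by simp
      ultimately show ?thesis using P(7) Q(6) by simp
    qed
    ultimately show ?case unfolding U'[symmetric]
      by (intro exI[of _ ?P] exI[of _ g'] conjI allI impI) blast+
  qed
  from this[OF order_refl] obtain P where "\<forall>i<k. P i \<subseteq> F \<and> conn N (Z i \<union> P i)" "disjoint_family_on P {..<k}"
    by (elim exE conjE) (rule that)
  then show ?thesis by (intro exI[of _ P]) simp
qed

end

section \<open>Trees given by parent functions\<close>

lemma pcas_nth:
  "pcas u p v \<Longrightarrow> i < length p \<Longrightarrow> p ! i = (pawalk_verts u p ! i, pawalk_verts u p ! Suc i)"
proof (induction p arbitrary: u i)
  case (Cons e p)
  then show ?case by (cases i; cases p) (auto simp: prod_eq_iff)
qed simp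

lemma length_pawalk_verts: "length (pawalk_verts u p) = Suc (length p)"
  by (induction p arbitrary: u) auto

lemma pawalk_verts_0: "pcas u p v \<Longrightarrow> pawalk_verts u p ! 0 = u"
  by (cases p) auto

lemma pawalk_verts_last: "pcas u p v \<Longrightarrow> pawalk_verts u p ! length p = v"
  by (induction p arbitrary: u) auto

definition parent_tree :: "'a set \<Rightarrow> 'a \<Rightarrow> ('a \<Rightarrow> 'a) \<Rightarrow> 'a pair_pre_digraph" where
  "parent_tree V r p = \<lparr>pverts = V, parcs = {(x, y). x \<in> V - {r} \<and> y = p x \<or> y \<in> V - {r} \<and> x = p y}\<rparr>"

text \<open>The rank certifies that following parents from any vertex ends in the root, which yields
  connectedness and excludes cycles.\<close>

locale parent_fun =
  fixes V :: "'a set" and r :: 'a and p :: "'a \<Rightarrow> 'a" and rk :: "'a \<Rightarrow> nat"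
  assumes fin: "finite V" and rV: "r \<in> V"
    and p_V: "x \<in> V - {r} \<Longrightarrow> p x \<in> V" and rk_p: "x \<in> V - {r} \<Longrightarrow> rk (p x) < rk x"
begin

abbreviation "T \<equiv> parent_tree V r p"

lemma pverts_T: "pverts T = V"
  by (simp add: parent_tree_def)

lemma parcs_T: "(x, y) \<in> parcs T \<longleftrightarrow> x \<in> V - {r} \<and> y = p x \<or> y \<in> V - {r} \<and> x = p y"
  by (simp add: parent_tree_def)

lemma parcs_T_sub: "parcs T \<subseteq> V \<times> V"
  using p_V by (auto simp: parent_tree_def)

lemma pair_graph_T: "pair_graph T"
proof
  fix e assume e: "e \<in> parcs T"
  then show "fst e \<in> pverts T" "snd e \<in> pverts T" using parcs_T_sub by (auto simp: pverts_T)
  obtain x y where xy: "e = (x, y)" by (cases e)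
  then show "fst e \<noteq> snd e" using e rk_p[of x] rk_p[of y] by (auto simp: parcs_T)
next
  show "finite (pverts T)" using fin by (simp add: pverts_T)
  show "finite (parcs T)" using parcs_T_sub fin by (meson finite_SigmaI finite_subset)
  show "symmetric (with_proj T)" unfolding symmetric_def by (auto simp: sym_def parcs_T)
qed

interpretation PG: pair_graph T
  by (rule pair_graph_T)

lemma connected_T: "Digraph_Component.connected (with_proj T)"
proof -
  have up: "v \<rightarrow>\<^sup>*\<^bsub>with_proj T\<^esub> r \<and> r \<rightarrow>\<^sup>*\<^bsub>with_proj T\<^esub> v" if "v \<in> V" for v
    using that
  proof (induction "rk v" arbitrary: v rule: less_induct)
    case less
    show ?case
    proof (cases "v = r")
      case True
      then show ?thesis using less.prems by (simp add: PG.reachable_refl pverts_T)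
    next
      case False
      then have v: "v \<in> V - {r}" using less.prems by simp
      have "v \<rightarrow>\<^bsub>with_proj T\<^esub> p v" "p v \<rightarrow>\<^bsub>with_proj T\<^esub> v" using v by (auto simp: parcs_T)
      then have "v \<rightarrow>\<^sup>*\<^bsub>with_proj T\<^esub> p v" "p v \<rightarrow>\<^sup>*\<^bsub>with_proj T\<^esub> v"
        by (auto intro: PG.adj_in_verts PG.reachable_adjI)
      then show ?thesis using less.hyps[OF rk_p[OF v] p_V[OF v]] PG.reachable_trans by blast
    qed
  qed
  have "u \<rightarrow>\<^sup>*\<^bsub>with_proj (mk_symmetric (with_proj T))\<^esub> v" if "u \<in> V" "v \<in> V" for u v
    using up[OF that(1)] up[OF that(2)] PG.reachable_trans PG.reachable_mk_symmetricI by blast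
  then show ?thesis
    unfolding connected_def using rV by (intro strongly_connectedI) (auto simp: pverts_T)
qed

lemma adj_cases:
  assumes "(x, y) \<in> parcs T \<or> (y, x) \<in> parcs T" "rk y \<le> rk x"
  shows "y = p x"
  using assms rk_p[of y] by (auto simp: parcs_T)

text \<open>A vertex of maximal rank on a cycle has both of its cyclic neighbours equal to its
  parent, which is impossible for a cycle of length at least 3.\<close>

lemma no_cycle_T: "\<not> (\<exists>q. pre_digraph.cycle (with_proj T) q \<and> 3 \<le> length q)"
proof
  assume "\<exists>q. pre_digraph.cycle (with_proj T) q \<and> 3 \<le> length q"
  then obtain q u where q: "pcas u q u" "set q \<subseteq> parcs T" "distinct (tl (pawalk_verts u q))" "3 \<le> length q"
    by (auto simp: PG.cycle_def PG.awalk_def)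
  define L where "L = length q"
  define w where "w i = pawalk_verts u q ! i" for i
  have L3: "3 \<le> L" using q by (simp add: L_def)
  have adj: "(w i, w (Suc i)) \<in> parcs T" if "i < L" for i
    using pcas_nth[OF q(1), of i] q(2) nth_mem[of i q] that by (auto simp: w_def L_def)
  have w0: "w 0 = w L" using pawalk_verts_0[OF q(1)] pawalk_verts_last[OF q(1)] by (simp add: w_def L_def)
  have dist: "i = j" if "w i = w j" "1 \<le> i" "i \<le> L" "1 \<le> j" "j \<le> L" for i j
  proof -
    have "tl (pawalk_verts u q) ! (i - 1) = tl (pawalk_verts u q) ! (j - 1)"
      using that by (simp add: w_def nth_tl length_pawalk_verts L_def)
    moreover have "i - 1 < length (tl (pawalk_verts u q))" "j - 1 < length (tl (pawalk_verts u q))"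
      using that by (auto simp: length_pawalk_verts L_def)
    ultimately have "i - 1 = j - 1" using q(3) nth_eq_iff_index_eq by blast
    then show ?thesis using that by linarith
  qed
  have "\<exists>j\<in>{1..L}. \<forall>i\<in>{1..L}. rk (w i) \<le> rk (w j)"
  proof -
    have "Max ((\<lambda>i. rk (w i)) ` {1..L}) \<in> (\<lambda>i. rk (w i)) ` {1..L}" using L3 by (intro Max_in) auto
    then obtain j where "j \<in> {1..L}" "rk (w j) = Max ((\<lambda>i. rk (w i)) ` {1..L})" by auto
    then show ?thesis by (intro bexI[of _ j]) auto
  qed
  then obtain j where j: "1 \<le> j" "j \<le> L" and max: "\<And>i. 1 \<le> i \<Longrightarrow> i \<le> L \<Longrightarrow> rk (w i) \<le> rk (w j)"
    by auto
  have max0: "rk (w i) \<le> rk (w j)" if "i \<le> L" for i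
    using that max[of i] max[of L] w0 L3 by (cases "i = 0") auto
  \<comment> \<open>Cyclic predecessor and successor of \<open>j\<close> among the indices 1 to L.
    Index 0 is left out because \<open>w 0 = w L\<close>; they differ as L is at least 3.\<close>
  define a where "a = (if j = 1 then L else j - 1)"
  define b where "b = (if j = L then 1 else j + 1)"
  have a: "1 \<le> a" "a \<le> L" and b: "1 \<le> b" "b \<le> L" and "a \<noteq> b"
    using j L3 by (auto simp: a_def b_def)
  have "w (j - 1) = p (w j)"
    using adj[of "j - 1"] j max0[of "j - 1"] by (intro adj_cases) auto
  then have "w a = p (w j)" using j w0 by (auto simp: a_def)
  moreover have "w b = p (w j)"
  proof (cases "j = L")
    case True
    then have "w 1 = p (w 0)" using adj[of 0] L3 max0[of 1] w0 by (intro adj_cases) auto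
    then show ?thesis using True w0 by (simp add: b_def)
  next
    case False
    then have "w (Suc j) = p (w j)" using adj[of j] j max0[of "Suc j"] by (intro adj_cases) auto
    then show ?thesis using False by (simp add: b_def)
  qed
  ultimately show False using dist[of a b] a b \<open>a \<noteq> b\<close> by simp
qed

lemma undirected_tree_T: "undirected_tree T"
  using pair_graph_T connected_T no_cycle_T by (simp add: undirected_tree_def)

text \<open>A path starting in the root never steps to a parent, since that parent is the vertex it
  has just left. Read backwards it follows \<open>p\<close> from \<open>v\<close>, so a set that
  contains \<open>v\<close> and is closed under \<open>p\<close> contains the path. Independence
  only needs such covering sets, not the paths themselves.\<close>

lemma apath_subset:
  assumes "pre_digraph.apath (with_proj T) r q v" and v: "v \<in> A" and A: "\<And>x. x \<in> A \<Longrightarrow> x \<noteq> r \<Longrightarrow> p x \<in> A"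
  shows "set (pre_digraph.awalk_verts (with_proj T) r q) \<subseteq> A"
proof -
  have q: "pcas r q v" "set q \<subseteq> parcs T" "distinct (pawalk_verts r q)"
    using assms(1) by (auto simp: PG.apath_def PG.awalk_def)
  define L where "L = length q"
  define w where "w i = pawalk_verts r q ! i" for i
  have adj: "(w i, w (Suc i)) \<in> parcs T" if "i < L" for i
    using pcas_nth[OF q(1), of i] q(2) nth_mem[of i q] that by (auto simp: w_def L_def)
  have w0: "w 0 = r" and wL: "w L = v"
    using pawalk_verts_0[OF q(1)] pawalk_verts_last[OF q(1)] by (simp_all add: w_def L_def)
  have dist: "i = j" if "w i = w j" "i \<le> L" "j \<le> L" for i j
    using that q(3) nth_eq_iff_index_eq[OF q(3), of i j] by (simp add: w_def length_pawalk_verts L_def)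
  have par: "w i = p (w (Suc i)) \<and> w (Suc i) \<noteq> r" if "i < L" for i
    using that
  proof (induction i)
    case 0
    then show ?case using adj[of 0] w0 dist[of 0 1] by (auto simp: parcs_T)
  next
    case (Suc i)
    have "w (Suc i) = p (w (Suc (Suc i)))"
      using adj[of "Suc i"] Suc dist[of i "Suc (Suc i)"] by (auto simp: parcs_T)
    then show ?case using Suc dist[of 0 "Suc (Suc i)"] w0 by auto
  qed
  have "w (L - j) \<in> A" if "j \<le> L" for j
    using that
  proof (induction j)
    case 0 then show ?case using wL v by simp
  next
    case (Suc j)
    then show ?case using par[of "L - Suc j"] A[of "w (L - j)"] by (simp add: Suc_diff_Suc)
  qed
  then have "w i \<in> A" if "i \<le> L" for i using that by (metis diff_diff_cancel diff_le_self)
  then have "set (pawalk_verts r q) \<subseteq> A"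
    by (auto simp: in_set_conv_nth length_pawalk_verts w_def L_def less_Suc_eq_le)
  then show ?thesis by simp
qed

end

text \<open>The rank is the distance from \<open>a\<close> within \<open>S\<close>; a parent is a
  predecessor on a shortest walk.\<close>

lemma bfs_parent:
  assumes conn: "conn N S" and a: "a \<in> S"
  shows "\<exists>f rk. \<forall>x\<in>S - {a}. f x \<in> S \<and> x \<in> N (f x) \<and> rk (f x) < (rk x :: nat)"
proof -
  define rk where "rk x = (LEAST n. (a, x) \<in> induced N S ^^ n)" for x
  have ex: "\<exists>y. y \<in> S \<and> x \<in> N y \<and> rk y < rk x" if x: "x \<in> S - {a}" for x
  proof -
    have "(a, x) \<in> (induced N S)\<^sup>*" using conn a x by (auto simp: conn_def)
    then have "\<exists>n. (a, x) \<in> induced N S ^^ n" by (auto simp: rtrancl_power)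
    then have n: "(a, x) \<in> induced N S ^^ rk x" unfolding rk_def by (rule LeastI_ex)
    have "rk x \<noteq> 0"
    proof
      assume "rk x = 0"
      then show False using n x by simp
    qed
    then obtain n' where n': "rk x = Suc n'" by (cases "rk x") auto
    then obtain y where y: "(a, y) \<in> induced N S ^^ n'" "(y, x) \<in> induced N S" using n by auto
    have "rk y \<le> n'" unfolding rk_def using y(1) by (rule Least_le)
    then show ?thesis using y(2) n' by (auto simp: induced_def)
  qed
  define f where "f x = (SOME y. y \<in> S \<and> x \<in> N y \<and> rk y < rk x)" for x
  have "f x \<in> S \<and> x \<in> N (f x) \<and> rk (f x) < rk x" if "x \<in> S - {a}" for x
    unfolding f_def using ex[OF that] by (rule someI_ex)
  then show ?thesis by blast
qed

text \<open>In tree \<open>i\<close> the way from \<open>v\<close> to the root enters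
  \<open>S i\<close> after at most two steps and then stays inside up to \<open>a i\<close>. It is
  covered by \<open>r\<close>, \<open>v\<close>, \<open>S i\<close> and possibly the single vertex
  \<open>m v i\<close>. Two such covers meet only in \<open>r\<close> and \<open>v\<close>, because
  the cores are disjoint, \<open>m v\<close> is injective and its values avoid all cores. The root
  itself needs no \<open>m\<close>, being adjacent to every \<open>a i\<close>.\<close>

lemma independent_trees_from_cores:
  fixes G :: "'a pair_pre_digraph" and S :: "nat \<Rightarrow> 'a set" and m :: "'a \<Rightarrow> nat \<Rightarrow> 'a"
  defines "N \<equiv> \<lambda>v. {u. (v, u) \<in> parcs G}"
  assumes G: "pair_graph G" and r: "r \<in> pverts G"
    and S: "\<And>i. i < k \<Longrightarrow> S i \<subseteq> pverts G - {r}" "\<And>i. i < k \<Longrightarrow> conn N (S i)"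
      "disjoint_family_on S {..<k}"
    and a: "\<And>i. i < k \<Longrightarrow> a i \<in> S i" "\<And>i. i < k \<Longrightarrow> a i \<in> N r"
    and m_inj: "\<And>v. v \<in> pverts G - {r} \<Longrightarrow> inj_on (m v) {i. i < k \<and> v \<notin> S i \<and> N v \<inter> S i = {}}"
    and m: "\<And>v i. v \<in> pverts G - {r} \<Longrightarrow> i < k \<Longrightarrow> v \<notin> S i \<Longrightarrow> N v \<inter> S i = {} \<Longrightarrow>
      m v i \<in> N v \<and> m v i \<noteq> r \<and> N (m v i) \<inter> S i \<noteq> {} \<and> (\<forall>j<k. m v i \<notin> S j)"
  shows "\<exists>T. independent_spanning_trees G r k T"
proof -
  interpret pair_graph G by (rule G)
  let ?V = "pverts G"
  have N_V: "N v \<subseteq> ?V" for v by (auto simp: N_def in_arcsD2)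
  have N_sym: "u \<in> N v \<longleftrightarrow> v \<in> N u" for u v
    using pair_sym_arcs by (auto simp: N_def symmetric_def sym_def)
  have "\<exists>f rk. \<forall>x\<in>S i - {a i}. f x \<in> S i \<and> x \<in> N (f x) \<and> rk (f x) < (rk x :: nat)" if "i < k" for i
    by (rule bfs_parent[OF S(2)[OF that] a(1)[OF that]])
  then obtain f rk where f: "\<And>i x. i < k \<Longrightarrow> x \<in> S i - {a i} \<Longrightarrow> f i x \<in> S i \<and> x \<in> N (f i x) \<and> rk i (f i x) < (rk i x :: nat)"
    by metis
  define q where "q i v = (if v = a i then r else if v \<in> S i then f i v
    else if N v \<inter> S i \<noteq> {} then (SOME u. u \<in> N v \<inter> S i) else m v i)" for i v
  define D where "D i = Max (rk i ` S i)" for i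
  \<comment> \<open>Ranks in layers: the root, the core by distance from \<open>a i\<close>, the
    neighbours of the core above all core ranks, and the remaining vertices on top. The parent
    \<open>m v i\<close> of a vertex of the top layer has a neighbour in the core and therefore lies
    one layer lower.\<close>
  define rho where "rho i v = (if v = r then 0 else if v \<in> S i then Suc (rk i v)
    else if N v \<inter> S i \<noteq> {} then D i + 2 else D i + 3)" for i v
  have r_S: "r \<notin> S i" if "i < k" for i using S(1)[OF that] by auto
  have q_a: "q i (a i) = r" for i by (simp add: q_def)
  have q_S: "q i x \<in> S i \<and> x \<in> N (q i x) \<and> rk i (q i x) < rk i x" if "i < k" "x \<in> S i" "x \<noteq> a i" for i x
    using f[of i x] that by (simp add: q_def)
  have q_nb: "q i x \<in> N x \<inter> S i" if "i < k" "x \<notin> S i" "N x \<inter> S i \<noteq> {}" for i x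
  proof -
    have "x \<noteq> a i" using a(1)[OF that(1)] that(2) by auto
    then have "q i x = (SOME u. u \<in> N x \<inter> S i)" using that by (simp add: q_def)
    then show ?thesis using that(3) by (metis some_in_eq)
  qed
  have q_m: "q i x = m x i" if "i < k" "x \<notin> S i" "N x \<inter> S i = {}" for i x
    using that a(1)[OF that(1)] by (auto simp: q_def)
  have D: "rk i x \<le> D i" if "i < k" "x \<in> S i" for i x
    unfolding D_def using that finite_subset[OF S(1)[OF that(1)] finite_Diff[OF pair_finite_verts]]
    by (intro Max_ge) auto
  have q_N: "q i x \<in> N x" if "i < k" "x \<in> ?V - {r}" for i x
  proof (cases "x \<in> S i")
    case True
    then show ?thesis using q_S[OF that(1) True] q_a a(2)[OF that(1)] N_sym by (cases "x = a i") auto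
  next
    case False
    then show ?thesis using q_nb[OF that(1) False] q_m[OF that(1) False] m[OF that(2,1) False] by force
  qed
  have PF: "parent_fun ?V r (q i) (rho i)" if i: "i < k" for i
  proof
    show "finite ?V" by (rule pair_finite_verts)
    show "r \<in> ?V" by (rule r)
    fix x assume x: "x \<in> ?V - {r}"
    show "q i x \<in> ?V" using q_N[OF i x] N_V by auto
    show "rho i (q i x) < rho i x"
    proof (cases "x \<in> S i")
      case True
      show ?thesis
      proof (cases "x = a i")
        case True
        then show ?thesis using q_a a(1)[OF i] r_S[OF i] by (auto simp: rho_def)
      next
        case False
        then show ?thesis using q_S[OF i True False] True r_S[OF i] x by (auto simp: rho_def)
      qed
    next
      case xS: False
      show ?thesis
      proof (cases "N x \<inter> S i = {}")
        case True
        then show ?thesis using m[OF x i xS True] q_m[OF i xS True] i x xS by (simp add: rho_def)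
      next
        case False
        have "q i x \<in> S i" using q_nb[OF i xS False] by simp
        then show ?thesis using D[OF i, of "q i x"] r_S[OF i] x xS False by (auto simp: rho_def)
      qed
    qed
  qed
  define T where "T i = parent_tree ?V r (q i)" for i
  have ust: "undirected_spanning_tree (T i) G" if i: "i < k" for i
  proof -
    interpret P: parent_fun ?V r "q i" "rho i" by (rule PF[OF i])
    interpret PG: pair_graph "T i" unfolding T_def by (rule P.pair_graph_T)
    have "parcs (T i) \<subseteq> parcs G"
      unfolding T_def using q_N[OF i] N_sym by (auto simp: P.parcs_T N_def)
    then have "subgraph (with_proj (T i)) (with_proj G)"
      using wf_digraph_axioms PG.wf_digraph_axioms P.pverts_T
      by (auto simp: subgraph_def compatible_def T_def)
    then show ?thesis using P.undirected_tree_T P.pverts_T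
      by (auto simp: undirected_spanning_tree_def spanning_def T_def)
  qed
  \<comment> \<open>The covering set of the path from \<open>r\<close> to \<open>v\<close>; it is
    closed under \<open>q i\<close> outside the root.\<close>
  define A where "A i v = insert r (insert v (S i \<union> (if v \<in> S i \<or> N v \<inter> S i \<noteq> {} then {} else {m v i})))" for i v
  have sub: "set (pre_digraph.awalk_verts (with_proj (T i)) r p) \<subseteq> A i v"
    if i: "i < k" and v: "v \<in> ?V" and p: "pre_digraph.apath (with_proj (T i)) r p v" for i v p
  proof -
    interpret P: parent_fun ?V r "q i" "rho i" by (rule PF[OF i])
    show ?thesis unfolding T_def
    proof (rule P.apath_subset[OF p[unfolded T_def]])
      show "v \<in> A i v" by (simp add: A_def)
      fix x assume x: "x \<in> A i v" "x \<noteq> r"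
      show "q i x \<in> A i v"
      proof (cases "x \<in> S i")
        case True
        then show ?thesis using q_a q_S[OF i True] by (cases "x = a i") (auto simp: A_def)
      next
        case xS: False
        show ?thesis
        proof (cases "N x \<inter> S i = {}")
          case False
          then show ?thesis using q_nb[OF i xS False] by (auto simp: A_def)
        next
          case True
          \<comment> \<open>The only other candidate outside the core is \<open>m v i\<close>, which
            does have a neighbour in \<open>S i\<close>.\<close>
          have "x = v"
          proof (rule ccontr)
            assume "x \<noteq> v"
            then have vS: "v \<notin> S i" "N v \<inter> S i = {}" "x = m v i"
              using x xS by (auto simp: A_def split: if_splits)
            moreover have "v \<noteq> r" using a[OF i] vS by auto
            ultimately show False using m[of v i] v i True by auto
          qed
          then show ?thesis using q_m[OF i xS True] xS True by (auto simp: A_def)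
        qed
      qed
    qed
  qed
  have disj: "A i v \<inter> A j v \<subseteq> {r, v}" if ij: "i < k" "j < k" "i \<noteq> j" and v: "v \<in> ?V" for i j v
  proof -
    have Sij: "S i \<inter> S j = {}" using S(3) ij by (auto simp: disjoint_family_on_def)
    show ?thesis
    proof (cases "v = r")
      case True
      then have "N v \<inter> S i \<noteq> {}" "N v \<inter> S j \<noteq> {}" using a ij by auto
      then show ?thesis using Sij by (auto simp: A_def)
    next
      case False
      then have vr: "v \<in> ?V - {r}" using v by simp
      have mi: "m v i \<notin> S j" if "v \<notin> S i" "N v \<inter> S i = {}" using m[OF vr ij(1) that] ij by blast
      have mj: "m v j \<notin> S i" if "v \<notin> S j" "N v \<inter> S j = {}" using m[OF vr ij(2) that] ij by blast
      have "m v i \<noteq> m v j" if "v \<notin> S i" "N v \<inter> S i = {}" "v \<notin> S j" "N v \<inter> S j = {}"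
        using inj_onD[OF m_inj[OF vr], of i j] that ij by auto
      then show ?thesis using Sij mi mj by (auto simp: A_def)
    qed
  qed
  have "independent_spanning_trees G r k T"
    unfolding independent_spanning_trees_def
  proof (intro conjI ballI allI impI)
    fix v i j p p' assume "v \<in> ?V" "i < k" "j < k" "i \<noteq> j"
      "pre_digraph.apath (with_proj (T i)) r p v \<and> pre_digraph.apath (with_proj (T j)) r p' v"
    then show "set (pre_digraph.awalk_verts (with_proj (T i)) r p) \<inter>
        set (pre_digraph.awalk_verts (with_proj (T j)) r p') \<subseteq> {r, v}"
      using sub[of i v p] sub[of j v p'] disj[of i j v] by blast
  qed (use r ust in auto)
  then show ?thesis by blast
qed

section \<open>The expander mixing lemma\<close>

text \<open>Gram-Schmidt leaves the head of the completed basis unchanged, so after normalization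
  the first column is a multiple of \<open>v\<close>. Over the reals conjugation is trivial and
  \<open>corthogonal\<close> is ordinary orthogonality.\<close>

lemma orthonormal_basis_extending:
  fixes v :: "real vec"
  assumes v: "v \<in> carrier_vec n" "v \<noteq> 0\<^sub>v n"
  shows "\<exists>W c. W \<in> carrier_mat n n \<and> transpose_mat W * W = 1\<^sub>m n \<and> c \<noteq> 0 \<and> col W 0 = c \<cdot>\<^sub>v v"
proof -
  interpret cof_vec_space n "TYPE(real)" .
  define b where "b = basis_completion v"
  define ws where "ws = gram_schmidt n b"
  from basis_completion[OF v, folded b_def]
  have b: "distinct b" "\<not> lin_dep (set b)" "set b \<subseteq> carrier_vec n" "hd b = v" "length b = n"
    by auto
  have n0: "n \<noteq> 0"
  proof
    assume "n = 0"
    then have "v = 0\<^sub>v n" using v(1) by (intro eq_vecI) auto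
    then show False using v(2) by simp
  qed
  obtain vs where bv: "b = v # vs" using b(4,5) n0 by (cases b) auto
  from gram_schmidt_result[OF b(3,1,2) refl, folded ws_def]
  have ws: "set ws \<subseteq> carrier_vec n" "corthogonal ws" "length ws = n" by (auto simp: b(5))
  from gram_schmidt_hd[OF v(1), of vs, folded bv] have "hd ws = v" unfolding ws_def .
  then have ws0: "ws ! 0 = v" using ws(3) n0 by (cases ws) auto
  have wsi: "ws ! i \<in> carrier_vec n" if "i < n" for i using ws that by auto
  have conj: "conjugate w = w" for w :: "real vec" by (intro eq_vecI) auto
  have orth: "ws ! i \<bullet> ws ! j = 0 \<longleftrightarrow> i \<noteq> j" if "i < n" "j < n" for i j
    using corthogonalD[OF ws(2), of i j] that ws(3) by (simp add: conj)
  have sq: "0 \<le> w \<bullet> w" for w :: "real vec" by (auto simp: scalar_prod_def intro: sum_nonneg)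
  define us where "us = map (\<lambda>w. (1 / sqrt (w \<bullet> w)) \<cdot>\<^sub>v w) ws"
  define W where "W = mat_of_cols n us"
  have "length us = n" by (simp add: us_def ws(3))
  then have W: "W \<in> carrier_mat n n" using mat_of_cols_carrier(1)[of n us] by (simp add: W_def)
  have colW: "col W i = (1 / sqrt (ws ! i \<bullet> ws ! i)) \<cdot>\<^sub>v ws ! i" if "i < n" for i
    using that ws wsi[OF that] by (simp add: W_def us_def)
  have "transpose_mat W * W = 1\<^sub>m n"
  proof (rule eq_matI)
    fix i j assume ij: "i < dim_row (1\<^sub>m n :: real mat)" "j < dim_col (1\<^sub>m n :: real mat)"
    then have "(transpose_mat W * W) $$ (i, j) = col W i \<bullet> col W j" using W by simp
    also have "\<dots> = 1 / sqrt (ws ! i \<bullet> ws ! i) * (1 / sqrt (ws ! j \<bullet> ws ! j) * (ws ! i \<bullet> ws ! j))"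
    proof -
      have c: "ws ! i \<in> carrier_vec n" "ws ! j \<in> carrier_vec n" using ij wsi by auto
      show ?thesis using ij c
        by (simp add: colW smult_scalar_prod_distrib[of _ n] scalar_prod_smult_distrib[of _ n])
    qed
    also have "\<dots> = (1\<^sub>m n :: real mat) $$ (i, j)"
    proof (cases "i = j")
      case True
      have "sqrt (ws ! i \<bullet> ws ! i) * sqrt (ws ! i \<bullet> ws ! i) = ws ! i \<bullet> ws ! i" using sq by simp
      moreover have "ws ! i \<bullet> ws ! i \<noteq> 0" using orth[of i i] ij by simp
      ultimately show ?thesis using True ij by (simp add: field_simps)
    next
      case False
      then show ?thesis using orth[of i j] ij by simp
    qed
    finally show "(transpose_mat W * W) $$ (i, j) = (1\<^sub>m n :: real mat) $$ (i, j)" .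
  qed (use W in auto)
  moreover have "ws ! 0 \<bullet> ws ! 0 \<noteq> 0" using orth[of 0 0] n0 by simp
  ultimately show ?thesis using W colW[of 0] ws0 n0 by (intro exI[of _ W] exI[of _ "1 / sqrt (v \<bullet> v)"]) auto
qed

text \<open>Deflation along the given factorization: an orthogonal matrix with an eigenvector for
  the head \<open>e\<close> as first column clears the first column of \<open>A\<close> below the
  diagonal, symmetry clears the first row as well, and the remaining block is symmetric with the
  remaining factors. The diagonal thus appears in the order of \<open>es\<close>, with
  multiplicities, as needed for an eigenvalue list sorted in advance.\<close>

theorem symmetric_mat_diagonalizable:
  fixes A :: "real mat"
  assumes "A \<in> carrier_mat n n" "transpose_mat A = A" "char_poly A = (\<Prod>e\<leftarrow>es. [:- e, 1:])"
  shows "length es = n \<and> (\<exists>U \<in> carrier_mat n n. transpose_mat U * U = 1\<^sub>m n \<and>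
    transpose_mat U * A * U = mat n n (\<lambda>(i, j). if i = j then es ! i else 0))"
  using assms
proof (induction es arbitrary: n A)
  case Nil
  then have "n = 0" using degree_monic_char_poly[of A n] by auto
  then show ?case using Nil by (intro conjI bexI[of _ "1\<^sub>m 0"]) auto
next
  case (Cons e es n A)
  let ?n1 = "n - 1"
  note A = Cons.prems(1) and sym = Cons.prems(2)
  have cp: "char_poly A = [:- e, 1:] * (\<Prod>e\<leftarrow>es. [:- e, 1:])" using Cons.prems by simp
  have mon: "monic (\<Prod>e\<leftarrow>es. [:- e, 1:])" by (rule monic_prod_list) auto
  have deg: "degree (char_poly A) = Suc (degree (\<Prod>e\<leftarrow>es. [:- e, 1:]))"
    unfolding cp by (subst degree_mult_eq) (use mon in auto)
  with degree_monic_char_poly[OF A] have n: "n \<noteq> 0" by auto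
  have "eigenvalue A e" unfolding eigenvalue_root_char_poly[OF A] cp by simp
  then obtain v where v: "v \<in> carrier_vec n" "v \<noteq> 0\<^sub>v n" "A *\<^sub>v v = e \<cdot>\<^sub>v v"
    using A by (auto simp: eigenvalue_def eigenvector_def)
  obtain W c where W: "W \<in> carrier_mat n n" "transpose_mat W * W = 1\<^sub>m n" "c \<noteq> 0" "col W 0 = c \<cdot>\<^sub>v v"
    using orthonormal_basis_extending[OF v(1,2)] by blast
  let ?Wt = "transpose_mat W"
  have Wt: "?Wt \<in> carrier_mat n n" using W by simp
  have WWt: "W * ?Wt = 1\<^sub>m n" by (rule mat_mult_left_right_inverse[OF Wt W(1,2)])
  define A' where "A' = ?Wt * A * W"
  have A': "A' \<in> carrier_mat n n" using A W by (simp add: A'_def)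
  have sym': "transpose_mat A' = A'"
    using A W Wt sym by (simp add: A'_def transpose_mult[of _ n n _ n] assoc_mult_mat[of _ n n _ n _ n])
  have Av: "A *\<^sub>v (c \<cdot>\<^sub>v v) = e \<cdot>\<^sub>v (c \<cdot>\<^sub>v v)"
    using A v by (simp add: mult_mat_vec[OF A v(1)] smult_smult_assoc mult.commute)
  have col0: "A' $$ (i, 0) = (if i = 0 then e else 0)" if i: "i < n" for i
  proof -
    have "A' = ?Wt * (A * W)" using A W Wt by (simp add: A'_def assoc_mult_mat[of _ n n _ n _ n])
    then have "A' $$ (i, 0) = col W i \<bullet> col (A * W) 0" using i n W A by simp
    also have "col (A * W) 0 = A *\<^sub>v col W 0" using A W(1) n by (auto simp: mult_mat_vec_def)
    also have "\<dots> = e \<cdot>\<^sub>v col W 0" using W(4) Av by simp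
    also have "col W i \<bullet> (e \<cdot>\<^sub>v col W 0) = e * (col W i \<bullet> col W 0)"
      using W(1) i n by (intro scalar_prod_smult_distrib[of _ n]) auto
    also have "col W i \<bullet> col W 0 = (?Wt * W) $$ (i, 0)" using W(1) i n by simp
    also have "\<dots> = (if i = 0 then 1 else 0)" using i n by (simp add: W(2))
    finally show ?thesis by simp
  qed
  have row0: "A' $$ (0, i) = (if i = 0 then e else 0)" if i: "i < n" for i
  proof -
    have "A' $$ (0, i) = transpose_mat A' $$ (i, 0)" using i n A' by simp
    then show ?thesis using col0[OF i] sym' by simp
  qed
  define A3 where "A3 = mat ?n1 ?n1 (\<lambda>(i, j). A' $$ (Suc i, Suc j))"
  have A3: "A3 \<in> carrier_mat ?n1 ?n1" by (simp add: A3_def)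
  define A1 where "A1 = mat 1 1 (\<lambda>_. e)"
  have A1: "A1 \<in> carrier_mat 1 1" by (simp add: A1_def)
  have block: "A' = four_block_mat A1 (0\<^sub>m 1 ?n1) (0\<^sub>m ?n1 1) A3"
    using A' n col0 row0 by (intro eq_matI) (auto simp: A1_def A3_def)
  have sym3: "transpose_mat A3 = A3"
  proof (rule eq_matI)
    fix i j assume ij: "i < dim_row A3" "j < dim_col A3"
    then have "A' $$ (Suc j, Suc i) = transpose_mat A' $$ (Suc i, Suc j)" using A' A3 by auto
    then show "transpose_mat A3 $$ (i, j) = A3 $$ (i, j)" using ij sym' by (simp add: A3_def)
  qed (auto simp: A3_def)
  have "similar_mat A' A"
    using A A' W Wt WWt by (intro similar_matI[of _ _ ?Wt W n]) (auto simp: A'_def)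
  then have "char_poly A' = [:- e, 1:] * (\<Prod>e\<leftarrow>es. [:- e, 1:])" using cp char_poly_similar by metis
  moreover have "char_poly A' = char_poly A1 * char_poly A3"
    unfolding block by (rule char_poly_four_block_zeros_col[OF A1 _ A3]) simp
  moreover have "char_poly A1 = [:- e, 1:]" by (simp add: A1_def char_poly_defs det_def sign_def)
  ultimately have "char_poly A3 = (\<Prod>e\<leftarrow>es. [:- e, 1:])"
    by (metis mult_cancel_left pCons_eq_0_iff zero_neq_one)
  from Cons.IH[OF A3 sym3 this] obtain U where len: "length es = ?n1" and U: "U \<in> carrier_mat ?n1 ?n1"
    "transpose_mat U * U = 1\<^sub>m ?n1"
    "transpose_mat U * A3 * U = mat ?n1 ?n1 (\<lambda>(i, j). if i = j then es ! i else 0)" by blast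
  define F where "F = four_block_mat (1\<^sub>m 1) (0\<^sub>m 1 ?n1) (0\<^sub>m ?n1 1) U"
  have n1: "1 + ?n1 = n" using n by simp
  have "F \<in> carrier_mat (1 + ?n1) (1 + ?n1)"
    unfolding F_def using U(1) by (intro four_block_carrier_mat) auto
  then have F: "F \<in> carrier_mat n n" unfolding n1 .
  have Ft: "transpose_mat F = four_block_mat (1\<^sub>m 1) (0\<^sub>m 1 ?n1) (0\<^sub>m ?n1 1) (transpose_mat U)"
    unfolding F_def using U(1) by (subst transpose_four_block_mat) auto
  have blocks: "four_block_mat A (0\<^sub>m 1 ?n1) (0\<^sub>m ?n1 1) B * four_block_mat C (0\<^sub>m 1 ?n1) (0\<^sub>m ?n1 1) D
      = four_block_mat (A * C) (0\<^sub>m 1 ?n1) (0\<^sub>m ?n1 1) (B * D)"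
    if "A \<in> carrier_mat 1 1" "C \<in> carrier_mat 1 1" "B \<in> carrier_mat ?n1 ?n1" "D \<in> carrier_mat ?n1 ?n1"
    for A B C D :: "real mat"
    using that by (subst mult_four_block_mat[of _ 1 1 _ ?n1 _ ?n1 _ _ 1 _ ?n1]) auto
  have "transpose_mat F * F = four_block_mat (1\<^sub>m 1) (0\<^sub>m 1 ?n1) (0\<^sub>m ?n1 1) (1\<^sub>m ?n1)"
    unfolding Ft unfolding F_def using U(1,2) by (subst blocks) auto
  then have FF: "transpose_mat F * F = 1\<^sub>m n" unfolding four_block_one_mat n1 .
  have "transpose_mat F * A' * F = four_block_mat A1 (0\<^sub>m 1 ?n1) (0\<^sub>m ?n1 1) (transpose_mat U * A3) * F"
    unfolding Ft block using U(1) A1 A3 by (subst blocks) auto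
  also have "\<dots> = four_block_mat A1 (0\<^sub>m 1 ?n1) (0\<^sub>m ?n1 1) (transpose_mat U * A3 * U)"
    unfolding F_def using U(1) A1 A3 by (subst blocks) auto
  also have "\<dots> = mat n n (\<lambda>(i, j). if i = j then (e # es) ! i else 0)"
    unfolding U(3) using n by (intro eq_matI) (auto simp: A1_def nth_Cons split: nat.splits)
  finally have FAF: "transpose_mat F * A' * F = mat n n (\<lambda>(i, j). if i = j then (e # es) ! i else 0)" .
  have WF: "W * F \<in> carrier_mat n n" using W F by simp
  have tWF: "transpose_mat (W * F) = transpose_mat F * ?Wt" using W F by (simp add: transpose_mult[of _ n n _ n])
  have Ft': "transpose_mat F \<in> carrier_mat n n" using F by simp
  have "transpose_mat (W * F) * (W * F) = transpose_mat F * (?Wt * W) * F"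
    unfolding tWF using W(1) Wt F Ft' by (simp add: assoc_mult_mat[of _ n n _ n _ n])
  also have "\<dots> = 1\<^sub>m n" unfolding W(2) using F Ft' FF by simp
  finally have orth: "transpose_mat (W * F) * (W * F) = 1\<^sub>m n" .
  have "transpose_mat (W * F) * A * (W * F) = transpose_mat F * A' * F"
    unfolding tWF A'_def using A W(1) Wt F Ft' by (simp add: assoc_mult_mat[of _ n n _ n _ n])
  then show ?case using FAF WF orth len n by (intro conjI bexI[of _ "W * F"]) auto
qed

lemma out_degree_eq_card:
  "out_degree (with_proj G) v = card {u. (v, u) \<in> parcs G}"
proof -
  have "{e \<in> parcs G. fst e = v} = Pair v ` {u. (v, u) \<in> parcs G}" by force
  then show ?thesis by (simp add: out_degree_def out_arcs_def card_image inj_on_def)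
qed

lemma sum_nth_indicator:
  assumes "distinct vs" "X \<subseteq> set vs"
  shows "(\<Sum>i<length vs. if vs ! i \<in> X then f (vs ! i) else (0 :: real)) = (\<Sum>x\<in>X. f x)"
proof -
  have "(\<Sum>i<length vs. if vs ! i \<in> X then f (vs ! i) else 0) = (\<Sum>x\<in>set vs. if x \<in> X then f x else 0)"
    using assms(1) by (intro sum.reindex_bij_betw[OF bij_betw_nth[OF assms(1) refl refl], of "\<lambda>x. if x \<in> X then f x else 0"])
  also have "\<dots> = (\<Sum>x\<in>X. f x)" using assms(2) by (simp add: sum.If_cases Int_absorb1)
  finally show ?thesis .
qed

text \<open>Both indicator vectors are expanded in an orthonormal eigenbasis. The constant
  eigenvector contributes the main term, all other eigenvalues have modulus at most
  \<open>lam\<close>, and Cauchy-Schwarz with Parseval bounds their contribution. The count is over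
  ordered pairs, so an edge inside both \<open>X\<close> and \<open>Y\<close> counts twice.\<close>

theorem expander_mixing:
  assumes G: "ndl_graph G n d lam" and lam: "lam < d" and X: "X \<subseteq> pverts G" and Y: "Y \<subseteq> pverts G"
  shows "\<bar>real (card {(x, y) \<in> parcs G. x \<in> X \<and> y \<in> Y}) - d * card X * card Y / n\<bar>
    \<le> lam * sqrt (card X * card Y)"
proof -
  interpret pair_graph G using G by (simp add: ndl_graph_def)
  obtain ls vs where ls: "sorted_wrt (\<ge>) ls" "max (ls ! 1) \<bar>ls ! (n - 1)\<bar> \<le> lam"
    and vs: "distinct vs" "set vs = pverts G"
    and cp: "char_poly (adjacency_mat G vs) = (\<Prod>l\<leftarrow>ls. [:- l, 1:])"
    using G by (auto simp: ndl_graph_def adjacency_eigenvalues_def)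
  have n: "length vs = n" "2 \<le> n"
    using G vs distinct_card[OF vs(1)] by (auto simp: ndl_graph_def)
  define A where "A = adjacency_mat G vs"
  have A: "A \<in> carrier_mat n n" by (simp add: A_def adjacency_mat_def n)
  have Aij: "A $$ (i, j) = (if (vs ! i, vs ! j) \<in> parcs G then 1 else 0)" if "i < n" "j < n" for i j
    using that by (simp add: A_def adjacency_mat_def n)
  have sym: "(x, y) \<in> parcs G \<longleftrightarrow> (y, x) \<in> parcs G" for x y
    using pair_sym_arcs by (auto simp: symmetric_def sym_def)
  have "transpose_mat A = A" using A Aij sym by (intro eq_matI) auto
  from symmetric_mat_diagonalizable[OF A this cp[folded A_def]] obtain U where len: "length ls = n"
    and U: "U \<in> carrier_mat n n" "transpose_mat U * U = 1\<^sub>m n"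
      "transpose_mat U * A * U = mat n n (\<lambda>(i, j). if i = j then ls ! i else 0)" by blast
  define u where "u i j = U $$ (i, j)" for i j
  let ?Ut = "transpose_mat U"
  have Ut: "?Ut \<in> carrier_mat n n" using U(1) by simp
  have UUt: "U * ?Ut = 1\<^sub>m n" by (rule mat_mult_left_right_inverse[OF Ut U(1,2)])
  have orth: "(\<Sum>j<n. u x j * u y j) = (if x = y then 1 else 0)" if "x < n" "y < n" for x y
  proof -
    have "(U * ?Ut) $$ (x, y) = (\<Sum>j<n. u x j * u y j)"
      using that U(1) by (simp add: scalar_prod_def u_def atLeast0LessThan)
    then show ?thesis using UUt that by simp
  qed
  have AU: "(\<Sum>x<n. A $$ (y, x) * u x j) = ls ! j * u y j" if "y < n" "j < n" for y j
  proof -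
    have "A * U = (U * ?Ut) * (A * U)" using A U(1) UUt by simp
    also have "\<dots> = U * (?Ut * A * U)" using A U(1) Ut by (simp add: assoc_mult_mat[of _ n n _ n _ n])
    finally have "(A * U) $$ (y, j) = (U * mat n n (\<lambda>(i, j). if i = j then ls ! i else 0)) $$ (y, j)"
      using U(3) by simp
    also have "\<dots> = (\<Sum>i<n. u y i * (if i = j then ls ! i else 0))"
      using that U(1) by (simp add: scalar_prod_def u_def atLeast0LessThan)
    also have "\<dots> = ls ! j * u y j" using that by (simp add: if_distrib mult.commute cong: if_cong)
    finally show ?thesis using that A U(1) by (simp add: scalar_prod_def u_def atLeast0LessThan)
  qed
  have lsj: "\<bar>ls ! j\<bar> \<le> lam" if "1 \<le> j" "j < n" for j
  proof -
    have "ls ! j \<le> ls ! 1" using sorted_wrt_nth_less[OF ls(1), of 1 j] that len by (cases "j = 1") auto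
    moreover have "ls ! (n - 1) \<le> ls ! j"
      using sorted_wrt_nth_less[OF ls(1), of j "n - 1"] that len by (cases "j = n - 1") auto
    ultimately show ?thesis using ls(2) by linarith
  qed
  have lam0: "0 \<le> lam" using lsj[of 1] n by linarith
  have deg: "(\<Sum>y<n. A $$ (y, x)) = d" if "x < n" for x
  proof -
    have "vs ! x \<in> pverts G" using that n vs nth_mem by blast
    then have "card {u. (vs ! x, u) \<in> parcs G} = d"
      using G out_degree_eq_card[of G] by (auto simp: ndl_graph_def)
    moreover have sub: "{u. (vs ! x, u) \<in> parcs G} \<subseteq> set vs" using vs by (auto dest: in_arcsD2)
    ultimately have "real d = (\<Sum>y\<in>{u. (vs ! x, u) \<in> parcs G}. 1)" by simp
    also have "\<dots> = (\<Sum>y<n. if vs ! y \<in> {u. (vs ! x, u) \<in> parcs G} then 1 else 0)"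
      using sum_nth_indicator[OF vs(1) sub, of "\<lambda>_. 1"] n by simp
    also have "\<dots> = (\<Sum>y<n. A $$ (y, x))" using that sym by (intro sum.cong) (auto simp: Aij)
    finally show ?thesis by simp
  qed
  \<comment> \<open>The coordinates of the all-ones vector. Regularity gives (d -
    \<open>ls ! j\<close>) \<open>c j\<close> = 0, and \<open>lam < d\<close> makes them vanish for
    all j \<ge> 1. So column 0 is a constant vector and \<open>ls ! 0\<close> equals d, without any
    appeal to Perron-Frobenius.\<close>
  define c where "c j = (\<Sum>x<n. u x j)" for j
  have cj: "d * c j = ls ! j * c j" if "j < n" for j
  proof -
    have "ls ! j * c j = (\<Sum>y<n. \<Sum>x<n. A $$ (y, x) * u x j)"
      using that by (simp add: c_def sum_distrib_left AU)
    also have "\<dots> = (\<Sum>x<n. (\<Sum>y<n. A $$ (y, x)) * u x j)"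
      by (subst sum.swap) (simp add: sum_distrib_right)
    also have "\<dots> = d * c j" by (simp add: deg c_def sum_distrib_left)
    finally show ?thesis by auto
  qed
  have c0: "c j = 0" if "1 \<le> j" "j < n" for j
    using cj[OF that(2)] lsj[OF that] lam by auto
  have split0: "(\<Sum>j<n. f j) = f 0 + (\<Sum>j=1..<n. f j)" for f :: "nat \<Rightarrow> real"
    using n by (simp add: sum.atLeast_Suc_lessThan lessThan_atLeast0)
  have expand: "(\<Sum>j<n. u x j * (\<Sum>y<n. g y * u y j)) = g x" if "x < n" for x and g :: "nat \<Rightarrow> real"
  proof -
    have "(\<Sum>j<n. u x j * (\<Sum>y<n. g y * u y j)) = (\<Sum>y<n. g y * (\<Sum>j<n. u x j * u y j))"
      by (simp add: sum_distrib_left) (subst sum.swap, simp add: mult.left_commute)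
    also have "\<dots> = (\<Sum>y<n. if y = x then g y else 0)" using that by (intro sum.cong) (auto simp: orth)
    also have "\<dots> = g x" using that by simp
    finally show ?thesis .
  qed
  have ux0: "u x 0 * c 0 = 1" if "x < n" for x
    using expand[OF that, of "\<lambda>_. 1"] split0[of "\<lambda>j. u x j * c j"] c0 by (simp add: c_def)
  have c00: "c 0 \<noteq> 0" using ux0[of 0] n by auto
  have "c 0 * c 0 = (\<Sum>x<n. u x 0 * c 0)" by (simp add: c_def sum_distrib_right)
  then have cn: "c 0 * c 0 = n" using ux0 by simp
  have l0: "ls ! 0 = d" using cj[of 0] c00 n by auto
  \<comment> \<open>The coordinates of the indicator vector of \<open>X\<close> in the
    eigenbasis.\<close>
  define al where "al X j = (\<Sum>x<n. (if vs ! x \<in> X then 1 else 0) * u x j)" for X j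
  have card_ind: "(\<Sum>x<n. if vs ! x \<in> X then 1 else (0::real)) = card X" if "X \<subseteq> pverts G" for X
    using sum_nth_indicator[OF vs(1), of X "\<lambda>_. 1"] that vs n by simp
  have al0: "al X 0 * c 0 = card X" if "X \<subseteq> pverts G" for X
  proof -
    have "al X 0 * c 0 = (\<Sum>x<n. if vs ! x \<in> X then 1 else 0)"
      unfolding al_def sum_distrib_right by (intro sum.cong) (auto simp: ux0)
    then show ?thesis using card_ind[OF that] by simp
  qed
  have parseval: "(\<Sum>j<n. (al X j)\<^sup>2) = card X" if "X \<subseteq> pverts G" for X
  proof -
    have "(\<Sum>j<n. (al X j)\<^sup>2) = (\<Sum>x<n. (if vs ! x \<in> X then 1 else 0) * (\<Sum>j<n. u x j * al X j))"
      unfolding power2_eq_square sum_distrib_left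
      by (subst sum.swap) (simp add: al_def[of _ _] sum_distrib_right mult.assoc cong: if_cong)
    also have "\<dots> = (\<Sum>x<n. if vs ! x \<in> X then 1 else 0)"
      by (intro sum.cong) (auto simp: al_def expand)
    finally show ?thesis using card_ind[OF that] by simp
  qed
  have "real (card {(x, y) \<in> parcs G. x \<in> X \<and> y \<in> Y})
      = (\<Sum>x<n. (if vs ! x \<in> X then 1 else 0) * (\<Sum>y<n. A $$ (x, y) * (if vs ! y \<in> Y then 1 else 0)))"
  proof -
    have finXY: "finite X" "finite Y"
      using finite_subset[OF X pair_finite_verts] finite_subset[OF Y pair_finite_verts] .
    have "{(x, y) \<in> parcs G. x \<in> X \<and> y \<in> Y} = Sigma X (\<lambda>x. {y \<in> Y. (x, y) \<in> parcs G})" by auto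
    then have "real (card {(x, y) \<in> parcs G. x \<in> X \<and> y \<in> Y})
        = (\<Sum>x\<in>X. real (card {y \<in> Y. (x, y) \<in> parcs G}))" using finXY by simp
    also have "\<dots> = (\<Sum>x<n. if vs ! x \<in> X then real (card {y \<in> Y. (vs ! x, y) \<in> parcs G}) else 0)"
      using sum_nth_indicator[OF vs(1), of X "\<lambda>x. real (card {y \<in> Y. (x, y) \<in> parcs G})"] X vs n by simp
    also have "\<dots> = (\<Sum>x<n. (if vs ! x \<in> X then 1 else 0) *
        (\<Sum>y<n. A $$ (x, y) * (if vs ! y \<in> Y then 1 else 0)))"
    proof (intro sum.cong refl)
      fix x assume x: "x \<in> {..<n}"
      let ?Y = "{y \<in> Y. (vs ! x, y) \<in> parcs G}"
      have "real (card ?Y) = (\<Sum>y\<in>?Y. 1)" by simp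
      also have "\<dots> = (\<Sum>y<n. if vs ! y \<in> ?Y then 1 else 0)"
      proof -
        have "?Y \<subseteq> pverts G" using Y by blast
        from card_ind[OF this] show ?thesis by simp
      qed
      also have "\<dots> = (\<Sum>y<n. A $$ (x, y) * (if vs ! y \<in> Y then 1 else 0))"
        using x by (intro sum.cong) (auto simp: Aij)
      finally show "(if vs ! x \<in> X then real (card ?Y) else 0) =
        (if vs ! x \<in> X then 1 else 0) * (\<Sum>y<n. A $$ (x, y) * (if vs ! y \<in> Y then 1 else 0))" by simp
    qed
    finally show ?thesis .
  qed
  also have "\<dots> = (\<Sum>x<n. (if vs ! x \<in> X then 1 else 0) * (\<Sum>j<n. ls ! j * u x j * al Y j))"
  proof (intro sum.cong refl)
    fix x assume "x \<in> {..<n}"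
    then have x: "x < n" by simp
    have "(\<Sum>y<n. A $$ (x, y) * (if vs ! y \<in> Y then 1 else 0))
        = (\<Sum>y<n. A $$ (x, y) * (\<Sum>j<n. u y j * al Y j))"
      by (intro sum.cong) (auto simp: al_def expand)
    also have "\<dots> = (\<Sum>j<n. (\<Sum>y<n. A $$ (x, y) * u y j) * al Y j)"
      unfolding sum_distrib_left sum_distrib_right by (subst sum.swap) (simp add: mult.assoc)
    also have "\<dots> = (\<Sum>j<n. ls ! j * u x j * al Y j)" using x by (simp add: AU)
    finally show "(if vs ! x \<in> X then 1 else 0) * (\<Sum>y<n. A $$ (x, y) * (if vs ! y \<in> Y then 1 else 0))
      = (if vs ! x \<in> X then 1 else 0) * (\<Sum>j<n. ls ! j * u x j * al Y j)" by simp
  qed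
  also have "\<dots> = (\<Sum>j<n. ls ! j * al X j * al Y j)"
    unfolding sum_distrib_left
    by (subst sum.swap) (simp add: al_def[of X] sum_distrib_left sum_distrib_right mult.assoc mult.left_commute)
  finally have e: "real (card {(x, y) \<in> parcs G. x \<in> X \<and> y \<in> Y})
      = d * al X 0 * al Y 0 + (\<Sum>j=1..<n. ls ! j * al X j * al Y j)" unfolding split0 l0 .
  have "al X 0 * al Y 0 * n = (al X 0 * c 0) * (al Y 0 * c 0)" using cn by (simp add: algebra_simps)
  then have "al X 0 * al Y 0 * n = card X * card Y" using al0 X Y by simp
  then have main: "d * al X 0 * al Y 0 = d * card X * card Y / n" using n by (simp add: field_simps)
  have "\<bar>\<Sum>j=1..<n. ls ! j * al X j * al Y j\<bar> \<le> (\<Sum>j=1..<n. \<bar>ls ! j * al X j * al Y j\<bar>)"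
    by (rule sum_abs)
  also have "\<dots> \<le> (\<Sum>j=1..<n. lam * (\<bar>al X j\<bar> * \<bar>al Y j\<bar>))"
    using lsj by (intro sum_mono) (auto simp: abs_mult mult.assoc intro!: mult_right_mono)
  also have "\<dots> \<le> (\<Sum>j<n. lam * (\<bar>al X j\<bar> * \<bar>al Y j\<bar>))"
    using lam0 by (intro sum_mono2) auto
  also have "\<dots> = lam * (\<Sum>j<n. \<bar>al X j\<bar> * \<bar>al Y j\<bar>)" by (simp add: sum_distrib_left)
  also have "\<dots> \<le> lam * (L2_set (al X) {..<n} * L2_set (al Y) {..<n})"
    using lam0 by (intro mult_left_mono L2_set_mult_ineq)
  also have "\<dots> = lam * sqrt (card X * card Y)"
    using parseval X Y by (simp add: L2_set_def real_sqrt_mult)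
  finally show ?thesis using e main by simp
qed

section \<open>Cores in mixing graphs\<close>

lemma sum_Pow_power:
  fixes x :: real
  assumes "finite A"
  shows "(\<Sum>I\<in>Pow A. x ^ card I) = (1 + x) ^ card A"
  using prod_add[OF assms, of "\<lambda>_. x" "\<lambda>_. 1"] by (simp add: add.commute)

lemma one_plus_power_le:
  fixes x :: real
  assumes "0 \<le> x" "k * x \<le> 1"
  shows "(1 + x) ^ k \<le> 1 + 2 * (k * x)"
proof -
  have "(1 + x) ^ k \<le> exp x ^ k" using assms by (intro power_mono exp_ge_add_one_self) auto
  also have "\<dots> = exp (k * x)" by (simp add: exp_of_nat_mult)
  also have "\<dots> \<le> 1 + k * x + (k * x)\<^sup>2" using assms by (intro exp_bound) auto
  also have "(k * x)\<^sup>2 \<le> k * x" using assms by (simp add: power2_eq_square mult_left_le)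
  finally show ?thesis by linarith
qed

locale mixing_graph =
  fixes V :: "'a set" and N :: "'a \<Rightarrow> 'a set" and d :: nat and lam :: real
  assumes finV: "finite V" and N_sub: "N x \<subseteq> V" and N_sym: "y \<in> N x \<Longrightarrow> x \<in> N y"
    and deg: "v \<in> V \<Longrightarrow> card (N v) = d" and lam: "0 < lam" and d_pos: "0 < d"
    and mixing: "X \<subseteq> V \<Longrightarrow> Y \<subseteq> V \<Longrightarrow>
      \<bar>real (\<Sum>x\<in>X. card (N x \<inter> Y)) - d * card X * card Y / card V\<bar> \<le> lam * sqrt (card X * card Y)"
begin

lemma fin_N: "finite (N x)"
  using finite_subset[OF N_sub finV] .

lemma card_N_le: "card (N x) \<le> d"
proof (cases "x \<in> V")
  case False
  then have "N x = {}" using N_sub N_sym by blast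
  then show ?thesis by simp
qed (simp add: deg)

lemma nbhd_sub: "nbhd N X \<subseteq> V"
  using N_sub by (auto simp: nbhd_def)

lemma fin_nbhd: "finite (nbhd N X)"
  using finite_subset[OF nbhd_sub finV] .

lemma card_nbhd_le: "finite X \<Longrightarrow> card (nbhd N X) \<le> card X * d"
proof -
  assume X: "finite X"
  have "card (nbhd N X) \<le> (\<Sum>x\<in>X. card (N x))" unfolding nbhd_def using X by (rule card_UN_le)
  also have "\<dots> \<le> (\<Sum>x\<in>X. d)" by (intro sum_mono card_N_le)
  finally show ?thesis by simp
qed

lemma double_count:
  assumes S: "S \<subseteq> V"
  shows "(\<Sum>v\<in>V. card (N v \<inter> S)) = d * card S"
proof -
  have finS: "finite S" using finite_subset[OF S finV] .
  have "(\<Sum>v\<in>V. card (N v \<inter> S)) = card (Sigma V (\<lambda>v. N v \<inter> S))" using finV finS by simp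
  also have "\<dots> = card (Sigma S N)"
  proof (rule bij_betw_same_card[where f = "\<lambda>(x, y). (y, x)"])
    show "bij_betw (\<lambda>(x, y). (y, x)) (Sigma V (\<lambda>v. N v \<inter> S)) (Sigma S N)"
      by (rule bij_betw_byWitness[where f' = "\<lambda>(x, y). (y, x)"]) (use N_sym N_sub in auto)
  qed
  also have "\<dots> = (\<Sum>x\<in>S. card (N x))" using finS fin_N by simp
  also have "\<dots> = d * card S" using S deg by (simp add: subset_iff)
  finally show ?thesis .
qed

text \<open>Counting pairs, b d |X| is at most the main term d |X| |Y| / |V| plus the error term lam
  sqrt (|X| |Y|). One of the two is at least half of it, and these are the two alternatives.\<close>

lemma expansion:
  fixes b :: real
  assumes X: "X \<subseteq> V" "X \<noteq> {}" and Y: "Y \<subseteq> V" and b: "0 \<le> b" "\<And>x. x \<in> X \<Longrightarrow> b * d \<le> card (N x \<inter> Y)"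
  shows "b * card V / 2 \<le> card Y \<or> (b * d / (2 * lam))\<^sup>2 * card X \<le> card Y"
proof (rule disjCI)
  assume small: "\<not> (b * d / (2 * lam))\<^sup>2 * card X \<le> card Y"
  have finX: "finite X" using finite_subset[OF X(1) finV] .
  have cX: "0 < real (card X)" using finX X by (simp add: card_gt_0_iff)
  have cV: "0 < real (card V)" using X finV by (auto simp: card_gt_0_iff)
  show "b * card V / 2 \<le> card Y"
  proof (rule ccontr)
    assume neg: "\<not> b * card V / 2 \<le> card Y"
    have "b * d * card X = (\<Sum>x\<in>X. b * d)" by simp
    also have "\<dots> \<le> (\<Sum>x\<in>X. real (card (N x \<inter> Y)))" using b(2) by (intro sum_mono)
    also have "\<dots> \<le> d * card X * card Y / card V + lam * sqrt (card X * card Y)"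
      using mixing[OF X(1) Y] by simp
    also have "d * card X * card Y / card V = d * card X * (card Y / card V)" by simp
    also have "\<dots> \<le> d * card X * (b / 2)"
      using neg cV by (intro mult_left_mono) (auto simp: field_simps)
    finally have "b * d / 2 * card X \<le> lam * sqrt (card X * card Y)" by (simp add: field_simps)
    then have "b * d / (2 * lam) * card X \<le> sqrt (card X * card Y)" using lam by (simp add: field_simps)
    then have "(b * d / (2 * lam) * card X)\<^sup>2 \<le> (sqrt (card X * card Y))\<^sup>2"
      using b(1) lam by (intro power_mono) auto
    then have "((b * d / (2 * lam))\<^sup>2 * card X) * card X \<le> card Y * real (card X)"
      by (simp add: power2_eq_square mult_ac)
    then show False using small cX by simp
  qed
qed

text \<open>Without edges the mixing inequality reads d s^2 / |V| \<le> lam s for the geometric mean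
  s of the two sizes, so s would be at most lam |V| / d, less than \<open>m\<close>.\<close>

lemma edge_between:
  assumes X: "X \<subseteq> V" and Y: "Y \<subseteq> V" and m: "m \<le> card X" "m \<le> card Y" "lam * card V / d < real m"
  shows "\<exists>x\<in>X. \<exists>y\<in>Y. y \<in> N x"
proof (rule ccontr)
  assume no: "\<not> ?thesis"
  then have z: "(\<Sum>x\<in>X. card (N x \<inter> Y)) = 0" by (auto intro!: sum.neutral simp: card_eq_0_iff)
  have "0 \<le> lam * card V / d" using lam by simp
  then have m0: "0 < m" using m(3) by linarith
  have cV: "0 < real (card V)" using m0 m(1) card_mono[OF finV X] by linarith
  let ?s = "sqrt (card X * card Y)"
  have "real m * real m \<le> real (card X) * real (card Y)" using m(1,2) by (intro mult_mono) simp_all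
  then have "sqrt (real m * m) \<le> ?s" by (intro real_sqrt_le_mono) simp
  then have s: "m \<le> ?s" by simp
  then have s0: "0 < ?s" using m0 by linarith
  have ss: "?s * ?s = real (card X) * real (card Y)" by simp
  have "(d / card V * ?s) * ?s = d / card V * (?s * ?s)" by (rule mult.assoc)
  also have "\<dots> = d * card X * card Y / card V" unfolding ss by simp
  also have "\<dots> \<le> lam * ?s" using mixing[OF X Y] z by simp
  finally have "(d / card V * ?s) * ?s \<le> lam * ?s" .
  then have "d / card V * ?s \<le> lam" using s0 by (meson mult_le_cancel_right_pos)
  then have "?s \<le> lam * card V / d" using cV d_pos by (simp add: field_simps)
  then show False using s m(3) by linarith
qed

text \<open>Each vertex gets one of \<open>L\<close> colours; colours 0 and 1 give \<open>Q\<close>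
  and \<open>B\<close>. Each of them has mean at least \<epsilon> d / (2 L) in
  \<open>N v - D\<close>, and a quarter of that is retained. The choice of \<open>L\<close> makes
  the mean of both together at most \<epsilon> d / 16, so that exceeding \<epsilon> d / 4 is
  unlikely. An event reads only the colours of neighbours and thus meets at most d^2 events; with
  three causes of failure, \<open>large\<close> is the condition of the local lemma.\<close>

lemma split_neighbourhoods:
  fixes \<epsilon> :: real and L :: nat
  assumes eps: "0 < \<epsilon>" and L: "32 / \<epsilon> \<le> L" "2 \<le> L"
    and N': "\<And>v. v \<in> V \<Longrightarrow> \<epsilon> * d / 2 \<le> card (N v - D)" and D: "D \<subseteq> V"
    and large: "12 * real d ^ 2 * exp (- (\<epsilon> / (8 * L) * d)) \<le> 1"
  shows "\<exists>Q B. Q \<subseteq> V - D \<and> B \<subseteq> V - D \<and> Q \<inter> B = {} \<and>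
    (\<forall>v\<in>V. \<epsilon> / (8 * L) * d \<le> card (N v \<inter> Q) \<and> \<epsilon> / (8 * L) * d \<le> card (N v \<inter> B) \<and>
      card ((N v - D) \<inter> (Q \<union> B)) \<le> \<epsilon> * d / 4)"
proof -
  let ?C = "{..<L}" let ?W = "\<lambda>v. N v - D"
  let ?O = "V \<rightarrow>\<^sub>E ?C"
  let ?X = "\<lambda>f v T. card {y \<in> ?W v. f y \<in> T}"
  define E1 where "E1 v c = {f \<in> ?O. real (?X f v {c}) \<le> card (?W v) / (4 * L)}" for v c
  define E2 where "E2 v = {f \<in> ?O. \<epsilon> * d / 4 \<le> real (?X f v {0, 1})}" for v
  define E where "E v = E1 v 0 \<union> E1 v 1 \<union> E2 v" for v
  have finO: "finite ?O" using finV by (simp add: finite_PiE)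
  have Wsub: "?W v \<subseteq> V" for v using N_sub by auto
  have L0: "0 < real L" using L by simp
  have "{..<L} \<noteq> {}" using L(2) by (metis lessThan_iff empty_iff less_le_trans pos2)
  then have C: "finite ?C" "?C \<noteq> {}" "{0} \<subseteq> ?C" "{1} \<subseteq> ?C" "{0, 1} \<subseteq> ?C" using L by auto
  let ?e = "exp (- (\<epsilon> / (8 * L) * d))"
  have p1: "card (E1 v c) \<le> card ?O * ?e" if v: "v \<in> V" and c: "{c} \<subseteq> ?C" for v c
  proof -
    have "card (E1 v c) \<le> card ?O * exp (card (?W v) / (4 * L) - real (card (?W v)) * card {c} / (2 * card ?C))"
      unfolding E1_def by (rule card_lower_tail[OF finV C(1) Wsub c C(2)])
    also have "card (?W v) / (4 * L) - real (card (?W v)) * card {c} / (2 * card ?C) = - (card (?W v) / (4 * L))"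
      using L0 by (simp add: field_simps)
    also have "exp (- (card (?W v) / (4 * L))) \<le> ?e"
      using N'[OF v] L0 by (simp add: field_simps)
    finally show ?thesis by (simp add: mult_left_mono)
  qed
  have p2: "card (E2 v) \<le> card ?O * ?e" if v: "v \<in> V" for v
  proof -
    have "card (E2 v) \<le> card ?O * exp (real (card (?W v)) * card {0::nat, 1} / card ?C - \<epsilon> * d / 4 / 2)"
      unfolding E2_def by (rule card_upper_tail[OF finV C(1) Wsub C(5) C(2)])
    also have "exp (real (card (?W v)) * card {0::nat, 1} / card ?C - \<epsilon> * d / 4 / 2) \<le> ?e"
    proof -
      have "card (?W v) \<le> d" using card_mono[OF fin_N, of "?W v" v] card_N_le[of v] by auto
      then have "real (card (?W v)) * card {0::nat, 1} / card ?C \<le> real d * 2 / L"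
        using L0 by (simp add: divide_right_mono)
      also have "real d * 2 / L \<le> \<epsilon> * d / 16"
      proof -
        have "32 \<le> \<epsilon> * L" using L(1) eps by (simp add: field_simps)
        then have "32 * real d \<le> \<epsilon> * L * d" by (intro mult_right_mono) auto
        then show ?thesis using L0 by (simp add: field_simps)
      qed
      finally have "real (card (?W v)) * card {0::nat, 1} / card ?C - \<epsilon> * d / 4 / 2 \<le> - (\<epsilon> * d / 16)" by simp
      also have "\<dots> \<le> - (\<epsilon> / (8 * L) * d)"
      proof -
        have "\<epsilon> * d / (8 * L) \<le> \<epsilon> * d / 16" using L(2) eps by (intro divide_left_mono) auto
        then show ?thesis by simp
      qed
      finally show ?thesis by simp
    qed
    finally show ?thesis by (simp add: mult_left_mono)
  qed
  have dep: "depends_on (E v) (?W v) V ?C" for v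
    unfolding depends_on_def
  proof (intro conjI ballI impI)
    show "E v \<subseteq> ?O" by (auto simp: E_def E1_def E2_def)
    fix f g assume f: "f \<in> E v" and g: "g \<in> ?O" and eq: "\<forall>x\<in>?W v. f x = g x"
    have eqT: "{y \<in> ?W v. g y \<in> T} = {y \<in> ?W v. f y \<in> T}" for T using eq by auto
    show "g \<in> E v" using f g unfolding E_def E1_def E2_def Un_iff mem_Collect_eq eqT by blast
  qed
  have "\<exists>f\<in>?O. \<forall>v\<in>V. f \<notin> E v"
  proof (rule lovasz_local_lemma[where W = ?W and D = "d * d"])
    show "depends_on (E v) (?W v) V ?C" for v by (rule dep)
    show "1 \<le> d * d" using d_pos by simp
    fix v assume v: "v \<in> V"
    let ?D = "{w \<in> V. ?W w \<inter> ?W v \<noteq> {}}"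
    have "?D \<subseteq> nbhd N (N v)" using N_sym by (auto simp: nbhd_def)
    then have "card ?D \<le> card (nbhd N (N v))" by (intro card_mono fin_nbhd)
    also have "\<dots> \<le> card (N v) * d" by (intro card_nbhd_le fin_N)
    also have "\<dots> \<le> d * d" using card_N_le by (intro mult_le_mono1)
    finally show "card ?D \<le> d * d" .
    have "card (E v) \<le> card (E1 v 0) + card (E1 v 1) + card (E2 v)"
      unfolding E_def using card_Un_le[of "E1 v 0 \<union> E1 v 1" "E2 v"] card_Un_le[of "E1 v 0" "E1 v 1"] by linarith
    then have "real (card (E v)) \<le> 3 * (card ?O * ?e)"
      using p1[OF v C(3)] p1[OF v C(4)] p2[OF v] by linarith
    then have "4 * real (d * d) * card (E v) \<le> 4 * real (d * d) * (3 * (card ?O * ?e))"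
      by (intro mult_left_mono) auto
    also have "\<dots> = (12 * real d ^ 2 * ?e) * card ?O" by (simp add: power2_eq_square)
    also have "\<dots> \<le> card ?O" using mult_right_mono[OF large, of "real (card ?O)"] by simp
    finally show "4 * real (d * d) * card (E v) \<le> card ?O" by simp
  qed (use finV C in auto)
  then obtain f where f: "f \<in> ?O" "\<And>v. v \<in> V \<Longrightarrow> f \<notin> E v" by blast
  define Q where "Q = {x \<in> V - D. f x = 0}"
  define B where "B = {x \<in> V - D. f x = 1}"
  have "\<epsilon> / (8 * L) * d \<le> card (N v \<inter> Q) \<and> \<epsilon> / (8 * L) * d \<le> card (N v \<inter> B) \<and>
      card ((N v - D) \<inter> (Q \<union> B)) \<le> \<epsilon> * d / 4" if v: "v \<in> V" for v
  proof -
    have low: "\<epsilon> / (8 * L) * d \<le> card (?W v) / (4 * L)"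
      using N'[OF v] L0 by (simp add: field_simps)
    have "{y \<in> ?W v. f y \<in> {0}} = N v \<inter> Q" "{y \<in> ?W v. f y \<in> {1}} = N v \<inter> B"
      "{y \<in> ?W v. f y \<in> {0, 1}} = ?W v \<inter> (Q \<union> B)"
      using N_sub by (auto simp: Q_def B_def)
    then show ?thesis using f(2)[OF v] f(1) low by (simp add: E_def E1_def E2_def not_le)
  qed
  moreover have "Q \<subseteq> V - D" "B \<subseteq> V - D" "Q \<inter> B = {}" by (auto simp: Q_def B_def)
  ultimately show ?thesis by blast
qed


text \<open>If the matching at \<open>v\<close> fails, Hall's theorem gives colours \<open>I\<close>
  and a set \<open>B'\<close> of fewer than card I vertices such that no colour of \<open>I\<close>
  occurs in \<open>B\<close> next to \<open>U v - B'\<close>. These are the events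
  \<open>E1\<close>, and by \<open>hit\<close> such a pair has probability at most d^(- 9 card I).
  The event \<open>E2\<close> is that too many neighbours of \<open>v\<close> are coloured; its
  absence everywhere bounds the number of seeds by double counting. Both depend on the colours
  within distance two of \<open>v\<close>.\<close>

lemma colour_seeds:
  fixes U :: "'a \<Rightarrow> 'a set" and J :: "'a \<Rightarrow> nat set" and k M :: nat and mu :: real
  assumes B: "B \<subseteq> V" and U: "\<And>v. U v \<subseteq> N v" and J: "\<And>v. J v \<subseteq> {..<k}"
    and k: "k \<le> M" "k \<le> d" and d: "200 \<le> d"
    and hit: "\<And>v U'. v \<in> V \<Longrightarrow> U' \<subseteq> U v \<Longrightarrow> card (U v) < card U' + card (J v) \<Longrightarrow>
      9 * M * ln d \<le> card (nbhd N U' \<inter> B)"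
    and mu: "real d * k / M \<le> mu" "32 * real d ^ 4 * exp (- mu) \<le> 1"
  shows "\<exists>R m. (\<forall>i<k. R i \<subseteq> B) \<and> disjoint_family_on R {..<k} \<and>
    real d * (\<Sum>i<k. card (R i)) \<le> 4 * mu * card V \<and>
    (\<forall>v\<in>V. inj_on (m v) (J v) \<and> (\<forall>i\<in>J v. m v i \<in> U v \<and> N (m v i) \<inter> R i \<noteq> {}))"
\<comment> \<open>For \<open>k = 0\<close> the palette \<open>{..<M}\<close> may be empty, while the
  local lemma needs a nonempty one.\<close>
proof (cases "k = 0")
  case True
  then have "0 \<le> mu" "\<And>v. J v = {}" using mu(1) J by auto
  then show ?thesis using True by (intro exI[of _ "\<lambda>_. {}"]) (auto simp: disjoint_family_on_def)
next
  case False
  then have M0: "0 < M" using k by simp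
  let ?C = "{..<M}" let ?O = "V \<rightarrow>\<^sub>E ?C" let ?W = "\<lambda>v. N v \<union> nbhd N (N v)"
  define avoid where "avoid v I B' = {f \<in> ?O. \<forall>x \<in> nbhd N (U v - B') \<inter> B. f x \<notin> I}" for v I B'
  define S where "S v = {(I, B') \<in> Pow (J v) \<times> Pow (U v). card B' < card I}" for v
  define E1 where "E1 v = (\<Union>(I, B') \<in> S v. avoid v I B')" for v
  define E2 where "E2 v = {f \<in> ?O. 4 * mu \<le> card {y \<in> N v \<inter> B. f y \<in> {..<k}}}" for v
  define E where "E v = E1 v \<union> E2 v" for v
  have finO: "finite ?O" using finV by (simp add: finite_PiE)
  have C: "finite ?C" "?C \<noteq> {}" using M0 by (auto simp: lessThan_empty_iff)
  have finU: "finite (U v)" for v using finite_subset[OF U fin_N] .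
  have finJ: "finite (J v)" for v using finite_subset[OF J] by blast
  have finS: "finite (S v)" for v unfolding S_def using finU finJ by (auto intro: finite_subset[of _ "Pow (J v) \<times> Pow (U v)"])
  have d0: "0 < real d" "1 \<le> real d" using d by simp_all
  \<comment> \<open>The factor d^(-9) per colour is divided into \<open>x\<close> for each colour of
    \<open>I\<close> and \<open>y\<close> for each vertex of \<open>B'\<close>, which is possible
    since card B' < card I. The union bound over all pairs then factorizes into binomial sums and is
    at most 6 / d^5, small enough against the dependency bound \<open>4 * d ^ 4\<close> once d \<ge>
    200.\<close>
  define x y :: real where "x = 1 / real d ^ 6" and "y = 1 / real d ^ 3"
  have xy: "0 < x" "0 < y" "y \<le> 1" using d0 by (auto simp: x_def y_def)
  have pavoid: "card (avoid v I B') \<le> card ?O * (x ^ card I * y ^ card B')"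
    if v: "v \<in> V" and IB: "(I, B') \<in> S v" for v I B'
  proof -
    have IB': "I \<subseteq> J v" "B' \<subseteq> U v" "card B' < card I" using IB by (auto simp: S_def)
    let ?Y = "nbhd N (U v - B') \<inter> B"
    have "card (U v - B') = card (U v) - card B'"
      using IB'(2) finite_subset[OF IB'(2) finU] by (simp add: card_Diff_subset)
    moreover have "card I \<le> card (J v)" using IB'(1) by (intro card_mono finJ)
    ultimately have Y: "9 * M * ln d \<le> card ?Y" using IB'(2,3) card_mono[OF finU IB'(2)]
      by (intro hit[OF v]) auto
    have "card (avoid v I B') \<le> card ?O * exp (- (real (card I) * card ?Y / card ?C))"
      unfolding avoid_def using IB'(1) J[of v] k(1) B
      by (intro card_avoiding[OF finV C(1) _ _ C(2)]) auto
    also have "exp (- (real (card I) * card ?Y / card ?C)) \<le> exp (real (card I) * - (9 * ln d))"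
    proof -
      have "9 * ln d \<le> card ?Y / M" using Y M0 by (simp add: field_simps)
      then have "card I * (9 * ln d) \<le> card I * (card ?Y / M)" by (intro mult_left_mono) auto
      then show ?thesis by simp
    qed
    also have "exp (real (card I) * - (9 * ln d)) = exp (- (9 * ln d)) ^ card I" by (rule exp_of_nat_mult)
    also have "exp (- (9 * ln d)) = x * y"
    proof -
      have "exp (9 * ln d) = real d ^ 9" using d0 exp_of_nat_mult[of 9 "ln d"] by simp
      also have "\<dots> = real d ^ 6 * real d ^ 3" by (simp add: power_add[symmetric])
      finally have "exp (- (9 * ln d)) = inverse (real d ^ 6 * real d ^ 3)" by (simp only: exp_minus)
      also have "\<dots> = x * y" unfolding x_def y_def by (simp only: inverse_mult_distrib inverse_eq_divide[symmetric])
      finally show ?thesis .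
    qed
    also have "(x * y) ^ card I \<le> x ^ card I * y ^ card B'"
      unfolding power_mult_distrib using xy IB'(3) by (intro mult_left_mono power_decreasing) auto
    finally show ?thesis by (simp add: mult_left_mono)
  qed
  have p1: "card (E1 v) \<le> card ?O * (6 / real d ^ 5)" if v: "v \<in> V" for v
  proof -
    have "card (E1 v) \<le> (\<Sum>p\<in>S v. card (case p of (I, B') \<Rightarrow> avoid v I B'))"
      unfolding E1_def by (rule card_UN_le[OF finS])
    then have "real (card (E1 v)) \<le> (\<Sum>p\<in>S v. real (card (case p of (I, B') \<Rightarrow> avoid v I B')))"
      by (metis of_nat_le_iff of_nat_sum)
    also have "\<dots> \<le> (\<Sum>(I, B')\<in>S v. card ?O * (x ^ card I * y ^ card B'))"
      using pavoid[OF v] by (intro sum_mono) auto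
    also have "\<dots> \<le> (\<Sum>(I, B')\<in>(Pow (J v) - {{}}) \<times> Pow (U v). card ?O * (x ^ card I * y ^ card B'))"
      using finU finJ xy by (intro sum_mono2) (auto simp: S_def)
    also have "\<dots> = card ?O * ((\<Sum>I\<in>Pow (J v) - {{}}. x ^ card I) * (\<Sum>B'\<in>Pow (U v). y ^ card B'))"
      unfolding sum_product unfolding sum.cartesian_product unfolding sum_distrib_left by (intro sum.cong) auto
    also have "(\<Sum>I\<in>Pow (J v) - {{}}. x ^ card I) = (1 + x) ^ card (J v) - 1"
      using finJ by (simp add: sum_diff1 sum_Pow_power)
    also have "(\<Sum>B'\<in>Pow (U v). y ^ card B') = (1 + y) ^ card (U v)"
      using finU by (simp add: sum_Pow_power)
    also have "((1 + x) ^ card (J v) - 1) * (1 + y) ^ card (U v) \<le> (2 / real d ^ 5) * 3"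
    proof (rule mult_mono)
      have "card (J v) \<le> d" using card_mono[OF _ J[of v]] k by simp
      then have "card (J v) * x \<le> d * x" using xy by (intro mult_right_mono) auto
      also have "d * x = 1 / real d ^ 5" using d0 by (simp add: x_def power_Suc[symmetric] del: power_Suc) (simp add: numeral_eq_Suc)
      finally have 1: "card (J v) * x \<le> 1 / real d ^ 5" .
      also have "1 / real d ^ 5 \<le> 1" using d0 by simp
      finally have "(1 + x) ^ card (J v) \<le> 1 + 2 * (card (J v) * x)" using xy by (intro one_plus_power_le) auto
      then show "(1 + x) ^ card (J v) - 1 \<le> 2 / real d ^ 5" using 1 by simp
      have "card (U v) \<le> d" using card_mono[OF fin_N U[of v]] card_N_le[of v] by simp
      then have "card (U v) * y \<le> d * y" using xy by (intro mult_right_mono) auto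
      also have "d * y = 1 / real d ^ 2" using d0 by (simp add: y_def numeral_eq_Suc)
      also have "\<dots> \<le> 1" using d0 by simp
      finally have 2: "card (U v) * y \<le> 1" .
      then have "(1 + y) ^ card (U v) \<le> 1 + 2 * (card (U v) * y)" using xy by (intro one_plus_power_le) auto
      then show "(1 + y) ^ card (U v) \<le> 3" using 2 by simp
    qed (use xy in auto)
    finally show ?thesis by (simp add: mult_left_mono)
  qed
  have p2: "card (E2 v) \<le> card ?O * exp (- mu)" for v
  proof -
    have "card (E2 v) \<le> card ?O * exp (real (card (N v \<inter> B)) * card {..<k} / card ?C - 4 * mu / 2)"
      unfolding E2_def using B k by (intro card_upper_tail[OF finV C(1) _ _ C(2)]) auto
    also have "exp (real (card (N v \<inter> B)) * card {..<k} / card ?C - 4 * mu / 2) \<le> exp (- mu)"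
    proof -
      have "card (N v \<inter> B) \<le> d" using card_mono[OF fin_N, of "N v \<inter> B" v] card_N_le[of v] by auto
      then have "real (card (N v \<inter> B)) * k / M \<le> real d * k / M"
        by (intro divide_right_mono mult_right_mono) auto
      then show ?thesis using mu(1) by simp
    qed
    finally show ?thesis by (simp add: mult_left_mono)
  qed
  have dep: "depends_on (E v) (?W v) V ?C" for v
    unfolding depends_on_def
  proof (intro conjI ballI impI)
    show "E v \<subseteq> ?O" by (auto simp: E_def E1_def E2_def avoid_def)
    fix f g assume f: "f \<in> E v" and g: "g \<in> ?O" and eq: "\<forall>x\<in>?W v. f x = g x"
    show "g \<in> E v"
    proof (cases "f \<in> E2 v")
      case True
      have "{y \<in> N v \<inter> B. g y \<in> {..<k}} = {y \<in> N v \<inter> B. f y \<in> {..<k}}" using eq by auto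
      then show ?thesis using True g by (simp add: E_def E2_def)
    next
      case False
      then obtain I B' where IB: "(I, B') \<in> S v" "f \<in> avoid v I B'" using f by (auto simp: E_def E1_def)
      have "nbhd N (U v - B') \<subseteq> ?W v" using U[of v] by (auto simp: nbhd_def)
      then have "g \<in> avoid v I B'" using IB(2) g eq by (auto simp: avoid_def subset_iff)
      then show ?thesis using IB(1) by (auto simp: E_def E1_def)
    qed
  qed
  have cW: "card (?W v) \<le> d + d * d" for v
  proof -
    have "card (?W v) \<le> card (N v) + card (nbhd N (N v))" by (rule card_Un_le)
    also have "card (nbhd N (N v)) \<le> card (N v) * d" by (intro card_nbhd_le fin_N)
    finally show ?thesis using card_N_le[of v] mult_le_mono1[OF card_N_le[of v], of d] by linarith
  qed
  have "\<exists>f\<in>?O. \<forall>v\<in>V. f \<notin> E v"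
  proof (rule lovasz_local_lemma[where W = ?W and D = "4 * d ^ 4"])
    show "depends_on (E v) (?W v) V ?C" for v by (rule dep)
    show "1 \<le> 4 * d ^ 4" using d by (simp add: Suc_le_eq)
    fix v assume v: "v \<in> V"
    let ?D = "{w \<in> V. ?W w \<inter> ?W v \<noteq> {}}"
    have "?D \<subseteq> (\<Union>x\<in>?W v. ?W x)"
    proof
      fix w assume "w \<in> ?D"
      then obtain x where x: "x \<in> ?W v" "x \<in> ?W w" by blast
      from x(2) consider "x \<in> N w" | z where "z \<in> N w" "x \<in> N z" by (auto simp: nbhd_def)
      then have "w \<in> ?W x"
      proof cases
        case 1
        then show ?thesis using N_sym[of x w] by simp
      next
        case 2
        then show ?thesis using N_sym[of x z] N_sym[of z w] by (auto simp: nbhd_def)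
      qed
      then show "w \<in> (\<Union>x\<in>?W v. ?W x)" using x by blast
    qed
    then have "card ?D \<le> card (\<Union>x\<in>?W v. ?W x)"
      by (intro card_mono) (auto simp: fin_N fin_nbhd)
    also have "\<dots> \<le> (\<Sum>x\<in>?W v. card (?W x))" by (intro card_UN_le) (auto simp: fin_N fin_nbhd)
    also have "\<dots> \<le> (\<Sum>x\<in>?W v. d + d * d)" by (intro sum_mono cW)
    also have "\<dots> = card (?W v) * (d + d * d)" by simp
    also have "\<dots> \<le> (d + d * d) * (d + d * d)" by (intro mult_le_mono1 cW)
    also have "\<dots> \<le> (2 * (d * d)) * (2 * (d * d))" using d by (intro mult_le_mono) auto
    also have "\<dots> = 4 * d ^ 4" by (simp add: power4_eq_xxxx)
    finally show "card ?D \<le> 4 * d ^ 4" .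
    have "card (E v) \<le> card (E1 v) + card (E2 v)" unfolding E_def by (rule card_Un_le)
    then have "real (card (E v)) \<le> card ?O * (6 / real d ^ 5 + exp (- mu))"
      using p1[OF v] p2[of v] by (simp add: distrib_left)
    then have "4 * real (4 * d ^ 4) * card (E v) \<le> 4 * real (4 * d ^ 4) * (card ?O * (6 / real d ^ 5 + exp (- mu)))"
      by (intro mult_left_mono) auto
    also have "\<dots> = card ?O * (96 * (real d ^ 4 / real d ^ 5) + 16 * real d ^ 4 * exp (- mu))"
      by (simp add: algebra_simps)
    also have "real d ^ 4 / real d ^ 5 = 1 / d" using d0 by (simp add: numeral_eq_Suc)
    also have "card ?O * (96 * (1 / d) + 16 * real d ^ 4 * exp (- mu)) \<le> real (card ?O) * 1"
    proof (rule mult_left_mono)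
      have "96 * (1 / real d) \<le> 1 / 2" using d by (simp add: field_simps)
      then show "96 * (1 / real d) + 16 * real d ^ 4 * exp (- mu) \<le> 1" using mu(2) by linarith
    qed auto
    finally show "4 * real (4 * d ^ 4) * card (E v) \<le> card ?O" by simp
  qed (use finV C in auto)
  then obtain f where f: "f \<in> ?O" "\<And>v. v \<in> V \<Longrightarrow> f \<notin> E v" by blast
  define R where "R i = {x \<in> B. f x = i}" for i
  have RB: "R i \<subseteq> B" for i by (auto simp: R_def)
  have finB: "finite B" using finite_subset[OF B finV] .
  have disj: "disjoint_family_on R {..<k}" by (auto simp: disjoint_family_on_def R_def)
  let ?S = "{x \<in> B. f x \<in> {..<k}}"
  have "(\<Sum>i<k. card (R i)) = card ?S"
  proof -
    have "?S = (\<Union>i<k. R i)" by (auto simp: R_def)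
    then show ?thesis using disj finite_subset[OF RB finB]
      by (simp add: card_UN_disjoint disjoint_family_on_def)
  qed
  moreover have "real d * card ?S \<le> 4 * mu * card V"
  proof -
    have SV: "?S \<subseteq> V" using B by auto
    have "real d * card ?S = (\<Sum>v\<in>V. real (card (N v \<inter> ?S)))"
      using arg_cong[OF double_count[OF SV], of real] by (simp only: of_nat_mult of_nat_sum)
    also have "\<dots> \<le> (\<Sum>v\<in>V. 4 * mu)"
    proof (intro sum_mono)
      fix v assume v: "v \<in> V"
      have "{y \<in> N v \<inter> B. f y \<in> {..<k}} = N v \<inter> ?S" by auto
      then show "real (card (N v \<inter> ?S)) \<le> 4 * mu" using f(2)[OF v] f(1) by (simp add: E_def E2_def)
    qed
    finally show ?thesis by (simp add: mult.commute)
  qed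
  moreover have "\<exists>m. inj_on m (J v) \<and> (\<forall>i\<in>J v. m i \<in> {u \<in> U v. N u \<inter> R i \<noteq> {}})" if v: "v \<in> V" for v
  proof (rule hall_marriage)
    show "finite (J v)" by (rule finJ)
    show "finite {u \<in> U v. N u \<inter> R i \<noteq> {}}" for i using finU by simp
    fix I assume I: "I \<subseteq> J v"
    let ?B = "\<Union>i\<in>I. {u \<in> U v. N u \<inter> R i \<noteq> {}}"
    show "card I \<le> card ?B"
    proof (rule ccontr)
      assume "\<not> card I \<le> card ?B"
      then have "(I, ?B) \<in> S v" using I by (auto simp: S_def)
      moreover have "f \<in> avoid v I ?B" using f(1) by (auto simp: avoid_def nbhd_def R_def)
      ultimately show False using f(2)[OF v] by (auto simp: E_def E1_def)
    qed
  qed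
  then obtain m where "\<And>v. v \<in> V \<Longrightarrow> inj_on (m v) (J v) \<and> (\<forall>i\<in>J v. m v i \<in> {u \<in> U v. N u \<inter> R i \<noteq> {}})"
    by metis
  then have "\<forall>v\<in>V. inj_on (m v) (J v) \<and> (\<forall>i\<in>J v. m v i \<in> U v \<and> N (m v i) \<inter> R i \<noteq> {})" by blast
  ultimately show ?thesis using RB disj by (intro exI[of _ R] exI[of _ m] conjI) simp_all
qed

end

section \<open>The amortized cost of merging\<close>

lemma sq_le_4_pow2: "real y \<le> 2 * sqrt (2 ^ y)"
proof -
  have "y\<^sup>2 \<le> 4 * 2 ^ y"
  proof (induction y)
    case (Suc y)
    have "2 * y + 1 \<le> 4 * 2 ^ y" using less_exp[of y] by linarith
    then show ?case using Suc by (simp add: power2_eq_square)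
  qed simp
  then have "real (y\<^sup>2) \<le> real (4 * 2 ^ y)" by (simp only: of_nat_le_iff)
  then have "(real y)\<^sup>2 \<le> (2 * sqrt (2 ^ y))\<^sup>2" by (simp add: power_mult_distrib)
  then show ?thesis by (rule power2_le_imp_le) simp
qed

text \<open>
  With \<open>j\<close> components left, binary trees of height \<open>h\<close> at half of them have at least \<open>m\<close> leaves;
  \<open>B\<close> majorizes the sum over \<open>j\<close> of the lengths \<open>2 h\<close> of the connecting paths.
\<close>

lemma merge_cost:
  fixes a m j :: nat and q :: real
  assumes m: "1 \<le> m" and j: "2 \<le> j" and q: "0 < q" "q\<^sup>2 \<le> 2 ^ a"
  defines "B \<equiv> \<lambda>j. 2 * real a * real j + 20 * sqrt m / q * sqrt j"
  shows "\<exists>h. m \<le> (j div 2) * 2 ^ h \<and> j * (2 ^ Suc h - 2) \<le> 12 * m \<and> 2 * real h \<le> B j - B (j - 1)"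
proof -
  have j2: "1 \<le> j div 2" "j \<le> 3 * (j div 2)" using j by presburger+
  define h where "h = (LEAST h. m \<le> (j div 2) * 2 ^ h)"
  have "m \<le> (j div 2) * 2 ^ m" using mult_le_mono[OF j2(1) less_imp_le[OF less_exp[of m]]] by simp
  then have h: "m \<le> (j div 2) * 2 ^ h" unfolding h_def by (rule LeastI)
  \<comment> \<open>The term of \<open>B\<close> linear in \<open>j\<close> pays for heights up to
    \<open>a\<close>. The excess of the height over \<open>a\<close> is about log (m / (j q^2)),
    hence bounded by a multiple of sqrt (m / j) / q, which up to a constant is the increment of sqrt
    (m j) / q; this is the origin of the second term.\<close>
  define c where "c = 20 * sqrt m / q"
  have c0: "0 \<le> c" using q by (simp add: c_def)
  define s where "s = sqrt j"
  have s0: "0 < s" "s * s = j" using j by (auto simp: s_def)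
  have diff: "1 / (2 * s) \<le> s - sqrt (real (j - 1))"
  proof -
    define t where "t = sqrt (real (j - 1))"
    have t: "0 \<le> t" "t * t = real j - 1" using j by (auto simp: t_def)
    have "t \<le> s" unfolding t_def s_def by (intro real_sqrt_le_mono) simp
    have "(s - t) * (s + t) = s * s - t * t" by (simp add: algebra_simps)
    then have "(s - t) * (s + t) = 1" using s0(2) t(2) by linarith
    moreover have "(s - t) * (s + t) \<le> (s - t) * (2 * s)" using \<open>t \<le> s\<close> by (intro mult_left_mono) auto
    ultimately have "1 \<le> (s - t) * (2 * s)" by linarith
    then have "1 / (2 * s) \<le> s - t" using s0(1) by (simp add: pos_divide_le_eq)
    then show ?thesis unfolding t_def .
  qed
  have Bdiff: "2 * real a + c * (1 / (2 * s)) \<le> B j - B (j - 1)"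
  proof -
    have "B j = 2 * real a * real j + c * s" by (simp add: B_def c_def s_def)
    moreover have "B (j - 1) = 2 * real a * real (j - 1) + c * sqrt (real (j - 1))"
      by (simp add: B_def c_def)
    moreover have "2 * real a * real j = 2 * real a * real (j - 1) + 2 * real a"
      using j by (simp add: of_nat_diff algebra_simps)
    ultimately have "B j - B (j - 1) = 2 * real a + c * (s - sqrt (real (j - 1)))"
      by (simp only: right_diff_distrib)
    moreover have "c * (1 / (2 * s)) \<le> c * (s - sqrt (real (j - 1)))" using diff c0 by (rule mult_left_mono)
    ultimately show ?thesis by linarith
  qed
  show ?thesis
  proof (cases h)
    case 0
    have "0 \<le> c * (1 / (2 * s))" using c0 s0 by simp
    then have "0 \<le> B j - B (j - 1)" using Bdiff by linarith
    then show ?thesis using h 0 by (intro exI[of _ 0]) auto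
  next
    case (Suc h')
    then have lt: "(j div 2) * 2 ^ h' < m" unfolding h_def using not_less_Least[of h' "\<lambda>h. m \<le> (j div 2) * 2 ^ h"] by auto
    \<comment> \<open>Minimality of the height gives fewer than \<open>m\<close> leaves one level
      lower; rounding \<open>j div 2\<close> costs a factor 3 and the two extra levels a factor 4,
      whence 12.\<close>
    have "j * 2 ^ Suc h \<le> (3 * (j div 2)) * 2 ^ Suc h" using j2(2) by (rule mult_le_mono1)
    also have "\<dots> = 12 * ((j div 2) * 2 ^ h')" using Suc by simp
    also have "\<dots> \<le> 12 * m" using lt by simp
    finally have c1: "j * 2 ^ Suc h \<le> 12 * m" .
    have "j * (2 ^ Suc h - 2) \<le> j * 2 ^ Suc h" by (intro mult_le_mono2) simp
    then have c2: "j * (2 ^ Suc h - 2) \<le> 12 * m" using c1 by linarith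
    have "2 * real h \<le> 2 * real a + c * (1 / (2 * s))"
    proof (cases "h \<le> a")
      case True
      then show ?thesis using c0 s0 by (simp add: add_increasing2)
    next
      case False
      define y where "y = h - a"
      have hy: "h = a + y" using False by (simp add: y_def)
      have "real j * 2 ^ h \<le> 6 * m"
        using c1 by (simp add: of_nat_le_iff[where ?'a = real, symmetric] del: of_nat_le_iff)
      then have "real j * (2 ^ a * 2 ^ y) \<le> 6 * m" by (simp add: hy power_add)
      moreover have "real j * (q\<^sup>2 * 2 ^ y) \<le> real j * (2 ^ a * 2 ^ y)"
        using q by (intro mult_left_mono mult_right_mono) auto
      ultimately have "(s * q * sqrt (2 ^ y))\<^sup>2 \<le> 6 * m"
        using s0(2) by (simp add: power_mult_distrib power2_eq_square[of s] mult_ac)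
      also have "\<dots> \<le> (5 / 2 * sqrt m)\<^sup>2" unfolding power_mult_distrib by (simp add: power_divide)
      finally have "s * q * sqrt (2 ^ y) \<le> 5 / 2 * sqrt m" by (rule power2_le_imp_le) simp
      then have "sqrt (2 ^ y) \<le> 5 / 2 * sqrt m / (s * q)" using s0 q by (simp add: field_simps)
      then have "2 * (2 * sqrt (2 ^ y)) \<le> c * (1 / (2 * s))" using s0 q by (simp add: c_def field_simps)
      then show ?thesis using sq_le_4_pow2[of y] by (simp add: hy)
    qed
    then show ?thesis using h c2 Bdiff by (intro exI[of _ h]) linarith
  qed
qed

section \<open>From seeds to cores\<close>

context mixing_graph
begin

text \<open>The parameter \<open>q\<close> of the potential is taken to be d. At most d colours
  contribute at most sqrt |V| each to its square-root part, so the factor 1 / d bounds their total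
  by 20 sqrt (m |V|), independently of how the seeds are distributed. The price is 2^a \<ge> d^2,
  that is, \<open>2 * real a\<close> of order ln d per seed.\<close>

lemma connect_seeds:
  fixes b :: real and k m a :: nat
  assumes Q: "Q \<subseteq> V" and b: "0 < b" "\<And>v. v \<in> V \<Longrightarrow> b * d \<le> card (N v \<inter> Q)"
    and m: "1 \<le> m" "lam * card V / d < m" and exp: "12 * real m \<le> b * card V" "12 \<le> (b * d / lam)\<^sup>2"
    and a: "real d ^ 2 \<le> 2 ^ a"
    and Z: "\<And>i. i < k \<Longrightarrow> Z i \<subseteq> V - Q" "\<And>i. i < k \<Longrightarrow> Z i \<noteq> {}" "disjoint_family_on Z {..<k}"
    and k: "k \<le> d"
    and size: "19 * real m + 2 * real a * (\<Sum>i<k. card (Z i)) + 20 * sqrt m * sqrt (card V) < b * card V"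
  shows "\<exists>P. (\<forall>i<k. P i \<subseteq> Q \<and> conn N (Z i \<union> P i)) \<and> disjoint_family_on P {..<k}"
proof -
  interpret expanding V N m
    by unfold_locales (use finV N_sub N_sym m edge_between in auto)
  have finQ: "finite Q" using finite_subset[OF Q finV] .
  have d0: "0 < real d" using d_pos by simp
  have "ext Q (\<lambda>_. 3)"
    unfolding ext_def
  proof (intro allI impI)
    fix X assume X: "X \<subseteq> V" "card X \<le> 2 * m"
    show "(\<Sum>x\<in>X. 3) \<le> int (card (nbhd N X \<inter> Q))"
    proof (cases "X = {}")
      case False
      have "b * card V / 2 \<le> card (nbhd N X \<inter> Q) \<or> (b * d / (2 * lam))\<^sup>2 * card X \<le> card (nbhd N X \<inter> Q)"
      proof (rule expansion[OF X(1) False])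
        fix x assume x: "x \<in> X"
        then have "N x \<inter> Q = N x \<inter> (nbhd N X \<inter> Q)" by (auto simp: nbhd_def)
        then show "b * d \<le> card (N x \<inter> (nbhd N X \<inter> Q))" using b(2)[of x] x X(1) by auto
      qed (use b Q in auto)
      \<comment> \<open>Budget 3 holds in both cases of the expansion: either half of b |V| exceeds
        three times 2 m, or the expansion factor is at least 3.\<close>
      then have "3 * real (card X) \<le> card (nbhd N X \<inter> Q)"
      proof
        assume "b * card V / 2 \<le> card (nbhd N X \<inter> Q)"
        moreover have "real (card X) \<le> 2 * real m" using X(2) by linarith
        ultimately show ?thesis using exp(1) by linarith
      next
        assume h: "(b * d / (2 * lam))\<^sup>2 * card X \<le> card (nbhd N X \<inter> Q)"
        have "(b * d / (2 * lam))\<^sup>2 = (b * d / lam)\<^sup>2 / 4" by (simp add: power2_eq_square)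
        then have "3 \<le> (b * d / (2 * lam))\<^sup>2" using exp(2) by simp
        then have "3 * real (card X) \<le> (b * d / (2 * lam))\<^sup>2 * card X" by (intro mult_right_mono) auto
        then show ?thesis using h by linarith
      qed
      then show ?thesis by simp
    qed simp
  qed
  define B where "B j = 2 * real a * real j + 20 * sqrt m / d * sqrt j" for j
  have "b * card V \<le> card Q"
  proof -
    have "d * (b * card V) = (\<Sum>v\<in>V. b * d)" by simp
    also have "\<dots> \<le> (\<Sum>v\<in>V. real (card (N v \<inter> Q)))" using b(2) by (rule sum_mono)
    also have "\<dots> = real (\<Sum>v\<in>V. card (N v \<inter> Q))" by simp
    also have "\<dots> = real d * card Q" using double_count[OF Q] by simp
    finally show ?thesis using d0 by simp
  qed
  moreover have "(\<Sum>i<k. B (card (Z i))) \<le> 2 * real a * (\<Sum>i<k. card (Z i)) + 20 * sqrt m * sqrt (card V)"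
  proof -
    have "(\<Sum>i<k. sqrt (card (Z i))) \<le> (\<Sum>i<k. sqrt (card V))"
      using Z(1) finV by (intro sum_mono real_sqrt_le_mono of_nat_mono card_mono) auto
    also have "\<dots> \<le> d * sqrt (card V)" using k by (simp add: mult_right_mono)
    finally have "20 * sqrt m / d * (\<Sum>i<k. sqrt (card (Z i))) \<le> 20 * sqrt m / d * (d * sqrt (card V))"
      by (intro mult_left_mono) auto
    also have "\<dots> = 20 * sqrt m * sqrt (card V)" using d0 by simp
    finally show ?thesis by (simp add: B_def sum.distrib sum_distrib_left)
  qed
  ultimately have sz: "19 * real m + (\<Sum>i<k. B (card (Z i))) < card Q" using size by linarith
  show ?thesis
  proof (rule connect_all[OF \<open>ext Q (\<lambda>_. 3)\<close> Q Z _ sz])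
    show "\<exists>h. m \<le> (j div 2) * 2 ^ h \<and> j * (2 ^ Suc h - 2) \<le> 12 * m \<and> 2 * real h \<le> B j - B (j - 1)"
      if "2 \<le> j" for j
      using merge_cost[OF m(1) that d0 a] by (simp add: B_def)
    show "B i \<le> B j" if "i \<le> j" for i j
      unfolding B_def using that d0 by (intro add_mono mult_left_mono) auto
    show "0 \<le> B 0" by (simp add: B_def)
  qed
qed


text \<open>The root neighbours \<open>t i\<close> name the cores. Of the neighbours of
  \<open>v\<close>, the set \<open>U v\<close> offers those outside the root, the chosen neighbours
  and both reservoirs, while \<open>J v\<close> collects the colours whose \<open>t i\<close> is not
  adjacent to \<open>v\<close>. The slack \<epsilon> d pays for the reservoirs, for rounding and the
  root, and still leaves \<epsilon> d / 2 vertices after any Hall violator is removed.\<close>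

lemma cores_exist:
  fixes \<epsilon> mu :: real and L M a m :: nat
  assumes eps: "0 < \<epsilon>" "\<epsilon> < 1" and r: "r \<in> V" "r \<notin> N r"
    and L: "32 / \<epsilon> \<le> L" "2 \<le> L" and d: "200 \<le> d" "8 \<le> \<epsilon> * d"
    and split: "12 * real d ^ 2 * exp (- (\<epsilon> / (8 * L) * d)) \<le> 1"
    and mu: "real d * d / M \<le> mu" "32 * real d ^ 4 * exp (- mu) \<le> 1" and dM: "d \<le> M"
    and hit: "9 * M * ln d \<le> \<epsilon> / (8 * L) * card V / 2"
      "9 * M * ln d \<le> (\<epsilon> / (8 * L) * d / (2 * lam))\<^sup>2 * (\<epsilon> * d / 2)"
    and m: "1 \<le> m" "lam * card V / d < m" "12 * real m \<le> \<epsilon> / (8 * L) * card V"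
      "12 \<le> (\<epsilon> / (8 * L) * d / lam)\<^sup>2"
    and a: "real d ^ 2 \<le> 2 ^ a"
    and size: "19 * real m + 2 * real a * (4 * mu * card V / d + d) + 20 * sqrt m * sqrt (card V) < \<epsilon> / (8 * L) * card V"
  shows "\<exists>k S t p. (1 - \<epsilon>) * d \<le> real k \<and> (\<forall>i<k. S i \<subseteq> V - {r} \<and> conn N (S i) \<and> t i \<in> S i \<and> t i \<in> N r) \<and>
    disjoint_family_on S {..<k} \<and>
    (\<forall>v\<in>V. inj_on (p v) {i. i < k \<and> v \<notin> S i \<and> N v \<inter> S i = {}} \<and>
      (\<forall>i<k. v \<notin> S i \<and> N v \<inter> S i = {} \<longrightarrow>
        p v i \<in> N v \<and> p v i \<noteq> r \<and> N (p v i) \<inter> S i \<noteq> {} \<and> (\<forall>j<k. p v i \<notin> S j)))"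
proof -
  define b where "b = \<epsilon> / (8 * L)"
  have b0: "0 < b" using eps L by (simp add: b_def)
  have hit_b: "9 * M * ln d \<le> b * card V / 2" "9 * M * ln d \<le> (b * d / (2 * lam))\<^sup>2 * (\<epsilon> * d / 2)"
    using hit unfolding b_def .
  define k where "k = nat \<lceil>(1 - \<epsilon>) * d\<rceil>"
  have pos: "0 \<le> (1 - \<epsilon>) * d" using eps by simp
  have k: "(1 - \<epsilon>) * d \<le> real k" "real k \<le> (1 - \<epsilon>) * d + 1"
    using pos by (simp_all add: k_def)
  have "(1 - \<epsilon>) * d \<le> d" using eps by (simp add: mult_left_le_one_le)
  then have kd: "k \<le> d" unfolding k_def using pos by (metis ceiling_mono ceiling_of_nat nat_le_iff)
  obtain T where T: "T \<subseteq> N r" "card T = k"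
    using obtain_subset_with_card_n[of k "N r"] kd deg[OF r(1)] by auto
  have finT: "finite T" using finite_subset[OF T(1) fin_N] .
  obtain t where "bij_betw t {0..<k} T" using ex_bij_betw_nat_finite[OF finT] T(2) by auto
  then have t: "inj_on t {..<k}" "t ` {..<k} = T" by (auto simp: bij_betw_def atLeast0LessThan)
  define D where "D = insert r T"
  have D: "D \<subseteq> V" using T N_sub r by (auto simp: D_def)
  have finD: "finite D" using finT by (simp add: D_def)
  let ?I = "\<lambda>v. {i \<in> {..<k}. t i \<in> N v}"
  \<comment> \<open>A neighbour \<open>t i\<close> of \<open>v\<close> is lost for
    \<open>U v\<close>, but colour \<open>i\<close> then needs no intermediate vertex at
    \<open>v\<close>. Hence this number cancels in the comparison of \<open>U v\<close> with
    \<open>J v\<close>.\<close>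
  define c where "c v = card (?I v)" for v
  have ck: "c v \<le> k" for v unfolding c_def using card_mono[of "{..<k}" "?I v"] by auto
  have ND: "d \<le> card (N v - D) + 1 + c v" if v: "v \<in> V" for v
  proof -
    have "N v \<inter> D \<subseteq> insert r (t ` ?I v)" using t(2) by (auto simp: D_def)
    then have "card (N v \<inter> D) \<le> card (insert r (t ` ?I v))" by (intro card_mono) auto
    also have "\<dots> \<le> Suc (card (t ` ?I v))" by (rule card_insert_le_m1) auto
    also have "\<dots> \<le> Suc (c v)" unfolding c_def using card_image_le[of "?I v" t] by simp
    finally have "card (N v \<inter> D) \<le> Suc (c v)" .
    moreover have "card (N v) = card (N v \<inter> D) + card (N v - D)" using fin_N by (rule card_Int_Diff)
    ultimately show ?thesis using deg[OF v] by simp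
  qed
  have ND': "\<epsilon> * d / 2 \<le> card (N v - D)" if v: "v \<in> V" for v
  proof -
    have "real d \<le> card (N v - D) + 1 + real k" using ND[OF v] ck[of v] by linarith
    then show ?thesis using k(2) d(2) by (simp add: algebra_simps)
  qed
  obtain Q B where QB: "Q \<subseteq> V - D" "B \<subseteq> V - D" "Q \<inter> B = {}"
    and nb: "\<And>v. v \<in> V \<Longrightarrow> b * d \<le> card (N v \<inter> Q)" "\<And>v. v \<in> V \<Longrightarrow> b * d \<le> card (N v \<inter> B)"
      "\<And>v. v \<in> V \<Longrightarrow> card ((N v - D) \<inter> (Q \<union> B)) \<le> \<epsilon> * d / 4"
    using split_neighbourhoods[OF eps(1) L ND' D split] unfolding b_def by blast
  define U where "U v = (N v - D) - (Q \<union> B)" for v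
  define J where "J v = {i \<in> {..<k}. t i \<notin> N v}" for v
  have cJ: "card (J v) = k - c v" for v
  proof -
    have "J v = {..<k} - ?I v" by (auto simp: J_def)
    moreover have "card ({..<k} - ?I v) = card {..<k} - card (?I v)"
      by (intro card_Diff_subset) auto
    ultimately show ?thesis by (simp only: c_def card_lessThan)
  qed
  have M0: "0 < real M" using dM d by simp
  have "real d * k / M \<le> real d * d / M" using kd M0 by (intro divide_right_mono mult_left_mono) auto
  then have mu': "real d * k / M \<le> mu" using mu(1) by linarith
  have hit': "9 * M * ln d \<le> card (nbhd N U' \<inter> B)"
    if v: "v \<in> V" and U': "U' \<subseteq> U v" "card (U v) < card U' + card (J v)" for v U'
  proof -
    have "card (N v - D) = card ((N v - D) \<inter> (Q \<union> B)) + card (U v)"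
      unfolding U_def using fin_N by (intro card_Int_Diff) auto
    then have "real d \<le> card ((N v - D) \<inter> (Q \<union> B)) + card (U v) + 1 + real (c v)"
      using ND[OF v] by linarith
    moreover have "real (card (J v)) = real k - real (c v)" using cJ[of v] ck[of v] by simp
    moreover have "real (card (U v)) < real (card U') + real (card (J v))" using U'(2) by linarith
    ultimately have "real d \<le> \<epsilon> * d / 4 + card U' + 1 + real k" using nb(3)[OF v] by linarith
    \<comment> \<open>Of \<epsilon> d, at most \<epsilon> d / 4 goes to the reservoirs, and the root
      and the rounding of \<open>k\<close> cost 2, which is at most \<epsilon> d / 4.\<close>
    then have cU': "\<epsilon> * d / 2 \<le> card U'" using k(2) d(2) by (simp add: algebra_simps)
    then have "0 < real (card U')" using d(2) by linarith
    then have ne: "U' \<noteq> {}" by auto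
    have U'V: "U' \<subseteq> V" using U'(1) N_sub by (auto simp: U_def)
    have "b * card V / 2 \<le> card (nbhd N U' \<inter> B) \<or> (b * d / (2 * lam))\<^sup>2 * card U' \<le> card (nbhd N U' \<inter> B)"
    proof (rule expansion[OF U'V ne])
      fix x assume x: "x \<in> U'"
      then have "N x \<inter> B = N x \<inter> (nbhd N U' \<inter> B)" by (auto simp: nbhd_def)
      then show "b * d \<le> card (N x \<inter> (nbhd N U' \<inter> B))" using nb(2)[of x] x U'V by auto
    qed (use b0 QB in auto)
    then show ?thesis
    proof
      assume "(b * d / (2 * lam))\<^sup>2 * card U' \<le> card (nbhd N U' \<inter> B)"
      moreover have "(b * d / (2 * lam))\<^sup>2 * (\<epsilon> * d / 2) \<le> (b * d / (2 * lam))\<^sup>2 * card U'"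
        using cU' by (intro mult_left_mono) auto
      ultimately show ?thesis using hit_b(2) by linarith
    next
      assume "b * card V / 2 \<le> card (nbhd N U' \<inter> B)"
      then show ?thesis using hit_b(1) by linarith
    qed
  qed
  have BV: "B \<subseteq> V" and UN: "\<And>v. U v \<subseteq> N v" and JK: "\<And>v. J v \<subseteq> {..<k}"
    using QB by (auto simp: U_def J_def)
  have kM: "k \<le> M" using kd dM by simp
  have "\<exists>R p. (\<forall>i<k. R i \<subseteq> B) \<and> disjoint_family_on R {..<k} \<and>
    real d * (\<Sum>i<k. card (R i)) \<le> 4 * mu * card V \<and>
    (\<forall>v\<in>V. inj_on (p v) (J v) \<and> (\<forall>i\<in>J v. p v i \<in> U v \<and> N (p v i) \<inter> R i \<noteq> {}))"
    by (rule colour_seeds[OF BV UN JK kM kd d(1) _ mu' mu(2)]) (rule hit')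
  then obtain R p where RB: "\<forall>i<k. R i \<subseteq> B" and R: "disjoint_family_on R {..<k}"
      "real d * (\<Sum>i<k. card (R i)) \<le> 4 * mu * card V"
    and p_all: "\<forall>v\<in>V. inj_on (p v) (J v) \<and> (\<forall>i\<in>J v. p v i \<in> U v \<and> N (p v i) \<inter> R i \<noteq> {})"
    by (elim exE conjE) (rule that)
  have RB: "R i \<subseteq> B" if "i < k" for i using RB that by simp
  have p: "\<And>v. v \<in> V \<Longrightarrow> inj_on (p v) (J v)"
      "\<And>v i. v \<in> V \<Longrightarrow> i \<in> J v \<Longrightarrow> p v i \<in> U v \<and> N (p v i) \<inter> R i \<noteq> {}"
    using p_all by blast+
  define Z where "Z i = insert (t i) (R i)" for i
  have tT: "t i \<in> T" if "i < k" for i using t(2) that by auto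
  have RD: "R i \<inter> D = {}" "R i \<inter> Q = {}" if "i < k" for i using RB[OF that] QB by auto
  have Z: "Z i \<subseteq> V - Q" "Z i \<noteq> {}" if "i < k" for i
    using RB[OF that] RD[OF that] tT[OF that] D QB by (auto simp: Z_def D_def)
  have Zdisj: "disjoint_family_on Z {..<k}"
    unfolding disjoint_family_on_def
  proof (intro ballI impI)
    fix i j assume ij: "i \<in> {..<k}" "j \<in> {..<k}" "i \<noteq> j"
    have "R i \<inter> R j = {}" using R(1) ij by (auto simp: disjoint_family_on_def)
    moreover have "t i \<noteq> t j" using inj_onD[OF t(1), of i j] ij by auto
    moreover have "t i \<notin> R j" "t j \<notin> R i" using RD[of i] RD[of j] tT[of i] tT[of j] ij by (auto simp: D_def)
    ultimately show "Z i \<inter> Z j = {}" by (auto simp: Z_def)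
  qed
  have d0: "0 < real d" using d by simp
  have "(\<Sum>i<k. card (Z i)) \<le> (\<Sum>i<k. card (R i) + 1)"
    unfolding Z_def using finite_subset[OF _ finV] RB BV by (intro sum_mono) (simp add: card_insert_le_m1)
  also have "\<dots> = (\<Sum>i<k. card (R i)) + k" by (simp only: sum.distrib) simp
  finally have "real (\<Sum>i<k. card (Z i)) \<le> real (\<Sum>i<k. card (R i)) + k"
    by (metis of_nat_add of_nat_mono)
  moreover have "real (\<Sum>i<k. card (R i)) \<le> 4 * mu * card V / d" using R(2) d0 by (simp add: field_simps)
  ultimately have sumZ: "real (\<Sum>i<k. card (Z i)) \<le> 4 * mu * card V / d + d" using kd by linarith
  have "2 * real a * (\<Sum>i<k. card (Z i)) \<le> 2 * real a * (4 * mu * card V / d + d)"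
    using sumZ by (intro mult_left_mono) auto
  then have size': "19 * real m + 2 * real a * (\<Sum>i<k. card (Z i)) + 20 * sqrt m * sqrt (card V) < b * card V"
    using size unfolding b_def by linarith
  have QV: "Q \<subseteq> V" using QB by auto
  have "\<exists>P. (\<forall>i<k. P i \<subseteq> Q \<and> conn N (Z i \<union> P i)) \<and> disjoint_family_on P {..<k}"
  proof (rule connect_seeds[OF QV b0 _ m(1,2) m(3,4)[folded b_def] a _ _ Zdisj kd size'])
    show "b * d \<le> card (N v \<inter> Q)" if "v \<in> V" for v by (rule nb(1)[OF that])
    show "Z i \<subseteq> V - Q" "Z i \<noteq> {}" if "i < k" for i using Z[OF that] .
  qed
  then obtain P where PQ: "\<forall>i<k. P i \<subseteq> Q \<and> conn N (Z i \<union> P i)" and P2: "disjoint_family_on P {..<k}"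
    by (elim exE conjE) (rule that)
  have P: "\<And>i. i < k \<Longrightarrow> P i \<subseteq> Q \<and> conn N (Z i \<union> P i)" "disjoint_family_on P {..<k}"
    using PQ P2 by simp_all
  define S where "S i = Z i \<union> P i" for i
  have S_sub: "S i \<subseteq> T \<union> B \<union> Q" if "i < k" for i
    using P(1)[OF that] RB[OF that] tT[OF that] by (auto simp: S_def Z_def)
  have rT: "r \<notin> T" using T r by auto
  have S1: "S i \<subseteq> V - {r} \<and> conn N (S i) \<and> t i \<in> S i \<and> t i \<in> N r" if i: "i < k" for i
  proof (intro conjI)
    show "S i \<subseteq> V - {r}" using S_sub[OF i] rT QB D by (auto simp: D_def)
    show "conn N (S i)" using P(1)[OF i] by (simp add: S_def)
    show "t i \<in> S i" by (simp add: S_def Z_def)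
    show "t i \<in> N r" using tT[OF i] T(1) by auto
  qed
  have Sdisj: "disjoint_family_on S {..<k}"
    unfolding disjoint_family_on_def
  proof (intro ballI impI)
    fix i j assume ij: "i \<in> {..<k}" "j \<in> {..<k}" "i \<noteq> j"
    have "Z i \<inter> Z j = {}" "P i \<inter> P j = {}" using Zdisj P(2) ij by (auto simp: disjoint_family_on_def)
    moreover have "Z i \<inter> P j = {}" "Z j \<inter> P i = {}" using Z[of i] Z[of j] P(1)[of i] P(1)[of j] ij by auto
    ultimately show "S i \<inter> S j = {}" by (auto simp: S_def)
  qed
  have S2: "inj_on (p v) {i. i < k \<and> v \<notin> S i \<and> N v \<inter> S i = {}}" if v: "v \<in> V" for v
    by (rule inj_on_subset[OF p(1)[OF v]]) (auto simp: J_def S_def Z_def)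
  have S3: "p v i \<in> N v \<and> p v i \<noteq> r \<and> N (p v i) \<inter> S i \<noteq> {} \<and> (\<forall>j<k. p v i \<notin> S j)"
    if v: "v \<in> V" and i: "i < k" and no: "N v \<inter> S i = {}" for v i
  proof -
    have "i \<in> J v" using i no by (auto simp: J_def S_def Z_def)
    then have "p v i \<in> U v" "N (p v i) \<inter> R i \<noteq> {}" using p(2)[OF v] by auto
    moreover have "p v i \<notin> S j" if "j < k" for j
      using \<open>p v i \<in> U v\<close> S_sub[OF that] by (auto simp: U_def D_def)
    ultimately show ?thesis by (auto simp: U_def D_def S_def Z_def)
  qed
  show ?thesis
    by (rule exI[of _ k], rule exI[of _ S], rule exI[of _ t], rule exI[of _ p])
      (use k(1) S1 Sdisj S2 S3 in simp)
qed

end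

section \<open>The main theorem\<close>

lemma eventually_parameters:
  fixes b C \<epsilon> :: real
  assumes "0 < b" "0 < C" "0 < \<epsilon>"
  shows "\<exists>d0. \<forall>d\<ge>d0. 200 \<le> d \<and> 8 \<le> \<epsilon> * real d \<and> 1 \<le> ln (real d) \<and>
    12 * real d ^ 2 * exp (- (b * d)) \<le> 1 \<and> 32 * real d ^ 4 * exp (- (d / (C * ln d))) \<le> 1"
    (is "\<exists>d0. \<forall>d\<ge>d0. ?P d")
proof -
  have "((\<lambda>d::nat. 12 * real d ^ 2 * exp (- (b * d))) \<longlongrightarrow> 0) at_top"
    "((\<lambda>d::nat. 32 * real d ^ 4 * exp (- (d / (C * ln d)))) \<longlongrightarrow> 0) at_top"
    using assms by real_asymp+
  then have "\<forall>\<^sub>F d in sequentially. 12 * real d ^ 2 * exp (- (b * d)) < 1"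
    "\<forall>\<^sub>F d in sequentially. 32 * real d ^ 4 * exp (- (d / (C * ln d))) < 1"
    by (auto dest!: order_tendstoD(2)[of _ 0 _ 1])
  moreover have "\<forall>\<^sub>F d in sequentially. 8 / \<epsilon> \<le> real d" "\<forall>\<^sub>F d in sequentially. 1 \<le> ln (real d)"
    "\<forall>\<^sub>F d in sequentially. 200 \<le> d"
    using assms by real_asymp+
  ultimately have "\<forall>\<^sub>F d in sequentially. ?P d"
    by eventually_elim (use assms in \<open>auto simp: field_simps\<close>)
  then show ?thesis by (simp add: eventually_sequentially)
qed

lemma ceiling_log_bounds:
  assumes "1 \<le> ln (real d)"
  shows "\<exists>a::nat. real d ^ 2 \<le> 2 ^ a \<and> real a \<le> 5 * ln d"
proof -
  have d: "0 < real d" using assms by (cases "d = 0") auto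
  define a where "a = nat \<lceil>log 2 (real d ^ 2)\<rceil>"
  have l: "log 2 (real d ^ 2) = 2 * (ln d / ln 2)" using d by (simp add: log_def ln_realpow)
  have pos: "0 \<le> log 2 (real d ^ 2)" unfolding l using assms by simp
  have "log 2 (real d ^ 2) \<le> a" using pos by (simp add: a_def)
  then have "2 powr log 2 (real d ^ 2) \<le> 2 powr real a" by (intro powr_mono) auto
  then have 1: "real d ^ 2 \<le> 2 ^ a" using d by (simp add: powr_realpow)
  have "exp (1/2 :: real) \<le> 2" using exp_bound_half[of "1/2::real"] by simp
  then have "1/2 \<le> ln (2::real)" by (subst ln_ge_iff) auto
  then have "ln d / ln 2 \<le> ln d / (1/2)" using assms by (intro divide_left_mono) auto
  then have "ln d / ln 2 \<le> 2 * ln d" by simp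
  moreover have "a \<le> log 2 (real d ^ 2) + 1" using pos by (simp add: a_def)
  ultimately have "real a \<le> 5 * ln d" using assms unfolding l by linarith
  then show ?thesis using 1 by blast
qed

text \<open>The second reservoir offers b n vertices, and the four demands take the fractions 1/8,
  5/32, 5/32 and 1/4 of it. In the second one the factor a of order ln d is cancelled by the seed
  density 1 / (C ln d) contained in \<open>mu\<close>.\<close>

lemma size_bound:
  fixes b K n m C mu l :: real and d a :: nat
  assumes b: "0 < b" and K: "304 / b \<le> K" "12800 / b\<^sup>2 \<le> K" and n: "0 < n"
    and m: "0 \<le> m" "m \<le> 2 * n / K" and a: "real a \<le> 5 * l" and l: "1 \<le> l"
    and mu: "mu = d / (C * l)" "C = 256 / b" and d: "0 < d" and nd: "64 / b * d * l\<^sup>2 \<le> n"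
  shows "19 * m + 2 * real a * (4 * mu * n / d + d) + 20 * sqrt m * sqrt n < b * n"
proof -
  have K0: "0 < K" using K(1) b by (meson divide_pos_pos less_le_trans zero_less_numeral)
  have C0: "0 < C" using mu b by simp
  have "304 \<le> b * K" using K(1) b by (simp add: field_simps)
  then have "304 * n \<le> b * K * n" using n by (intro mult_right_mono) auto
  then have "38 * n / K \<le> b * n / 8" using K0 by (simp add: field_simps)
  moreover have "19 * m \<le> 19 * (2 * n / K)" using m(2) by (rule mult_left_mono) simp
  ultimately have t1: "19 * m \<le> b * n / 8" by simp
  have "4 * mu * n / d = 4 * n / (C * l)" using d l C0 by (simp add: mu(1))
  then have "2 * real a * (4 * mu * n / d) = real a * (8 * n / (C * l))" by simp
  also have "\<dots> \<le> (5 * l) * (8 * n / (C * l))" using a n l C0 by (intro mult_right_mono) auto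
  also have "\<dots> = 40 * n / C" using l by simp
  also have "\<dots> = 5 * b * n / 32" using b by (simp add: mu(2))
  finally have t2: "2 * real a * (4 * mu * n / d) \<le> 5 * b * n / 32" .
  have "2 * real a * d \<le> 2 * (5 * l) * d" using a by (intro mult_right_mono) auto
  also have "\<dots> = 10 * d * l" by simp
  also have "\<dots> \<le> 10 * d * l\<^sup>2" using l by (intro mult_left_mono) (auto simp: power2_eq_square)
  also have "\<dots> \<le> 5 * b * n / 32" using nd b by (simp add: field_simps)
  finally have t3: "2 * real a * d \<le> 5 * b * n / 32" .
  have "12800 \<le> b\<^sup>2 * K" using K(2) b by (simp add: field_simps)
  then have "12800 / K \<le> b\<^sup>2" using K0 by (simp add: field_simps)
  then have "12800 / K * (n\<^sup>2 / 6400) \<le> b\<^sup>2 * (n\<^sup>2 / 6400)" by (rule mult_right_mono) simp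
  moreover have "(b * n / 80)\<^sup>2 = b\<^sup>2 * (n\<^sup>2 / 6400)" by (simp add: power_mult_distrib power_divide)
  moreover have "m * n \<le> 2 * n / K * n" using m(2) n by (intro mult_right_mono) auto
  moreover have "12800 / K * (n\<^sup>2 / 6400) = 2 * n / K * n" by (simp add: power2_eq_square)
  ultimately have "m * n \<le> (b * n / 80)\<^sup>2" by linarith
  then have "sqrt (m * n) \<le> b * n / 80" using b n by (intro real_le_lsqrt) auto
  then have t4: "20 * sqrt m * sqrt n \<le> b * n / 4" by (simp add: real_sqrt_mult)
  have "0 < b * n" using b n by simp
  moreover have "2 * real a * (4 * mu * n / d + d) = 2 * real a * (4 * mu * n / d) + 2 * real a * d"
    by (rule distrib_left)
  ultimately show ?thesis using t1 t2 t3 t4 by linarith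
qed

lemma mixing_graph_ndl:
  assumes G: "ndl_graph G n d lam" and lam: "0 < lam" "lam < d"
  shows "mixing_graph (pverts G) (\<lambda>v. {u. (v, u) \<in> parcs G}) d lam"
proof -
  interpret pair_graph G using G by (simp add: ndl_graph_def)
  have n: "card (pverts G) = n" using G by (simp add: ndl_graph_def)
  show ?thesis
  proof
    show "finite (pverts G)" by (rule pair_finite_verts)
    show "{u. (x, u) \<in> parcs G} \<subseteq> pverts G" for x by (auto dest: in_arcsD2)
    show "x \<in> {u. (y, u) \<in> parcs G}" if "y \<in> {u. (x, u) \<in> parcs G}" for x y
      using that pair_sym_arcs by (auto simp: symmetric_def sym_def)
    show "card {u. (v, u) \<in> parcs G} = d" if "v \<in> pverts G" for v
      using G that by (simp add: ndl_graph_def out_degree_eq_card)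
    show "0 < lam" "0 < d" using lam by auto
    fix X Y assume X: "X \<subseteq> pverts G" and Y: "Y \<subseteq> pverts G"
    have fin: "finite X" "finite Y"
      using finite_subset[OF X pair_finite_verts] finite_subset[OF Y pair_finite_verts] .
    have "{(x, y) \<in> parcs G. x \<in> X \<and> y \<in> Y} = Sigma X (\<lambda>x. {u. (x, u) \<in> parcs G} \<inter> Y)" by auto
    then have "card {(x, y) \<in> parcs G. x \<in> X \<and> y \<in> Y} = (\<Sum>x\<in>X. card ({u. (x, u) \<in> parcs G} \<inter> Y))"
      using fin by simp
    then show "\<bar>real (\<Sum>x\<in>X. card ({u. (x, u) \<in> parcs G} \<inter> Y)) - d * card X * card Y / card (pverts G)\<bar>
        \<le> lam * sqrt (card X * card Y)"
      using expander_mixing[OF G lam(2) X Y] n by simp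
  qed
qed

text \<open>Mixing between a vertex and its neighbourhood bounds \<open>lam\<close> from below by
  half of sqrt d. Hence a large d / lam forces a large degree, which is how d is shown to exceed
  every constant.\<close>

lemma ratio_le_sqrt_degree:
  assumes G: "ndl_graph G n d lam" and lam: "0 < lam" "lam < d" and n: "2 * d \<le> n"
  shows "d / lam \<le> 2 * sqrt d"
proof -
  interpret mixing_graph "pverts G" "\<lambda>v. {u. (v, u) \<in> parcs G}" d lam
    by (rule mixing_graph_ndl[OF G lam])
  have cn: "card (pverts G) = n" "0 < n" using G by (auto simp: ndl_graph_def)
  then obtain v where v: "v \<in> pverts G" by (metis card.empty equals0I less_irrefl)
  let ?N = "{u. (v, u) \<in> parcs G}"
  have "\<bar>real d - real d * d / n\<bar> \<le> lam * sqrt d"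
    using mixing[of "{v}" ?N] v N_sub[of v] deg[OF v] cn by simp
  moreover have "real d * d / n \<le> d / 2"
  proof -
    have "2 * real d \<le> n" using n by linarith
    then have "real d * (2 * real d) \<le> real d * n" by (rule mult_left_mono) simp
    then show ?thesis using cn by (simp add: field_simps)
  qed
  ultimately have "d / 2 \<le> lam * sqrt d" by linarith
  then have "sqrt d * sqrt d \<le> (2 * lam) * sqrt d" by simp
  then have "sqrt d \<le> 2 * lam" using d_pos by (meson mult_le_cancel_right_pos of_nat_0_less_iff real_sqrt_gt_zero)
  then have "sqrt d * sqrt d \<le> sqrt d * (2 * lam)" by (intro mult_left_mono) auto
  then show ?thesis using lam by (simp add: field_simps)
qed

text \<open>The asymptotic hypotheses in uniform form: \<open>C\<close> and \<open>d0\<close> depend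
  on \<epsilon> only.\<close>

lemma independent_trees_ndl:
  fixes \<epsilon> :: real
  assumes eps: "0 < \<epsilon>" "\<epsilon> < 1"
  shows "\<exists>(C :: real) (d0 :: nat). 1 \<le> C \<and> (\<forall>G n d lam. ndl_graph (G :: 'a pair_pre_digraph) n d lam \<longrightarrow> d0 \<le> d \<longrightarrow> 0 < lam \<longrightarrow>
    C * ln d \<le> d / lam \<longrightarrow> C * d * (ln d)\<^sup>2 \<le> n \<longrightarrow> 2 * d \<le> n \<longrightarrow>
    (\<forall>r\<in>pverts G. \<exists>k T. (1 - \<epsilon>) * d \<le> real k \<and> independent_spanning_trees G r k T))"
proof -
  define L where "L = nat \<lceil>32 / \<epsilon>\<rceil> + 2"
  have L: "32 / \<epsilon> \<le> L" "2 \<le> L" unfolding L_def by linarith+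
  define b where "b = \<epsilon> / (8 * L)"
  have b: "0 < b" using eps L by (simp add: b_def)
  have "b \<le> \<epsilon> / 8" unfolding b_def using eps L by (intro divide_left_mono) auto
  then have b1: "b < 1" using eps by simp
  \<comment> \<open>With \<open>C0\<close> = 256 / b the connecting vertices charged to the seeds,
    at most 40 n / C0, are a fraction 5/32 of b n.\<close>
  define C0 where "C0 = 256 / b"
  have C0: "256 \<le> C0" using b b1 by (simp add: C0_def field_simps)
  obtain d0 where d0: "\<And>d. d0 \<le> d \<Longrightarrow> 200 \<le> d \<and> 8 \<le> \<epsilon> * real d \<and> 1 \<le> ln (real d) \<and>
    12 * real d ^ 2 * exp (- (b * d)) \<le> 1 \<and> 32 * real d ^ 4 * exp (- (d / (C0 * ln d))) \<le> 1"
    using eventually_parameters[of b C0 \<epsilon>] b C0 eps by auto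
  \<comment> \<open>The summands with \<open>C0\<close> serve the lower bounds on second
    neighbourhoods, one relative to n and one relative to d / lam; the last two make
    \<open>m\<close> small compared with b n.\<close>
  define C where "C = 1 + 36 * C0 / b + 144 * C0 / (b\<^sup>2 * \<epsilon>) + 304 / b + 12800 / b\<^sup>2"
  have terms: "0 \<le> 36 * C0 / b" "0 \<le> 144 * C0 / (b\<^sup>2 * \<epsilon>)" "0 \<le> 304 / b" "0 \<le> 12800 / b\<^sup>2"
    using b C0 eps by auto
  have C: "1 \<le> C" "36 * C0 / b \<le> C" "144 * C0 / (b\<^sup>2 * \<epsilon>) \<le> C" "304 / b \<le> C" "12800 / b\<^sup>2 \<le> C"
    using terms unfolding C_def by linarith+
  have "\<exists>k T. (1 - \<epsilon>) * d \<le> real k \<and> independent_spanning_trees G r k T"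
    if G: "ndl_graph G n d lam" and dd: "d0 \<le> d" and lam: "0 < lam" and K: "C * ln d \<le> d / lam"
      and nd: "C * d * (ln d)\<^sup>2 \<le> n" and n2: "2 * d \<le> n" and r: "r \<in> pverts G"
    for G :: "'a pair_pre_digraph" and n d lam r
  proof -
    note D = d0[OF dd]
    have d: "200 \<le> d" "8 \<le> \<epsilon> * real d" "1 \<le> ln (real d)" using D by auto
    define l where "l = ln (real d)"
    have l: "1 \<le> l" using d by (simp add: l_def)
    have dpos: "0 < real d" using d by simp
    define K where "K = d / lam"
    have "C * 1 \<le> C * l" using C l by (intro mult_left_mono) auto
    then have KC: "C \<le> K" "C * l \<le> K" using K by (simp_all add: K_def l_def)
    have "304 \<le> 304 / b" using b b1 by (simp add: field_simps)
    then have "304 \<le> K" using KC C by linarith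
    then have lamd: "lam < d" using lam by (simp add: K_def field_simps)
    interpret pair_graph G using G by (simp add: ndl_graph_def)
    let ?N = "\<lambda>v. {u. (v, u) \<in> parcs G}"
    interpret mixing_graph "pverts G" "?N" d lam
      by (rule mixing_graph_ndl[OF G lam lamd])
    have cn: "card (pverts G) = n" using G by (simp add: ndl_graph_def)
    have n0: "0 < real n" using n2 dpos by linarith
    have nd': "C * d * l\<^sup>2 \<le> n" using nd by (simp add: l_def)
    have Cdl: "c * d * l\<^sup>2 \<le> n" if "c \<le> C" for c
    proof -
      have "c * (d * l\<^sup>2) \<le> C * (d * l\<^sup>2)" using that by (intro mult_right_mono) auto
      then show ?thesis using nd' by (simp add: mult.assoc)
    qed
    \<comment> \<open>This yields n / K \<ge> 1, so that rounding n / K up to \<open>m\<close> at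
      most doubles it.\<close>
    have "K \<le> 2 * sqrt d" using ratio_le_sqrt_degree[OF G lam lamd n2] by (simp add: K_def)
    also have "sqrt d \<le> d"
      using d by (intro real_le_lsqrt) (auto simp: power2_eq_square mult_le_cancel_left1)
    finally have "K \<le> n" using n2 by linarith
    then have nK: "1 \<le> n / K" using \<open>304 \<le> K\<close> by simp
    have lamK: "lam * n / d = n / K" by (simp add: K_def)
    define m where "m = nat \<lfloor>n / K\<rfloor> + 1"
    have m: "1 \<le> m" "n / K < m" "m \<le> n / K + 1" unfolding m_def using nK by linarith+
    then have m2: "m \<le> 2 * n / K" using nK by simp
    obtain a where a: "real d ^ 2 \<le> 2 ^ a" "real a \<le> 5 * l"
      using ceiling_log_bounds[OF d(3)] by (auto simp: l_def)
    \<comment> \<open>The size of the palette. As only k \<le> d of its colours are used, a vertex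
      becomes a seed with probability at most about 1 / (C0 ln d).\<close>
    define M where "M = nat \<lceil>C0 * d * l\<rceil>"
    have pos: "0 \<le> C0 * d * l" using C0 l by simp
    have "1 * (1 * real d) \<le> C0 * (l * d)" using C0 l by (intro mult_mono) auto
    then have dC: "real d \<le> C0 * d * l" by (simp add: mult_ac)
    have M: "C0 * d * l \<le> M" "M \<le> C0 * d * l + 1" using pos by (simp_all add: M_def)
    have M2: "real M \<le> 2 * C0 * d * l" using M(2) dC d(1) by linarith
    have dM: "d \<le> M" using M(1) dC by linarith
    define mu where "mu = d / (C0 * l)"
    have Mpos: "0 < C0 * d * l" "0 < real M" using M(1) dC dpos by linarith+
    have "0 < real M * (C0 * d * l)" by (rule mult_pos_pos[OF Mpos(2,1)])
    then have "real d * d / M \<le> real d * d / (C0 * d * l)" using M(1)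
      by (intro divide_left_mono) simp_all
    also have "\<dots> = mu" using dpos by (simp add: mu_def)
    finally have mu: "real d * d / M \<le> mu" .
    have Ml: "9 * M * ln d \<le> 18 * C0 * d * l\<^sup>2"
    proof -
      have "9 * real M \<le> 9 * (2 * C0 * d * l)" using M2 by linarith
      then have "9 * real M * l \<le> 9 * (2 * C0 * d * l) * l" by (rule mult_right_mono) (use l in simp)
      then show ?thesis by (simp add: power2_eq_square l_def mult_ac)
    qed
    have hit1: "9 * M * ln d \<le> b * n / 2"
    proof -
      have "36 * C0 / b * d * l\<^sup>2 \<le> n" by (rule Cdl[OF C(2)])
      then have "18 * C0 * d * l\<^sup>2 \<le> b * n / 2" using b by (simp add: field_simps)
      then show ?thesis using Ml by linarith
    qed
    have hit2: "9 * M * ln d \<le> (b * d / (2 * lam))\<^sup>2 * (\<epsilon> * d / 2)"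
    proof -
      \<comment> \<open>The bound on K enters squared, and one factor \<open>C\<close> suffices
        since the other is at least 1.\<close>
      have "144 * C0 / (b\<^sup>2 * \<epsilon>) * 1 \<le> C * C" using C terms by (intro mult_mono) auto
      then have "144 * C0 \<le> b\<^sup>2 * \<epsilon> * (C * C)" using b eps by (simp add: field_simps)
      then have "144 * C0 * l\<^sup>2 \<le> b\<^sup>2 * \<epsilon> * (C * C) * l\<^sup>2" by (rule mult_right_mono) simp
      also have "\<dots> = b\<^sup>2 * \<epsilon> * (C * l)\<^sup>2" by (simp add: power2_eq_square)
      also have "\<dots> \<le> b\<^sup>2 * \<epsilon> * K\<^sup>2" using KC C l eps by (intro mult_left_mono power_mono) auto
      finally have "144 * C0 * l\<^sup>2 * (d / 8) \<le> b\<^sup>2 * \<epsilon> * K\<^sup>2 * (d / 8)" by (rule mult_right_mono) simp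
      then have "18 * C0 * d * l\<^sup>2 \<le> b\<^sup>2 * \<epsilon> * K\<^sup>2 * (d / 8)" by (simp add: mult_ac)
      also have "\<dots> = (b * d / (2 * lam))\<^sup>2 * (\<epsilon> * d / 2)" by (simp add: K_def power2_eq_square mult_ac)
      finally show ?thesis using Ml by linarith
    qed
    have bK: "304 \<le> b * K"
    proof -
      have "304 / b \<le> K" using C KC by linarith
      then show ?thesis using b by (simp add: field_simps)
    qed
    have m12: "12 * real m \<le> b * n"
    proof -
      have "24 * real n \<le> b * K * real n" using bK n0 by (intro mult_right_mono) auto
      then have "12 * (2 * real n / K) \<le> b * n" using \<open>304 \<le> K\<close> by (simp add: field_simps)
      then show ?thesis using m2 by linarith
    qed
    have e12: "12 \<le> (b * d / lam)\<^sup>2"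
    proof -
      have "(304::real)\<^sup>2 \<le> (b * K)\<^sup>2" using bK by (intro power_mono) auto
      then show ?thesis by (simp add: K_def)
    qed
    have size: "19 * real m + 2 * real a * (4 * mu * n / d + d) + 20 * sqrt m * sqrt n < b * n"
    proof (rule size_bound[where K = K and C = C0 and l = l])
      show "304 / b \<le> K" "12800 / b\<^sup>2 \<le> K" using C KC by linarith+
      have "64 / b \<le> 304 / b" using b by (intro divide_right_mono) auto
      then have "64 / b \<le> C" using C by linarith
      then show "64 / b * d * l\<^sup>2 \<le> n" by (rule Cdl)
    qed (use b n0 m2 a l d in \<open>auto simp: mu_def C0_def\<close>)
    have rN: "r \<notin> ?N r" using pair_no_loops[of "(r, r)"] by auto
    have split: "12 * real d ^ 2 * exp (- (\<epsilon> / (8 * L) * d)) \<le> 1" using D by (simp add: b_def)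
    have mu2: "32 * real d ^ 4 * exp (- mu) \<le> 1" using D by (simp add: mu_def l_def)
    have m3: "lam * card (pverts G) / d < m" using m(2) by (simp add: cn lamK)
    obtain k S t p where k: "(1 - \<epsilon>) * d \<le> real k"
      and S: "\<forall>i<k. S i \<subseteq> pverts G - {r} \<and> conn ?N (S i) \<and> t i \<in> S i \<and> t i \<in> ?N r"
      and disj: "disjoint_family_on S {..<k}"
      and p: "\<forall>v\<in>pverts G. inj_on (p v) {i. i < k \<and> v \<notin> S i \<and> ?N v \<inter> S i = {}} \<and>
        (\<forall>i<k. v \<notin> S i \<and> ?N v \<inter> S i = {} \<longrightarrow>
          p v i \<in> ?N v \<and> p v i \<noteq> r \<and> ?N (p v i) \<inter> S i \<noteq> {} \<and> (\<forall>j<k. p v i \<notin> S j))"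
      using cores_exist[OF eps r rN L d(1,2) split mu mu2 dM hit1[folded cn, unfolded b_def]
          hit2[unfolded b_def] m(1) m3 m12[folded cn, unfolded b_def] e12[unfolded b_def] a(1)
          size[folded cn, unfolded b_def]]
      by (elim exE conjE) (rule that)
    have "\<exists>T. independent_spanning_trees G r k T"
      by (rule independent_trees_from_cores[where S = S and a = t and m = p])
        (use pair_graph_axioms r S disj p in \<open>simp_all\<close>)
    then show ?thesis using k by blast
  qed
  then show ?thesis using C(1) by blast
qed

theorem theorem1p3:
  fixes \<epsilon> :: real
    and N :: "nat set"
    and G :: "nat \<Rightarrow> 'a pair_pre_digraph"
    and d :: "nat \<Rightarrow> nat"
    and lam :: "nat \<Rightarrow> real"
  assumes "\<epsilon> > 0"
    and "infinite N"
    and "\<And>n. n \<in> N \<Longrightarrow> ndl_graph (G n) n (d n) (lam n)"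
    and "filterlim (\<lambda>n. (real (d n) / lam n) / ln (real (d n))) at_top
           (inf sequentially (principal N))"
    and "((\<lambda>n. real (d n) * (ln (real n))\<^sup>2 / real n) \<longlongrightarrow> 0)
           (inf sequentially (principal N))"
  shows "\<exists>n0. \<forall>n\<in>N. n \<ge> n0 \<longrightarrow>
           (\<forall>r\<in>pverts (G n). \<exists>k T. real k \<ge> (1 - \<epsilon>) * real (d n) \<and>
              independent_spanning_trees (G n) r k T)"
proof -
  \<comment> \<open>Also covers \<epsilon> \<ge> 1; a smaller value only yields more trees.\<close>
  define e where "e = min \<epsilon> (1 / 2)"
  have e: "0 < e" "e < 1" "e \<le> \<epsilon>" using assms(1) by (auto simp: e_def)
  obtain C :: real and d0 :: nat where C: "1 \<le> C" and main: "\<forall>G n d lam. ndl_graph (G :: 'a pair_pre_digraph) n d lam \<longrightarrow> d0 \<le> d \<longrightarrow> 0 < lam \<longrightarrow>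
    C * ln d \<le> d / lam \<longrightarrow> C * d * (ln d)\<^sup>2 \<le> n \<longrightarrow> 2 * d \<le> n \<longrightarrow>
    (\<forall>r\<in>pverts G. \<exists>k T. (1 - e) * d \<le> real k \<and> independent_spanning_trees G r k T)"
    using independent_trees_ndl[OF e(1,2)] by blast
  \<comment> \<open>The surplus 2 / ln 2 makes d / lam at least 2, so that lam < d, and the
    square-root term forces d \<ge> \<open>d0\<close>.\<close>
  define C' where "C' = C + 2 + 2 * sqrt d0 / ln 2 + 2 / ln 2"
  have ln2: "0 < ln (2::real)" by simp
  have nn: "0 \<le> 2 * sqrt d0 / ln 2" "0 < 2 / ln (2::real)" by simp_all
  have "\<forall>\<^sub>F n in inf sequentially (principal N). C' \<le> (real (d n) / lam n) / ln (real (d n))"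
    using assms(4) by (simp add: filterlim_at_top)
  moreover have "\<forall>\<^sub>F n in inf sequentially (principal N). real (d n) * (ln (real n))\<^sup>2 / real n < 1 / (C + 2)"
    using assms(5) C by (intro order_tendstoD(2)) auto
  moreover have "\<forall>\<^sub>F n in inf sequentially (principal N). 3 \<le> n"
    by (rule filter_leD[OF inf_le1 eventually_ge_at_top])
  moreover have "\<forall>\<^sub>F n in inf sequentially (principal N). n \<in> N"
    by (simp add: eventually_inf_principal)
  ultimately have "\<forall>\<^sub>F n in inf sequentially (principal N). \<forall>r\<in>pverts (G n). \<exists>k T. real k \<ge> (1 - \<epsilon>) * real (d n) \<and>
              independent_spanning_trees (G n) r k T"
  proof eventually_elim
    case (elim n)
    note G = assms(3)[OF elim(4)]
    define l where "l = ln (real (d n))"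
    have C': "0 < C'" using C nn unfolding C'_def by linarith
    then have X: "0 < (d n / lam n) / l" using elim(1) unfolding l_def by linarith
    \<comment> \<open>Division by zero and \<open>ln 0\<close> are 0 here, so positivity of the
      ratio excludes degrees 0 and 1 and, below, a nonpositive \<open>lam n\<close>.\<close>
    have "l \<noteq> 0" "d n \<noteq> 0" using X by (cases "l = 0"; cases "d n = 0"; simp)+
    moreover have "d n \<noteq> 1" using \<open>l \<noteq> 0\<close> by (auto simp: l_def)
    ultimately have d2: "2 \<le> d n" by linarith
    then have l: "ln 2 \<le> l" by (simp add: l_def)
    then have l0: "0 < l" using ln2 by linarith
    have lam: "0 < lam n" using X l0 d2 by (auto simp: zero_less_divide_iff zero_less_mult_iff)
    have K: "C' * l \<le> d n / lam n" using elim(1) l0 unfolding l_def by (simp only: pos_le_divide_eq)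
    have Cl: "c * l \<le> d n / lam n" if "c \<le> C'" for c
      using mult_right_mono[OF that, of l] l0 K by linarith
    have "2 / ln 2 \<le> C'" "2 * sqrt d0 / ln 2 + 2 / ln 2 \<le> C'" "C \<le> C'"
      using C nn unfolding C'_def by linarith+
    note C'_ge = this
    have "2 \<le> 2 / ln 2 * l" using l ln2 by (simp add: field_simps)
    then have "2 \<le> d n / lam n" using Cl[OF C'_ge(1)] by linarith
    then have lamd: "lam n < d n" using lam d2 by (simp add: field_simps)
    have lnn: "1 \<le> ln (real n)"
    proof -
      have "exp 1 \<le> real n" using exp_le elim(3) by linarith
      then show ?thesis using elim(3) by (subst ln_ge_iff) auto
    qed
    have n0: "0 < real n" using elim(3) by simp
    have small: "(C + 2) * (d n * (ln n)\<^sup>2) \<le> n"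
    proof -
      have "d n * (ln n)\<^sup>2 / n \<le> 1 / (C + 2)" using elim(2) by simp
      then show ?thesis using n0 C by (simp add: field_simps)
    qed
    have "1 \<le> (ln (real n))\<^sup>2" using lnn by simp
    then have "(C + 2) * (real (d n) * 1) \<le> (C + 2) * (d n * (ln n)\<^sup>2)" using C by (intro mult_left_mono) auto
    then have "(C + 2) * d n \<le> n" using small by simp
    moreover have "2 * real (d n) \<le> (C + 2) * real (d n)" using C by (intro mult_right_mono) auto
    ultimately have n2: "2 * d n \<le> n" by linarith
    have "C * d n * l\<^sup>2 \<le> (C + 2) * (d n * (ln n)\<^sup>2)"
    proof -
      have "l \<le> ln n" using n2 d2 by (simp add: l_def)
      then have "d n * l\<^sup>2 \<le> d n * (ln n)\<^sup>2" using l0 by (intro mult_left_mono power_mono) auto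
      then have "(C + 2) * (d n * l\<^sup>2) \<le> (C + 2) * (d n * (ln n)\<^sup>2)"
        by (rule mult_left_mono) (use C in simp)
      moreover have "C * (d n * l\<^sup>2) \<le> (C + 2) * (d n * l\<^sup>2)" by (rule mult_right_mono) simp_all
      ultimately have "C * (d n * l\<^sup>2) \<le> (C + 2) * (d n * (ln n)\<^sup>2)" by (rule order_trans[rotated])
      then show ?thesis by (simp add: mult.assoc)
    qed
    then have nd: "C * d n * l\<^sup>2 \<le> n" using small by linarith
    \<comment> \<open>A degree below \<open>d0\<close> would give 2 sqrt d0 + 2 \<le> d / lam \<le>
      2 sqrt d \<le> 2 sqrt d0.\<close>
    have dd: "d0 \<le> d n"
    proof (rule ccontr)
      assume "\<not> d0 \<le> d n"
      then have "sqrt (d n) \<le> sqrt d0" by simp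
      moreover have "(2 * sqrt d0 / ln 2 + 2 / ln 2) * ln 2 \<le> (2 * sqrt d0 / ln 2 + 2 / ln 2) * l"
        using l nn by (intro mult_left_mono) auto
      moreover have "(2 * sqrt d0 / ln 2 + 2 / ln 2) * ln 2 = 2 * sqrt d0 + 2" using ln2 by (simp add: field_simps)
      ultimately show False
        using Cl[OF C'_ge(2)] ratio_le_sqrt_degree[OF G lam lamd n2] by linarith
    qed
    have "\<forall>r\<in>pverts (G n). \<exists>k T. (1 - e) * d n \<le> real k \<and> independent_spanning_trees (G n) r k T"
      using main[rule_format, OF G dd lam Cl[OF C'_ge(3), unfolded l_def] nd[unfolded l_def] n2] by blast
    moreover have "(1 - \<epsilon>) * d n \<le> (1 - e) * d n" using e by (intro mult_right_mono) auto
    ultimately show ?case by (meson order_trans)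
  qed
  then show ?thesis
    unfolding eventually_inf_principal eventually_sequentially by blast
qed

end
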